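(* Let $A\in M_n$ with $\det(A)\ge 0$ (that is, $\det(A)$ is a nonnegative real number). If $A=\alpha I_n$ with $\alpha\in\mathbb{C}\setminus[0,\infty)$, then $A$ can be expressed as a product of five positive semi-definite matrices, but not fewer. Otherwise, let $T$ be an upper triangular matrix unitarily similar to $A$ of the form $$T=\begin{bmatrix}T_1 & R\\ 0 & T_2\end{bmatrix},\qquad T_1 \text{ invertible},\quad T_2 \text{ nilpotent}.$$ Then the following hold. (1) If $T$ is a nonnegative diagonal matrix, then $A$ is itself positive semi-definite. (2) If the condition in (1) does not hold and $A$ satisfies any one of the equivalent conditions (P1)--(P5) listed in the context, then $A$ can be expressed as a product of two positive semi-definite matrices, but not fewer. (3) If neither the condition in (1) nor the condition in (2) holds, then $A$ can be expressed as a product of three positive semi-definite matrices, but not fewer, if any of the following holds: (3.a) $R\ne 0$ or $T_2\neq 0$; (3.b) $R=0$ and $T_2=0$, and $T_1$ is the product of three positive definite matrices. In (3.b), the invertible matrix $T_1$ is a product of three positive definite matrices if one of the following holds: (i) $\det(T_1)>0$ and $W(T_1)$ contains $0$ as an interior point; (ii) $0$ is not in the interior of $W(T_1)$, $W(T_1)$ contains a positive number, and $\sum_{j=1}^{k}\theta_j=0$, where $-\pi<\theta_1\le\cdots\le\theta_k<\pi$ are the arguments of the eigenvalues of $T_1\in M_k$ (counted with algebraic multiplicity). (4) If the conditions in (1), (2) and (3) all fail, i.e., (1) and (2) fail, $T=T_1\oplus 0_p$, and neither (i) nor (ii) holds for the upper triangular matrix $T_1$, then $A$ can be expressed as a product of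 four positive semi-definite matrices, but not fewer.
   Context: $M_n$ denotes the set of $n\times n$ complex matrices. Positive semi-definite (respectively positive definite) matrices are complex Hermitian matrices $P$ with $x^*Px\ge 0$ for all vectors $x$ (respectively $x^*Px>0$ for all nonzero $x$). "A product of $k$ positive semi-definite matrices, but not fewer" means that $A$ is a product of $k$ positive semi-definite matrices in $M_n$ and is not a product of $j$ positive semi-definite matrices for any $1\le j<k$. The numerical range of $B\in M_k$ is $W(B)=\{x^*Bx: x\in\mathbb{C}^k,\ x^*x=1\}\subseteq\mathbb{C}$; interior points are taken with respect to the topology of $\mathbb{C}$. In the block form of $T$, the block $T_1$ is absent if $A$ is nilpotent, and the blocks $T_2$ and $R$ are absent if $A$ is invertible (absent blocks are regarded as zero in the conditions $R=0$, $T_2=0$). In (ii), the existence of arguments in $(-\pi,\pi)$ means in particular that $T_1$ has no negative real eigenvalue. The equivalent conditions referred to in (2) are: (P1) $A$ is the product of two positive semi-definite matrices. (P2) $A=BC$, where $B,C$ are positive semi-definite matrices such that $B$ or $C$ is invertible. (P3) $A$ is similar to a nonnegative diagonal matrix (a diagonal matrix with nonnegative real diagonal entries). (P4) $A$ is unitarily similar to an upper block triangular matrix whose diagonal blocks are scalar matrices corresponding to distinct nonnegative scalars. (P5) The minimal polynomial of $A$ has only simple nonnegative zeros. *)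

theory Defs
  imports
    "HOL-Analysis.Analysis"
    "Jordan_Normal_Form.Spectral_Radius"
begin

text \<open>
  Matrices are those of \<^theory>\<open>Jordan_Normal_Form.Matrix\<close>, since block sizes vary inside the
  statement; blocks of size 0 are allowed. The order on \<^typ>\<open>complex\<close> is that of
  \<^theory>\<open>HOL-Library.Complex_Order\<close>: \<open>0 \<le> z\<close> (resp. \<open>0 < z\<close>) says that \<open>z\<close> is a nonnegative
  (resp. positive) real number. \<open>(P *\<^sub>v x) \<bullet>c x\<close> is \<open>x\<^sup>*Px\<close>, as \<open>\<bullet>c\<close> conjugates its second argument.
\<close>

definition psd :: "nat \<Rightarrow> complex mat \<Rightarrow> bool" where
  "psd n P \<longleftrightarrow> P \<in> carrier_mat n n \<and> mat_adjoint P = P \<and>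
     (\<forall>x\<in>carrier_vec n. 0 \<le> (P *\<^sub>v x) \<bullet>c x)"

definition pd :: "nat \<Rightarrow> complex mat \<Rightarrow> bool" where
  "pd n P \<longleftrightarrow> P \<in> carrier_mat n n \<and> mat_adjoint P = P \<and>
     (\<forall>x\<in>carrier_vec n. x \<noteq> 0\<^sub>v n \<longrightarrow> 0 < (P *\<^sub>v x) \<bullet>c x)"

definition psd_product :: "nat \<Rightarrow> nat \<Rightarrow> complex mat \<Rightarrow> bool" where
  "psd_product n k A \<longleftrightarrow>
     (\<exists>Ps. length Ps = k \<and> (\<forall>P\<in>set Ps. psd n P) \<and> A = foldr (*) Ps (1\<^sub>m n))"

definition pd_product :: "nat \<Rightarrow> nat \<Rightarrow> complex mat \<Rightarrow> bool" where
  "pd_product n k A \<longleftrightarrow>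
     (\<exists>Ps. length Ps = k \<and> (\<forall>P\<in>set Ps. pd n P) \<and> A = foldr (*) Ps (1\<^sub>m n))"

definition psd_product_not_fewer :: "nat \<Rightarrow> nat \<Rightarrow> complex mat \<Rightarrow> bool" where
  "psd_product_not_fewer n k A \<longleftrightarrow>
     psd_product n k A \<and> (\<forall>j. 1 \<le> j \<and> j < k \<longrightarrow> \<not> psd_product n j A)"

definition unitary_mat :: "nat \<Rightarrow> complex mat \<Rightarrow> bool" where
  "unitary_mat n U \<longleftrightarrow> U \<in> carrier_mat n n \<and>
     mat_adjoint U * U = 1\<^sub>m n \<and> U * mat_adjoint U = 1\<^sub>m n"

definition unitarily_similar :: "nat \<Rightarrow> complex mat \<Rightarrow> complex mat \<Rightarrow> bool" where
  "unitarily_similar n A B \<longleftrightarrow> A \<in> carrier_mat n n \<and> B \<in> carrier_mat n n \<and>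
     (\<exists>U. unitary_mat n U \<and> A = U * B * mat_adjoint U)"

definition nonneg_diagonal :: "complex mat \<Rightarrow> bool" where
  "nonneg_diagonal D \<longleftrightarrow> square_mat D \<and> diagonal_mat D \<and> (\<forall>i<dim_row D. 0 \<le> D $$ (i, i))"

definition numerical_range :: "complex mat \<Rightarrow> complex set" where
  "numerical_range B = {(B *\<^sub>v x) \<bullet>c x | x. x \<in> carrier_vec (dim_row B) \<and> x \<bullet>c x = 1}"

text \<open>\<open>upper_block_triangular Ds B\<close>: \<open>B\<close> is upper block triangular with diagonal blocks \<open>Ds\<close>.\<close>

fun upper_block_triangular :: "complex mat list \<Rightarrow> complex mat \<Rightarrow> bool" where
  "upper_block_triangular [] B \<longleftrightarrow> B \<in> carrier_mat 0 0"
| "upper_block_triangular (D # Ds) B \<longleftrightarrow>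
     (\<exists>m r X B'. D \<in> carrier_mat m m \<and> X \<in> carrier_mat m r \<and> B' \<in> carrier_mat r r \<and>
        upper_block_triangular Ds B' \<and> B = four_block_mat D X (0\<^sub>m r m) B')"

text \<open>Evaluation of a polynomial at an \<open>n \<times> n\<close> matrix, written entrywise because
  matrices of varying dimension do not form a type with a sum operator.\<close>

definition poly_at_mat :: "nat \<Rightarrow> complex poly \<Rightarrow> complex mat \<Rightarrow> complex mat" where
  "poly_at_mat n q A =
     Matrix.mat n n (\<lambda>(i, j). \<Sum>l\<le>degree q. poly.coeff q l * (A ^\<^sub>m l) $$ (i, j))"

definition is_minimal_polynomial :: "nat \<Rightarrow> complex mat \<Rightarrow> complex poly \<Rightarrow> bool" where
  "is_minimal_polynomial n A q \<longleftrightarrow>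
     lead_coeff q = 1 \<and> poly_at_mat n q A = 0\<^sub>m n n \<and>
     (\<forall>q'. q' \<noteq> 0 \<and> poly_at_mat n q' A = 0\<^sub>m n n \<longrightarrow> degree q \<le> degree q')"

definition cond_P1 :: "nat \<Rightarrow> complex mat \<Rightarrow> bool" where
  "cond_P1 n A \<longleftrightarrow> psd_product n 2 A"

definition cond_P2 :: "nat \<Rightarrow> complex mat \<Rightarrow> bool" where
  "cond_P2 n A \<longleftrightarrow>
     (\<exists>B C. psd n B \<and> psd n C \<and> (invertible_mat B \<or> invertible_mat C) \<and> A = B * C)"

definition cond_P3 :: "complex mat \<Rightarrow> bool" where
  "cond_P3 A \<longleftrightarrow> (\<exists>D. similar_mat A D \<and> nonneg_diagonal D)"

definition cond_P4 :: "nat \<Rightarrow> complex mat \<Rightarrow> bool" where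
  "cond_P4 n A \<longleftrightarrow>
     (\<exists>B bs. unitarily_similar n A B \<and>
        distinct (map snd bs) \<and> (\<forall>(m, c)\<in>set bs. 0 < m \<and> 0 \<le> c) \<and>
        upper_block_triangular (map (\<lambda>(m, c). c \<cdot>\<^sub>m 1\<^sub>m m) bs) B)"

definition cond_P5 :: "nat \<Rightarrow> complex mat \<Rightarrow> bool" where
  "cond_P5 n A \<longleftrightarrow>
     (\<exists>q. is_minimal_polynomial n A q \<and>
        (\<forall>z. poly q z = 0 \<longrightarrow> Polynomial.order z q = 1 \<and> 0 \<le> z))"

definition cond_P :: "nat \<Rightarrow> complex mat \<Rightarrow> bool" where
  "cond_P n A \<longleftrightarrow> cond_P1 n A \<or> cond_P2 n A \<or> cond_P3 A \<or> cond_P4 n A \<or> cond_P5 n A"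

text \<open>\<open>k = 0\<close> (resp. \<open>p = 0\<close>) is the case where \<open>T\<^sub>1\<close> (resp. \<open>R\<close> and \<open>T\<^sub>2\<close>) is absent;
  then \<open>R = 0\<^sub>m k p\<close> (resp. also \<open>T2 = 0\<^sub>m p p\<close>) holds automatically.\<close>

definition triangular_block_form ::
  "nat \<Rightarrow> complex mat \<Rightarrow> complex mat \<Rightarrow> nat \<Rightarrow> nat \<Rightarrow> complex mat \<Rightarrow> complex mat \<Rightarrow> complex mat \<Rightarrow> bool"
  where
  "triangular_block_form n A T k p T1 R T2 \<longleftrightarrow>
     unitarily_similar n A T \<and> upper_triangular T \<and>
     T1 \<in> carrier_mat k k \<and> R \<in> carrier_mat k p \<and> T2 \<in> carrier_mat p p \<and>
     T = four_block_mat T1 R (0\<^sub>m p k) T2 \<and>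
     invertible_mat T1 \<and> (\<exists>m. T2 ^\<^sub>m m = 0\<^sub>m p p)"

definition cond_i :: "complex mat \<Rightarrow> bool" where
  "cond_i T1 \<longleftrightarrow> 0 < Determinant.det T1 \<and> 0 \<in> interior (numerical_range T1)"

text \<open>The list \<open>es\<close> is the list of eigenvalues, repeated by algebraic multiplicity; it is left
  unsorted since only the sum of the arguments matters. \<^const>\<open>Arg\<close> takes values in \<open>(-pi, pi]\<close>,
  so \<open>Arg e < pi\<close> excludes the negative reals.\<close>

definition cond_ii :: "complex mat \<Rightarrow> bool" where
  "cond_ii T1 \<longleftrightarrow>
     0 \<notin> interior (numerical_range T1) \<and>
     (\<exists>r\<in>numerical_range T1. 0 < r) \<and>
     (\<exists>es. char_poly T1 = (\<Prod>e\<leftarrow>es. [:- e, 1:]) \<and>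
        (\<forall>e\<in>set es. - pi < Arg e \<and> Arg e < pi) \<and>
        (\<Sum>e\<leftarrow>es. Arg e) = 0)"

definition cond_3a :: "nat \<Rightarrow> nat \<Rightarrow> complex mat \<Rightarrow> complex mat \<Rightarrow> bool" where
  "cond_3a k p R T2 \<longleftrightarrow> R \<noteq> 0\<^sub>m k p \<or> T2 \<noteq> 0\<^sub>m p p"

definition cond_3b :: "nat \<Rightarrow> nat \<Rightarrow> complex mat \<Rightarrow> complex mat \<Rightarrow> complex mat \<Rightarrow> bool" where
  "cond_3b k p T1 R T2 \<longleftrightarrow> R = 0\<^sub>m k p \<and> T2 = 0\<^sub>m p p \<and> pd_product k 3 T1"

end

theory Submission
  imports Defs
begin

text \<open>
  The question of how many positive semi-definite factors are needed is answered by one criterion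
  and one reduction.

  The criterion: \<open>M\<close> is a product of two positive semi-definite matrices iff it is similar to a
  nonnegative diagonal matrix (\<open>psd_product_2_iff\<close>). A product \<open>B C\<close> has nonnegative eigenvalues and
  no Jordan chain of length two, because the forms \<open>x\<^sup>* C x\<close> and \<open>x\<^sup>* B x\<close> only vanish on kernels;
  conversely \<open>P D P\<^sup>-\<^sup>1 = (P D P\<^sup>*) (P\<^sup>-\<^sup>* P\<^sup>-\<^sup>1)\<close>. The second factor of this factorization is
  positive definite. All the equivalent conditions in \<open>cond_P\<close> amount to the same property.

  The reduction: if some congruence \<open>S\<^sup>* T S\<close> is similar to a nonnegative diagonal matrix, say
  \<open>S\<^sup>* T S = B C\<close>, then \<open>T = (S\<^sup>-\<^sup>* B S\<^sup>-\<^sup>1) (S C S\<^sup>*) (S\<^sup>-\<^sup>* S\<^sup>-\<^sup>1)\<close> has three factors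
  (\<open>congruent_nonneg_factorization\<close>). Such an \<open>S\<close> is built one vector at a time: pick \<open>x\<close> with
  \<open>x\<^sup>* T x > 0\<close> and compress \<open>T\<close> to the hyperplane of all \<open>y\<close> with \<open>y\<^sup>* T x = 0\<close>. The result is
  block triangular, and rescaling \<open>x\<close> makes the new eigenvalue different from all the others
  (\<open>congruent_nonneg_block\<close>). What remains is to choose \<open>x\<close> so that the compression again satisfies the
  hypothesis of the induction. This is done for three hypotheses:

  \<^item> \<open>T\<close> kills a vector that \<open>T\<^sup>*\<close> does not kill (\<open>congruent_nonneg_of_kernel\<close>), which is the case
    when \<open>cond_3a\<close> holds (\<open>kernel_not_adjoint_kernel\<close>);
  \<^item> \<open>T\<close> has positive determinant and \<open>0\<close> is interior to the numerical range, that is, \<open>x\<^sup>* T x\<close> takes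
    all complex values (\<open>congruent_nonneg_of_interior\<close>);
  \<^item> the numerical range lies in a half-plane, contains a positive number, and the arguments of the
    eigenvalues have sum zero (\<open>congruent_nonneg_of_arg_sum\<close>).

  In the last case, and in its converse (\<open>pd_product_3_imp_cond\<close>), the sum of the arguments plays the
  part of a winding number: for \<open>T\<close> in a half-plane and \<open>P\<close> positive definite, \<open>T\<close> and \<open>P T\<close> have the
  same sum (\<open>arg_sum_invariant\<close>). So the sum is a congruence invariant, and for a product of three
  positive definite matrices it is the sum for a product of two, where all eigenvalues are positive.

  Four factors suffice for a nonscalar matrix with positive determinant, since it is a product
  of two matrices similar to nonnegative diagonal ones (\<open>nonscalar_two_factors\<close>), and for
  \<open>T\<^sub>1 \<oplus> 0\<close>, which is a projection times a matrix to which the kernel case applies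
  (\<open>pad_zero_psd_product_4\<close>). A scalar matrix that is not nonnegative needs a fifth factor to make it
  nonscalar.

  As identity factors can be added, a lower bound only concerns the next smaller number of factors.
  If \<open>T\<^sub>1 \<oplus> 0\<close> is a product of three positive semi-definite matrices then \<open>T\<^sub>1\<close> is a product of three
  positive definite ones (\<open>pad_zero_psd_product_3\<close>), and if \<open>\<alpha> I = M N\<close> with \<open>M\<close> and \<open>N\<close> products of
  two factors, then \<open>\<alpha>\<close> is a product of nonnegative eigenvalues of \<open>M\<close> and \<open>N\<close>
  (\<open>scalar_psd_product_4\<close>).
\<close>

section \<open>Adjoints and sesquilinear forms\<close>

lemma adjoint_carrier [simp]: "A \<in> carrier_mat n m \<Longrightarrow> mat_adjoint A \<in> carrier_mat m n"
  for A :: "complex mat"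
  by (auto simp: mat_adjoint_def)

lemma adjoint_dim [simp]: "dim_row (mat_adjoint A) = dim_col A" "dim_col (mat_adjoint A) = dim_row A"
  for A :: "complex mat"
  by (auto simp: mat_adjoint_def)

lemma adjoint_index [simp]:
  "i < dim_col A \<Longrightarrow> j < dim_row A \<Longrightarrow> mat_adjoint A $$ (i, j) = cnj (A $$ (j, i))"
  for A :: "complex mat"
  by (auto simp: mat_adjoint_def mat_of_rows_def)

lemma adjoint_adjoint [simp]: "mat_adjoint (mat_adjoint A) = A" for A :: "complex mat"
  by (rule eq_matI) auto

lemma adjoint_mult:
  fixes A B :: "complex mat"
  assumes "A \<in> carrier_mat n m" "B \<in> carrier_mat m k"
  shows "mat_adjoint (A * B) = mat_adjoint B * mat_adjoint A"
  using assms by (intro eq_matI) (auto simp: scalar_prod_def mult.commute)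

lemma adjoint_one [simp]: "mat_adjoint (1\<^sub>m n) = (1\<^sub>m n :: complex mat)"
  by (rule eq_matI) auto

lemma adjoint_zero [simp]: "mat_adjoint (0\<^sub>m n m) = (0\<^sub>m m n :: complex mat)"
  by (rule eq_matI) auto

lemma adjoint_add:
  fixes A B :: "complex mat"
  assumes "A \<in> carrier_mat n m" "B \<in> carrier_mat n m"
  shows "mat_adjoint (A + B) = mat_adjoint A + mat_adjoint B"
  using assms by (intro eq_matI) auto

lemma adjoint_smult: "mat_adjoint (c \<cdot>\<^sub>m A) = cnj c \<cdot>\<^sub>m mat_adjoint A" for A :: "complex mat"
  by (rule eq_matI) auto

lemma adjoint_four_block:
  fixes A B C D :: "complex mat"
  assumes "A \<in> carrier_mat n1 m1" "B \<in> carrier_mat n1 m2" "C \<in> carrier_mat n2 m1" "D \<in> carrier_mat n2 m2"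
  shows "mat_adjoint (four_block_mat A B C D) =
    four_block_mat (mat_adjoint A) (mat_adjoint C) (mat_adjoint B) (mat_adjoint D)"
  using assms by (intro eq_matI) auto

lemma det_adjoint:
  fixes A :: "complex mat"
  assumes A: "A \<in> carrier_mat n n"
  shows "Determinant.det (mat_adjoint A) = cnj (Determinant.det A)"
proof -
  have "mat_adjoint A = map_mat cnj (transpose_mat A)" using A by (intro eq_matI) auto
  moreover interpret comm_ring_hom cnj by unfold_locales auto
  have "Determinant.det (map_mat cnj (transpose_mat A)) = cnj (Determinant.det (transpose_mat A))"
    by (rule hom_det)
  ultimately show ?thesis using det_transpose[OF A] by simp
qed

lemma adjoint_inner:
  fixes A :: "complex mat"
  assumes "A \<in> carrier_mat n m" "x \<in> carrier_vec m" "y \<in> carrier_vec n"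
  shows "(A *\<^sub>v x) \<bullet>c y = x \<bullet>c (mat_adjoint A *\<^sub>v y)"
proof -
  have "(A *\<^sub>v x) \<bullet>c y = (\<Sum>i<n. \<Sum>j<m. A $$ (i,j) * x $ j * cnj (y $ i))"
    using assms by (auto simp: scalar_prod_def sum_distrib_right lessThan_atLeast0 intro!: sum.cong)
  also have "\<dots> = (\<Sum>j<m. \<Sum>i<n. A $$ (i,j) * x $ j * cnj (y $ i))" by (rule sum.swap)
  also have "\<dots> = x \<bullet>c (mat_adjoint A *\<^sub>v y)"
    using assms by (auto simp: scalar_prod_def sum_distrib_left lessThan_atLeast0 mult_ac intro!: sum.cong)
  finally show ?thesis .
qed

lemma cinner_commute:
  fixes x y :: "complex vec"
  assumes "x \<in> carrier_vec n" "y \<in> carrier_vec n"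
  shows "x \<bullet>c y = cnj (y \<bullet>c x)"
  using assms by (auto simp: scalar_prod_def mult.commute)

lemma cinner_add_left:
  "x \<in> carrier_vec n \<Longrightarrow> y \<in> carrier_vec n \<Longrightarrow> z \<in> carrier_vec n \<Longrightarrow> (x + y) \<bullet>c z = x \<bullet>c z + y \<bullet>c z"
  for x y z :: "complex vec"
  by (rule add_scalar_prod_distrib) auto

lemma cinner_add_right:
  "x \<in> carrier_vec n \<Longrightarrow> y \<in> carrier_vec n \<Longrightarrow> z \<in> carrier_vec n \<Longrightarrow> z \<bullet>c (x + y) = z \<bullet>c x + z \<bullet>c y"
  for x y z :: "complex vec"
  by (subst conjugate_add_vec[of _ n]) (auto intro!: scalar_prod_add_distrib)

lemma cinner_smult_left:
  "x \<in> carrier_vec n \<Longrightarrow> z \<in> carrier_vec n \<Longrightarrow> (c \<cdot>\<^sub>v x) \<bullet>c z = c * (x \<bullet>c z)"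
  for x z :: "complex vec"
  by auto

lemma cinner_smult_right:
  "x \<in> carrier_vec n \<Longrightarrow> z \<in> carrier_vec n \<Longrightarrow> z \<bullet>c (c \<cdot>\<^sub>v x) = cnj c * (z \<bullet>c x)"
  for x z :: "complex vec"
  by (simp add: conjugate_smult_vec)

lemma cinner_self:
  fixes x :: "complex vec"
  assumes "x \<in> carrier_vec n"
  shows "x \<bullet>c x = of_real (Re (x \<bullet>c x))" "0 \<le> Re (x \<bullet>c x)" "x \<noteq> 0\<^sub>v n \<Longrightarrow> 0 < Re (x \<bullet>c x)"
proof -
  have ge: "0 \<le> x \<bullet>c x" by (rule conjugate_square_ge_0_vec)
  then show "x \<bullet>c x = of_real (Re (x \<bullet>c x))" "0 \<le> Re (x \<bullet>c x)"
    by (auto simp: less_eq_complex_def complex_eq_iff)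
  show "0 < Re (x \<bullet>c x)" if "x \<noteq> 0\<^sub>v n"
    using conjugate_square_greater_0_vec[OF assms] that by (auto simp: less_complex_def)
qed

text \<open>
  The value is \<open>x\<^sup>* T y\<close>: conjugate linear in \<open>x\<close> and linear in \<open>y\<close>.
\<close>
definition sesq :: "complex mat \<Rightarrow> complex vec \<Rightarrow> complex vec \<Rightarrow> complex" where
  "sesq T x y = (T *\<^sub>v y) \<bullet>c x"

context
  fixes T :: "complex mat" and n :: nat
  assumes T: "T \<in> carrier_mat n n"
begin

lemma sesq_add_left:
  "x \<in> carrier_vec n \<Longrightarrow> y \<in> carrier_vec n \<Longrightarrow> z \<in> carrier_vec n \<Longrightarrow> sesq T (x + y) z = sesq T x z + sesq T y z"
  unfolding sesq_def using T by (intro cinner_add_right) auto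

lemma sesq_add_right:
  "x \<in> carrier_vec n \<Longrightarrow> y \<in> carrier_vec n \<Longrightarrow> z \<in> carrier_vec n \<Longrightarrow> sesq T z (x + y) = sesq T z x + sesq T z y"
  unfolding sesq_def using T by (subst mult_add_distrib_mat_vec[OF T]) (auto intro!: cinner_add_left)

lemma sesq_smult_left:
  "x \<in> carrier_vec n \<Longrightarrow> z \<in> carrier_vec n \<Longrightarrow> sesq T (c \<cdot>\<^sub>v x) z = cnj c * sesq T x z"
  unfolding sesq_def using T by (intro cinner_smult_right) auto

lemma sesq_smult_right:
  "x \<in> carrier_vec n \<Longrightarrow> z \<in> carrier_vec n \<Longrightarrow> sesq T z (c \<cdot>\<^sub>v x) = c * sesq T z x"
  unfolding sesq_def using T by (subst mult_mat_vec[OF T]) (auto intro!: cinner_smult_left)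

lemma sesq_adjoint:
  "x \<in> carrier_vec n \<Longrightarrow> y \<in> carrier_vec n \<Longrightarrow> sesq (mat_adjoint T) x y = cnj (sesq T y x)"
  unfolding sesq_def using adjoint_inner[OF T, of x y] adjoint_carrier[OF T]
  by (subst cinner_commute[of _ n]) (auto intro!: mult_mat_vec_carrier)

lemmas sesq_bilinear = sesq_add_left sesq_add_right sesq_smult_left sesq_smult_right

end

lemma sesq_congruence:
  assumes T: "T \<in> carrier_mat n n" and S: "S \<in> carrier_mat n m"
    and "x \<in> carrier_vec m" "y \<in> carrier_vec m"
  shows "sesq (mat_adjoint S * T * S) x y = sesq T (S *\<^sub>v x) (S *\<^sub>v y)"
proof -
  have "(mat_adjoint S * T * S) *\<^sub>v y = mat_adjoint S *\<^sub>v (T *\<^sub>v (S *\<^sub>v y))"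
  proof -
    note Sa = adjoint_carrier[OF S]
    have "(mat_adjoint S * T * S) *\<^sub>v y = (mat_adjoint S * T) *\<^sub>v (S *\<^sub>v y)"
      using S T Sa assms by (intro assoc_mult_mat_vec[of _ m n]) auto
    also have "\<dots> = mat_adjoint S *\<^sub>v (T *\<^sub>v (S *\<^sub>v y))"
      using S T Sa assms by (intro assoc_mult_mat_vec[of _ m n _ n]) auto
    finally show ?thesis .
  qed
  then show ?thesis unfolding sesq_def
    using adjoint_inner[of "mat_adjoint S" m n "T *\<^sub>v (S *\<^sub>v y)" x] assms by auto
qed

lemma sesq_unit:
  assumes "T \<in> carrier_mat n n" "i < n" "j < n"
  shows "sesq T (unit_vec n i) (unit_vec n j) = T $$ (i, j)"
proof -
  have "conjugate (unit_vec n i) = (unit_vec n i :: complex vec)"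
    by (rule eq_vecI) (auto simp: unit_vec_def)
  then show ?thesis using assms by (simp add: sesq_def)
qed

lemma sesq_cong:
  assumes "T \<in> carrier_mat n n" "T' \<in> carrier_mat n n"
    "\<And>x y. x \<in> carrier_vec n \<Longrightarrow> y \<in> carrier_vec n \<Longrightarrow> sesq T x y = sesq T' x y"
  shows "T = T'"
  using assms by (intro eq_matI) (auto simp: sesq_unit[symmetric])

lemma psd_sesq: "psd n P \<longleftrightarrow> P \<in> carrier_mat n n \<and> mat_adjoint P = P \<and> (\<forall>x\<in>carrier_vec n. 0 \<le> sesq P x x)"
  by (simp add: psd_def sesq_def)

lemma pd_sesq: "pd n P \<longleftrightarrow> P \<in> carrier_mat n n \<and> mat_adjoint P = P \<and>
   (\<forall>x\<in>carrier_vec n. x \<noteq> 0\<^sub>v n \<longrightarrow> 0 < sesq P x x)"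
  by (simp add: pd_def sesq_def)

section \<open>Positive (semi-)definite matrices\<close>

lemma psd_carrier: "psd n P \<Longrightarrow> P \<in> carrier_mat n n" by (simp add: psd_def)
lemma pd_carrier: "pd n P \<Longrightarrow> P \<in> carrier_mat n n" by (simp add: pd_def)

lemma pd_imp_psd: "pd n P \<Longrightarrow> psd n P"
proof -
  assume "pd n P"
  then have "0 \<le> (P *\<^sub>v x) \<bullet>c x" if "x \<in> carrier_vec n" for x
    using that by (cases "x = 0\<^sub>v n") (auto simp: pd_def order.strict_iff_order)
  then show ?thesis using \<open>pd n P\<close> by (auto simp: psd_def pd_def)
qed

lemma pd_one: "pd n (1\<^sub>m n)"
  by (auto simp: pd_def)

lemma psd_one: "psd n (1\<^sub>m n)"
  by (simp add: pd_imp_psd pd_one)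

lemma psd_congruence:
  assumes "psd n P" and S: "S \<in> carrier_mat n m"
  shows "psd m (mat_adjoint S * P * S)"
proof -
  note P = psd_carrier[OF assms(1)]
  have "mat_adjoint (mat_adjoint S * P * S) = mat_adjoint S * mat_adjoint P * S"
    using P S adjoint_carrier[OF S] adjoint_carrier[OF P]
      adjoint_mult[OF mult_carrier_mat[OF adjoint_carrier[OF S] P] S] adjoint_mult[OF adjoint_carrier[OF S] P]
    by (simp add: assoc_mult_mat[of _ m n _ n _ m])
  then show ?thesis using assms P S
    by (auto simp: psd_sesq sesq_congruence[OF P S])
qed

text \<open>
  Otherwise the form would be negative at \<open>x - t P x\<close> for small \<open>t > 0\<close>.
\<close>
lemma psd_zero_form_imp_kernel:
  assumes P: "psd n P" and x: "x \<in> carrier_vec n" and 0: "sesq P x x = 0"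
  shows "P *\<^sub>v x = 0\<^sub>v n"
proof (rule ccontr)
  assume ne: "P *\<^sub>v x \<noteq> 0\<^sub>v n"
  have Pc: "P \<in> carrier_mat n n" and herm: "mat_adjoint P = P" using P by (auto simp: psd_def)
  define y where "y = P *\<^sub>v x"
  have y: "y \<in> carrier_vec n" using Pc x by (auto simp: y_def)
  define a where "a = Re (y \<bullet>c y)"
  have a: "y \<bullet>c y = of_real a" "0 < a" using cinner_self[OF y] ne by (auto simp: a_def y_def)
  have yx: "sesq P y x = of_real a" by (simp add: sesq_def y_def[symmetric] a)
  have xy: "sesq P x y = of_real a" using sesq_adjoint[OF Pc x y] herm yx by simp
  define b where "b = Re (sesq P y y)"
  have "0 \<le> sesq P y y" using P y by (auto simp: psd_sesq)
  then have b: "sesq P y y = of_real b" "0 \<le> b" by (auto simp: b_def less_eq_complex_def complex_eq_iff)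
  define t where "t = a / (b + 1)"
  have t: "0 < t" "t * b < a" using a b by (auto simp: t_def field_simps)
  have "0 \<le> sesq P (x + (- of_real t) \<cdot>\<^sub>v y) (x + (- of_real t) \<cdot>\<^sub>v y)"
    using P x y by (auto simp: psd_sesq)
  also have "\<dots> = of_real (- 2 * t * a + t * t * b)"
    using x y by (simp add: sesq_bilinear[OF Pc] 0 yx xy b algebra_simps)
  finally have "0 \<le> - 2 * t * a + t * t * b" by (simp add: less_eq_complex_def)
  moreover have "t * (t * b) < t * a" "0 < t * a" using t a by (auto intro: mult_strict_left_mono)
  ultimately show False by (simp add: mult.assoc)
qed

lemma pd_iff_psd_det: "pd n P \<longleftrightarrow> psd n P \<and> Determinant.det P \<noteq> 0"
proof (intro iffI conjI)
  assume P: "pd n P"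
  then show "psd n P" by (rule pd_imp_psd)
  show "Determinant.det P \<noteq> 0"
  proof
    assume "Determinant.det P = 0"
    then obtain v where "v \<in> carrier_vec n" "v \<noteq> 0\<^sub>v n" "P *\<^sub>v v = 0\<^sub>v n"
      using det_0_iff_vec_prod_zero[OF pd_carrier[OF P]] by auto
    moreover then have "0 < (P *\<^sub>v v) \<bullet>c v" using P by (auto simp: pd_def)
    ultimately show False by simp
  qed
next
  assume P: "psd n P \<and> Determinant.det P \<noteq> 0"
  then have Pc: "P \<in> carrier_mat n n" by (simp add: psd_def)
  have "0 < sesq P x x" if "x \<in> carrier_vec n" "x \<noteq> 0\<^sub>v n" for x
  proof -
    have "sesq P x x \<noteq> 0"
      using psd_zero_form_imp_kernel[of n P x] P that det_0_iff_vec_prod_zero[OF Pc] by auto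
    moreover have "0 \<le> sesq P x x" using P that by (auto simp: psd_sesq)
    ultimately show ?thesis by (simp add: order.strict_iff_order)
  qed
  then show "pd n P" using P by (auto simp: pd_sesq psd_def)
qed

section \<open>Products of positive semi-definite matrices\<close>

lemma mult_carrier_sq [simp]:
  "A \<in> carrier_mat n n \<Longrightarrow> B \<in> carrier_mat n n \<Longrightarrow> A * B \<in> carrier_mat n n"
  by auto

lemma foldr_mult_carrier:
  assumes "\<forall>P\<in>set Ps. P \<in> carrier_mat n n"
  shows "foldr (*) Ps (1\<^sub>m n) \<in> carrier_mat n n"
  using assms by (induction Ps) auto

lemma foldr_mult_append:
  fixes Ps Qs :: "complex mat list"
  assumes "\<forall>P\<in>set Ps. P \<in> carrier_mat n n" "\<forall>P\<in>set Qs. P \<in> carrier_mat n n"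
  shows "foldr (*) (Ps @ Qs) (1\<^sub>m n) = foldr (*) Ps (1\<^sub>m n) * foldr (*) Qs (1\<^sub>m n)"
  using assms
proof (induction Ps)
  case Nil
  then show ?case using foldr_mult_carrier[of Qs n] by simp
next
  case (Cons P Ps)
  then show ?case using foldr_mult_carrier[of Ps n] foldr_mult_carrier[of Qs n]
    by (simp add: assoc_mult_mat[of _ n n _ n _ n])
qed

lemma psd_product_carrier: "psd_product n k A \<Longrightarrow> A \<in> carrier_mat n n"
  unfolding psd_product_def using foldr_mult_carrier psd_carrier by blast

lemma psd_product_mult:
  assumes "psd_product n j A" "psd_product n k B"
  shows "psd_product n (j + k) (A * B)"
proof -
  obtain Ps Qs where *: "length Ps = j" "\<forall>P\<in>set Ps. psd n P" "A = foldr (*) Ps (1\<^sub>m n)"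
    "length Qs = k" "\<forall>P\<in>set Qs. psd n P" "B = foldr (*) Qs (1\<^sub>m n)"
    using assms unfolding psd_product_def by blast
  then have "A * B = foldr (*) (Ps @ Qs) (1\<^sub>m n)"
    by (subst foldr_mult_append) (auto simp: psd_carrier)
  then show ?thesis unfolding psd_product_def using * by (intro exI[of _ "Ps @ Qs"]) auto
qed

lemma psd_product_1: "psd_product n 1 A \<longleftrightarrow> psd n A"
proof
  assume "psd_product n 1 A"
  then show "psd n A" by (auto simp: psd_product_def length_Suc_conv) (metis psd_carrier right_mult_one_mat)
next
  assume "psd n A"
  then show "psd_product n 1 A" unfolding psd_product_def
    by (intro exI[of _ "[A]"]) (auto dest: psd_carrier)
qed

lemma psd_product_2:
  assumes "psd n B" "psd n C"
  shows "psd_product n 2 (B * C)"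
  using psd_product_mult[of n 1 B 1 C] assms unfolding psd_product_1 by (simp add: numeral_2_eq_2)

lemma psd_product_2E:
  assumes "psd_product n 2 A"
  obtains B C where "psd n B" "psd n C" "A = B * C"
proof -
  obtain Ps where *: "length Ps = 2" "\<forall>P\<in>set Ps. psd n P" "A = foldr (*) Ps (1\<^sub>m n)"
    using assms unfolding psd_product_def by blast
  then obtain B C where "Ps = [B, C]" by (auto simp: numeral_2_eq_2 length_Suc_conv)
  then show thesis using * that[of B C] psd_carrier[of n C] by auto
qed

lemma psd_product_3E:
  assumes "psd_product n 3 A"
  obtains B C D where "psd n B" "psd n C" "psd n D" "A = B * (C * D)"
proof -
  obtain Ps where *: "length Ps = 3" "\<forall>P\<in>set Ps. psd n P" "A = foldr (*) Ps (1\<^sub>m n)"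
    using assms unfolding psd_product_def by blast
  then obtain B C D where "Ps = [B, C, D]" by (auto simp: numeral_3_eq_3 length_Suc_conv)
  then show thesis using * that[of B C D] psd_carrier[of n D] by auto
qed

lemma pd_product_3:
  "pd_product n 3 A \<longleftrightarrow> (\<exists>B C D. pd n B \<and> pd n C \<and> pd n D \<and> A = B * (C * D))"
proof
  assume "pd_product n 3 A"
  then obtain Ps where *: "length Ps = 3" "\<forall>P\<in>set Ps. pd n P" "A = foldr (*) Ps (1\<^sub>m n)"
    unfolding pd_product_def by blast
  then obtain B C D where "Ps = [B, C, D]" by (auto simp: numeral_3_eq_3 length_Suc_conv)
  then show "\<exists>B C D. pd n B \<and> pd n C \<and> pd n D \<and> A = B * (C * D)" using * pd_carrier[of n D] by auto
next
  assume "\<exists>B C D. pd n B \<and> pd n C \<and> pd n D \<and> A = B * (C * D)"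
  then obtain B C D where "pd n B" "pd n C" "pd n D" "A = B * (C * D)" by blast
  then show "pd_product n 3 A" unfolding pd_product_def using pd_carrier[of n D]
    by (intro exI[of _ "[B, C, D]"]) auto
qed

text \<open>
  Identity factors fill up the product.
\<close>
lemma psd_product_mono:
  assumes "psd_product n j A" "j \<le> k"
  shows "psd_product n k A"
proof -
  have one: "psd_product n i (1\<^sub>m n)" for i
  proof (induction i)
    case 0
    then show ?case unfolding psd_product_def by (intro exI[of _ "[]"]) auto
  next
    case (Suc i)
    have "psd_product n (1 + i) (1\<^sub>m n * 1\<^sub>m n)"
      by (rule psd_product_mult) (use Suc psd_one psd_product_1 in blast)+
    then show ?case by simp
  qed
  have "psd_product n (j + (k - j)) (A * 1\<^sub>m n)"
    by (rule psd_product_mult[OF assms(1) one])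
  then show ?thesis using assms psd_product_carrier[OF assms(1)] by simp
qed

lemma unitary_adjoint: "unitary_mat n U \<Longrightarrow> unitary_mat n (mat_adjoint U)"
  by (auto simp: unitary_mat_def)

lemma psd_unitary_similar:
  assumes "unitary_mat n U" "psd n P"
  shows "psd n (U * P * mat_adjoint U)"
  using psd_congruence[OF assms(2), of "mat_adjoint U"] assms(1) by (auto simp: unitary_mat_def)

lemma psd_product_unitary_similar:
  assumes U: "unitary_mat n U" and A: "psd_product n k A"
  shows "psd_product n k (U * A * mat_adjoint U)"
proof -
  have Uc: "U \<in> carrier_mat n n" "mat_adjoint U \<in> carrier_mat n n"
    and UU: "mat_adjoint U * U = 1\<^sub>m n" "U * mat_adjoint U = 1\<^sub>m n"
    using U by (auto simp: unitary_mat_def)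
  obtain Ps where Ps: "length Ps = k" "\<forall>P\<in>set Ps. psd n P" "A = foldr (*) Ps (1\<^sub>m n)"
    using A unfolding psd_product_def by blast
  have "U * foldr (*) Ps (1\<^sub>m n) * mat_adjoint U = foldr (*) (map (\<lambda>P. U * P * mat_adjoint U) Ps) (1\<^sub>m n)"
    using Ps(2)
  proof (induction Ps)
    case Nil
    then show ?case using Uc UU by simp
  next
    case (Cons P Ps)
    let ?F = "foldr (*) Ps (1\<^sub>m n)"
    have F: "?F \<in> carrier_mat n n" and P: "P \<in> carrier_mat n n"
      using Cons.prems foldr_mult_carrier[of Ps n] by (auto simp: psd_carrier)
    have "(U * P * mat_adjoint U) * (U * ?F * mat_adjoint U) = U * P * (mat_adjoint U * U) * ?F * mat_adjoint U"
      using Uc F P by (simp add: assoc_mult_mat[of _ n n _ n _ n])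
    also have "\<dots> = U * (P * ?F) * mat_adjoint U"
      using Uc F P UU by (simp add: assoc_mult_mat[of _ n n _ n _ n])
    finally show ?case using Cons by simp
  qed
  then show ?thesis unfolding psd_product_def using Ps psd_unitary_similar[OF U]
    by (intro exI[of _ "map (\<lambda>P. U * P * mat_adjoint U) Ps"]) auto
qed

lemma unitarily_similar_sym:
  assumes "unitarily_similar n A B"
  shows "unitarily_similar n B A"
proof -
  obtain U where U: "unitary_mat n U" and AB: "A = U * B * mat_adjoint U"
    and A: "A \<in> carrier_mat n n" and B: "B \<in> carrier_mat n n"
    using assms unfolding unitarily_similar_def by blast
  have Uc: "U \<in> carrier_mat n n" "mat_adjoint U \<in> carrier_mat n n"
    and UU: "mat_adjoint U * U = 1\<^sub>m n" "U * mat_adjoint U = 1\<^sub>m n"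
    using U by (auto simp: unitary_mat_def)
  have "mat_adjoint U * A * U = (mat_adjoint U * U) * B * (mat_adjoint U * U)"
    unfolding AB using Uc B by (simp add: assoc_mult_mat[of _ n n _ n _ n])
  also have "\<dots> = B" using UU B by simp
  finally show ?thesis unfolding unitarily_similar_def using A B unitary_adjoint[OF U]
    by (intro conjI exI[of _ "mat_adjoint U"]) auto
qed

lemma psd_product_unitarily_similar:
  assumes "unitarily_similar n A B"
  shows "psd_product n k A \<longleftrightarrow> psd_product n k B"
  using assms unitarily_similar_sym[OF assms] psd_product_unitary_similar
  unfolding unitarily_similar_def by metis

section \<open>Similarity to a nonnegative diagonal matrix\<close>

lemma cond_P3E:
  assumes "cond_P3 M" "M \<in> carrier_mat n n"
  obtains D P Q where "D \<in> carrier_mat n n" "P \<in> carrier_mat n n" "Q \<in> carrier_mat n n"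
    "P * Q = 1\<^sub>m n" "Q * P = 1\<^sub>m n" "M = P * D * Q" "diagonal_mat D" "\<And>i. i < n \<Longrightarrow> 0 \<le> D $$ (i, i)"
proof -
  obtain D where D: "similar_mat M D" "nonneg_diagonal D" using assms unfolding cond_P3_def by blast
  then obtain P Q where "similar_mat_wit M D P Q" unfolding similar_mat_def by blast
  note w = similar_mat_witD2[OF assms(2) this]
  have "0 \<le> D $$ (i, i)" if "i < n" for i
    using D(2) carrier_matD(1)[OF w(5)] that unfolding nonneg_diagonal_def by metis
  moreover have "diagonal_mat D" using D(2) unfolding nonneg_diagonal_def by blast
  ultimately show thesis by (intro that[OF w(5-7) w(1-3)])
qed

lemma similar_mat_carrier:
  assumes "similar_mat A B" "A \<in> carrier_mat n n"
  shows "B \<in> carrier_mat n n"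
  using assms(1) similar_mat_witD2(5)[OF assms(2)] unfolding similar_mat_def by blast

lemma zero_mult_vec: "A \<in> carrier_mat n m \<Longrightarrow> A *\<^sub>v 0\<^sub>v m = 0\<^sub>v n" for A :: "complex mat"
  by (rule eq_vecI) (auto simp: scalar_prod_def)

lemma zero_mat_mult_vec: "v \<in> carrier_vec m \<Longrightarrow> 0\<^sub>m n m *\<^sub>v v = 0\<^sub>v n" for v :: "complex vec"
  by (rule eq_vecI) (auto simp: scalar_prod_def)

lemma smult_vec_eq_0D: "c \<cdot>\<^sub>v v = 0\<^sub>v n \<Longrightarrow> c \<noteq> 0 \<Longrightarrow> v \<in> carrier_vec n \<Longrightarrow> v = 0\<^sub>v n" for v :: "complex vec"
proof -
  assume *: "c \<cdot>\<^sub>v v = 0\<^sub>v n" "c \<noteq> 0" "v \<in> carrier_vec n"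
  have "c * v $ i = 0" if "i < n" for i
    using * that by (metis carrier_vecD index_smult_vec(1) index_zero_vec(1))
  then show "v = 0\<^sub>v n" using * by (intro eq_vecI) auto
qed

lemma cond_P3_similar: "similar_mat A B \<Longrightarrow> cond_P3 B \<Longrightarrow> cond_P3 A"
  unfolding cond_P3_def using similar_mat_trans by blast

lemma diagonal_mat_mult_vec_index:
  assumes "D \<in> carrier_mat n n" "diagonal_mat D" "v \<in> carrier_vec n" "i < n"
  shows "(D *\<^sub>v v) $ i = D $$ (i, i) * v $ i"
proof -
  have "(D *\<^sub>v v) $ i = (\<Sum>j<n. D $$ (i, j) * v $ j)"
    using assms by (auto simp: scalar_prod_def lessThan_atLeast0 intro!: sum.cong)
  also have "\<dots> = (\<Sum>j<n. if j = i then D $$ (i, i) * v $ i else 0)"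
    using assms by (intro sum.cong) (auto simp: diagonal_mat_def)
  finally show ?thesis using assms by simp
qed

text \<open>
  The equations \<open>M v = \<lambda> v + w\<close> and \<open>M w = \<lambda> w\<close> say that \<open>v\<close>, \<open>w\<close> is a Jordan chain of
  length two, so the first condition says that all Jordan blocks are trivial.
\<close>
definition nonneg_semisimple :: "nat \<Rightarrow> complex mat \<Rightarrow> bool" where
  "nonneg_semisimple n M \<longleftrightarrow>
    (\<forall>c. \<forall>v\<in>carrier_vec n. \<forall>w\<in>carrier_vec n. M *\<^sub>v v = c \<cdot>\<^sub>v v + w \<and> M *\<^sub>v w = c \<cdot>\<^sub>v w \<longrightarrow> w = 0\<^sub>v n) \<and>
    (\<forall>c. \<forall>v\<in>carrier_vec n. v \<noteq> 0\<^sub>v n \<and> M *\<^sub>v v = c \<cdot>\<^sub>v v \<longrightarrow> 0 \<le> c)"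

lemma nonneg_semisimpleD1:
  "nonneg_semisimple n M \<Longrightarrow> M *\<^sub>v v = c \<cdot>\<^sub>v v + w \<Longrightarrow> M *\<^sub>v w = c \<cdot>\<^sub>v w \<Longrightarrow>
    v \<in> carrier_vec n \<Longrightarrow> w \<in> carrier_vec n \<Longrightarrow> w = 0\<^sub>v n"
  unfolding nonneg_semisimple_def by blast

lemma nonneg_semisimpleD2:
  "nonneg_semisimple n M \<Longrightarrow> M *\<^sub>v v = c \<cdot>\<^sub>v v \<Longrightarrow> v \<noteq> 0\<^sub>v n \<Longrightarrow> v \<in> carrier_vec n \<Longrightarrow> 0 \<le> c"
  unfolding nonneg_semisimple_def by blast

text \<open>For an injective linear \<open>f\<close> this is restriction to an invariant subspace or, if \<open>k = n\<close>, similarity.\<close>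
lemma nonneg_semisimple_intertwine:
  fixes M N :: "complex mat"
  assumes ss: "nonneg_semisimple n M" and N: "N \<in> carrier_mat k k"
    and f: "\<And>v. v \<in> carrier_vec k \<Longrightarrow> f v \<in> carrier_vec n"
    and add: "\<And>v w. v \<in> carrier_vec k \<Longrightarrow> w \<in> carrier_vec k \<Longrightarrow> f (v + w) = f v + f w"
    and smult: "\<And>c v. v \<in> carrier_vec k \<Longrightarrow> f (c \<cdot>\<^sub>v v) = c \<cdot>\<^sub>v f v"
    and inj: "\<And>v. v \<in> carrier_vec k \<Longrightarrow> f v = 0\<^sub>v n \<Longrightarrow> v = 0\<^sub>v k"
    and comm: "\<And>v. v \<in> carrier_vec k \<Longrightarrow> M *\<^sub>v f v = f (N *\<^sub>v v)"
  shows "nonneg_semisimple k N"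
  unfolding nonneg_semisimple_def
proof (intro conjI allI ballI impI)
  fix c v w assume v: "v \<in> carrier_vec k" and w: "w \<in> carrier_vec k" and *: "N *\<^sub>v v = c \<cdot>\<^sub>v v + w \<and> N *\<^sub>v w = c \<cdot>\<^sub>v w"
  have "f w = 0\<^sub>v n"
    using nonneg_semisimpleD1[OF ss, of "f v" c "f w"] * v w f by (simp add: comm add smult)
  then show "w = 0\<^sub>v k" by (rule inj[OF w])
next
  fix c v assume v: "v \<in> carrier_vec k" and *: "v \<noteq> 0\<^sub>v k \<and> N *\<^sub>v v = c \<cdot>\<^sub>v v"
  then show "0 \<le> c" using nonneg_semisimpleD2[OF ss, of "f v" c] inj[OF v] f[OF v] by (auto simp: comm smult)
qed

lemma nonneg_semisimple_similar:
  assumes "similar_mat A B" "A \<in> carrier_mat n n" "nonneg_semisimple n A"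
  shows "nonneg_semisimple n B"
proof -
  obtain P Q where "similar_mat_wit A B P Q" using assms(1) unfolding similar_mat_def by blast
  note w = similar_mat_witD2[OF assms(2) this]
  have AP: "A *\<^sub>v (P *\<^sub>v v) = P *\<^sub>v (B *\<^sub>v v)" if "v \<in> carrier_vec n" for v
  proof -
    have "A * P = P * B * (Q * P)" unfolding w(3) using w(4-7)
      by (simp add: assoc_mult_mat[of _ n n _ n _ n])
    then have "A * P = P * B" using w by simp
    then show ?thesis using w that assoc_mult_mat_vec[of A n n P n v] assoc_mult_mat_vec[of P n n B n v] by simp
  qed
  show ?thesis
  proof (rule nonneg_semisimple_intertwine[OF assms(3) w(5), of "\<lambda>v. P *\<^sub>v v"])
    show "v = 0\<^sub>v n" if "v \<in> carrier_vec n" "P *\<^sub>v v = 0\<^sub>v n" for v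
      using assoc_mult_mat_vec[OF w(7,6) that(1)] that zero_mult_vec[OF w(7)] unfolding w(2) by simp
  qed (use w(6) AP in \<open>auto simp: mult_add_distrib_mat_vec[of P n n] mult_mat_vec[of P n n]\<close>)
qed

lemma nonneg_diagonal_semisimple:
  assumes D: "D \<in> carrier_mat n n" "nonneg_diagonal D"
  shows "nonneg_semisimple n D"
proof -
  have diag: "diagonal_mat D" and nn: "\<And>i. i < n \<Longrightarrow> 0 \<le> D $$ (i, i)"
    using D by (auto simp: nonneg_diagonal_def)
  note Di = diagonal_mat_mult_vec_index[OF D(1) diag]
  show ?thesis unfolding nonneg_semisimple_def
  proof (intro conjI allI ballI impI)
    fix c v w assume *: "v \<in> carrier_vec n" "w \<in> carrier_vec n" "D *\<^sub>v v = c \<cdot>\<^sub>v v + w \<and> D *\<^sub>v w = c \<cdot>\<^sub>v w"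
    show "w = 0\<^sub>v n"
    proof (rule eq_vecI)
      fix i assume i: "i < dim_vec (0\<^sub>v n :: complex vec)"
      have "(D *\<^sub>v v) $ i = c * v $ i + w $ i" "(D *\<^sub>v w) $ i = c * w $ i" using * i by auto
      then show "w $ i = 0\<^sub>v n $ i" using Di[of v i] Di[of w i] * i by auto
    qed (use * in auto)
  next
    fix c v assume *: "v \<in> carrier_vec n" "v \<noteq> 0\<^sub>v n \<and> D *\<^sub>v v = c \<cdot>\<^sub>v v"
    then obtain i where i: "i < n" "v $ i \<noteq> 0" by (metis carrier_vecD eq_vecI index_zero_vec)
    have "(D *\<^sub>v v) $ i = c * v $ i" using * i by auto
    then show "0 \<le> c" using Di[of v i] * i nn[of i] by auto
  qed
qed

text \<open>
  The first two unit vectors of a Jordan block of size at least two form a Jordan chain, so all blocks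
  have size at most one.
\<close>
lemma jordan_matrix_semisimple_diagonal:
  assumes "nonneg_semisimple (sum_list (map fst n_as)) (jordan_matrix n_as)"
  shows "nonneg_diagonal (jordan_matrix n_as)"
  using assms
proof (induction n_as)
  case Nil
  then show ?case by (auto simp: nonneg_diagonal_def diagonal_mat_def jordan_matrix_def)
next
  case (Cons na n_as)
  obtain m a where na: "na = (m, a)" by force
  define k where "k = sum_list (map fst n_as)"
  define J where "J = jordan_matrix n_as"
  let ?B = "jordan_block m a"
  have J: "J \<in> carrier_mat k k" by (simp add: J_def k_def)
  have JJ: "jordan_matrix (na # n_as) = four_block_mat ?B (0\<^sub>m m k) (0\<^sub>m k m) J"
    by (simp add: na jordan_matrix_Cons J_def k_def)
  have ss: "nonneg_semisimple (m + k) (four_block_mat ?B (0\<^sub>m m k) (0\<^sub>m k m) J)"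
    using Cons.prems JJ by (simp add: na k_def)
  have mv: "four_block_mat ?B (0\<^sub>m m k) (0\<^sub>m k m) J *\<^sub>v (x @\<^sub>v y) = ?B *\<^sub>v x @\<^sub>v J *\<^sub>v y"
    if "x \<in> carrier_vec m" "y \<in> carrier_vec k" for x y
    using J that by (intro mult_mat_vec_split) auto
  have app0: "x @\<^sub>v y = 0\<^sub>v (m + k) \<longleftrightarrow> x = 0\<^sub>v m \<and> y = 0\<^sub>v k"
    if "x \<in> carrier_vec m" "y \<in> carrier_vec k" for x y :: "complex vec"
  proof -
    have "0\<^sub>v (m + k) = 0\<^sub>v m @\<^sub>v 0\<^sub>v k" by (rule eq_vecI) auto
    then show ?thesis using that by (metis append_vec_eq zero_carrier_vec)
  qed
  have c0: "c \<cdot>\<^sub>v 0\<^sub>v j = 0\<^sub>v j" for c :: complex and j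
    by (rule eq_vecI) auto
  have sm: "c \<cdot>\<^sub>v (x @\<^sub>v y) = c \<cdot>\<^sub>v x @\<^sub>v c \<cdot>\<^sub>v y" for c and x y :: "complex vec"
    by (rule eq_vecI) auto
  have ad: "(x @\<^sub>v y) + (x' @\<^sub>v y') = (x + x') @\<^sub>v (y + y')"
    if "x \<in> carrier_vec m" "x' \<in> carrier_vec m" "y \<in> carrier_vec k" "y' \<in> carrier_vec k" for x y x' y' :: "complex vec"
    using that by (intro append_vec_add) auto
  have z: "0\<^sub>v m \<in> carrier_vec m" "0\<^sub>v k \<in> carrier_vec k" by auto
  have B0: "?B *\<^sub>v 0\<^sub>v m = 0\<^sub>v m" by (rule eq_vecI) (auto simp: scalar_prod_def)
  have "nonneg_semisimple k J"
    by (rule nonneg_semisimple_intertwine[OF ss J, of "\<lambda>v. 0\<^sub>v m @\<^sub>v v"])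
      (use z app0 in \<open>auto simp: mv sm ad B0 c0\<close>)
  then have dJ: "nonneg_diagonal J" using Cons.IH by (simp add: J_def k_def)
  have J0: "J *\<^sub>v 0\<^sub>v k = 0\<^sub>v k" using J by (intro eq_vecI) (auto simp: scalar_prod_def)
  have ev: "?B *\<^sub>v unit_vec m 0 = a \<cdot>\<^sub>v unit_vec m 0" if "0 < m"
    using that by (intro eq_vecI) (auto simp: jordan_block_def)
  have "m \<le> 1"
  proof (rule ccontr)
    assume "\<not> m \<le> 1"
    then have m: "1 < m" by simp
    have "?B *\<^sub>v unit_vec m 1 = a \<cdot>\<^sub>v unit_vec m 1 + unit_vec m 0"
      using m by (intro eq_vecI) (auto simp: jordan_block_def)
    then have "four_block_mat ?B (0\<^sub>m m k) (0\<^sub>m k m) J *\<^sub>v (unit_vec m 1 @\<^sub>v 0\<^sub>v k) =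
        a \<cdot>\<^sub>v (unit_vec m 1 @\<^sub>v 0\<^sub>v k) + (unit_vec m 0 @\<^sub>v 0\<^sub>v k)"
      "four_block_mat ?B (0\<^sub>m m k) (0\<^sub>m k m) J *\<^sub>v (unit_vec m 0 @\<^sub>v 0\<^sub>v k) = a \<cdot>\<^sub>v (unit_vec m 0 @\<^sub>v 0\<^sub>v k)"
      using ev m z by (simp_all add: mv sm ad J0 c0)
    then have "unit_vec m 0 @\<^sub>v 0\<^sub>v k = (0\<^sub>v (m + k) :: complex vec)"
      by (rule nonneg_semisimpleD1[OF ss]) auto
    then show False using app0[of "unit_vec m 0" "0\<^sub>v k"] m by (auto simp: vec_eq_iff unit_vec_def)
  qed
  moreover have "0 \<le> a" if "0 < m"
  proof -
    have "four_block_mat ?B (0\<^sub>m m k) (0\<^sub>m k m) J *\<^sub>v (unit_vec m 0 @\<^sub>v 0\<^sub>v k) = a \<cdot>\<^sub>v (unit_vec m 0 @\<^sub>v 0\<^sub>v k)"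
      using ev that z by (simp add: mv sm J0 c0)
    moreover have "unit_vec m 0 @\<^sub>v 0\<^sub>v k \<noteq> 0\<^sub>v (m + k)"
      using app0[of "unit_vec m 0" "0\<^sub>v k"] that by (auto simp: vec_eq_iff unit_vec_def)
    ultimately show ?thesis by (rule nonneg_semisimpleD2[OF ss]) auto
  qed
  ultimately show ?case using dJ J unfolding JJ nonneg_diagonal_def diagonal_mat_def
    by (auto simp: jordan_block_def)
qed

theorem cond_P3_iff_nonneg_semisimple:
  assumes M: "M \<in> carrier_mat n n"
  shows "cond_P3 M \<longleftrightarrow> nonneg_semisimple n M"
proof
  assume "cond_P3 M"
  then obtain D where D: "similar_mat M D" "nonneg_diagonal D" unfolding cond_P3_def by blast
  have Dc: "D \<in> carrier_mat n n" using similar_mat_carrier[OF D(1) M] .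
  show "nonneg_semisimple n M"
    by (rule nonneg_semisimple_similar[OF similar_mat_sym[OF D(1)] Dc nonneg_diagonal_semisimple[OF Dc D(2)]])
next
  assume ss: "nonneg_semisimple n M"
  obtain as where as: "char_poly M = (\<Prod>a\<leftarrow>as. [:- a, 1:])" using char_poly_factorized[OF M] by blast
  obtain n_as where "jordan_nf M n_as" using jordan_nf_exists[OF M as] by blast
  then have sim: "similar_mat M (jordan_matrix n_as)" unfolding jordan_nf_def by simp
  let ?J = "jordan_matrix n_as"
  have Jc: "?J \<in> carrier_mat n n" by (rule similar_mat_carrier[OF sim M])
  have n: "sum_list (map fst n_as) = n" using carrier_matD(1)[OF Jc] unfolding jordan_matrix_dim .
  have "nonneg_diagonal ?J"
    by (rule jordan_matrix_semisimple_diagonal, unfold n, rule nonneg_semisimple_similar[OF sim M ss])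
  then show "cond_P3 M" using sim unfolding cond_P3_def by (intro exI[of _ ?J] conjI)
qed

lemma divide_nonneg_nonneg_complex:
  fixes a b :: complex
  assumes "0 \<le> a" "0 \<le> b"
  shows "0 \<le> a / b"
proof -
  have "Im a = 0" "Im b = 0" "0 \<le> Re a" "0 \<le> Re b"
    using assms by (auto simp: less_eq_complex_def)
  then show ?thesis
    by (simp add: less_eq_complex_def Re_divide Im_divide)
qed

text \<open>
  If \<open>B C v = c v\<close> then \<open>(C v)\<^sup>* B (C v) = c v\<^sup>* C v\<close>, which shows \<open>c\<close> as a quotient of nonnegative numbers. For a chain
  \<open>B C v = c v + w\<close>, \<open>B C w = c w\<close>, moving \<open>C B C\<close> from \<open>w\<close> to \<open>v\<close> in the form gives \<open>w\<^sup>* C w = 0\<close>,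
  so \<open>C w = 0\<close>; for \<open>c \<noteq> 0\<close> this forces \<open>w = 0\<close>, and for \<open>c = 0\<close> the vector \<open>w = B C v\<close> has
  \<open>(C v)\<^sup>* B (C v) = 0\<close> and vanishes too.
\<close>
lemma psd_mult_semisimple:
  assumes B: "psd n B" and C: "psd n C"
  shows "nonneg_semisimple n (B * C)"
proof -
  note Bc = psd_carrier[OF B] and Cc = psd_carrier[OF C]
  have adj: "mat_adjoint B = B" "mat_adjoint C = C" using B C by (auto simp: psd_def)
  have M: "(B * C) *\<^sub>v v = B *\<^sub>v (C *\<^sub>v v)" if "v \<in> carrier_vec n" for v
    using assoc_mult_mat_vec[OF Bc Cc that] .
  have nz: "0 \<le> c" "sesq C v v \<noteq> 0" if "v \<in> carrier_vec n" "v \<noteq> 0\<^sub>v n" "c \<noteq> 0" "B *\<^sub>v (C *\<^sub>v v) = c \<cdot>\<^sub>v v" for c v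
  proof -
    have Cv: "C *\<^sub>v v \<in> carrier_vec n" using Cc that by auto
    show ne: "sesq C v v \<noteq> 0"
    proof
      assume "sesq C v v = 0"
      then have "C *\<^sub>v v = 0\<^sub>v n" using psd_zero_form_imp_kernel[OF C that(1)] by simp
      then have "c \<cdot>\<^sub>v v = 0\<^sub>v n" using that(4) zero_mult_vec[OF Bc] by simp
      then have "v = 0\<^sub>v n" using smult_vec_eq_0D that(1,3) by blast
      then show False using that(2) by simp
    qed
    have "sesq B (C *\<^sub>v v) (C *\<^sub>v v) = c * sesq C v v"
      unfolding sesq_def that(4) using adjoint_inner[OF Cc that(1) that(1)] adj(2) Cv that(1)
      by (simp add: cinner_smult_left[of _ n])
    moreover have "0 \<le> sesq B (C *\<^sub>v v) (C *\<^sub>v v)" "0 \<le> sesq C v v"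
      using B C Cv that(1) by (auto simp: psd_sesq)
    ultimately have "0 \<le> c * sesq C v v / sesq C v v" using ne
      by (metis divide_nonneg_nonneg_complex)
    then show "0 \<le> c" using ne by simp
  qed
  show ?thesis unfolding nonneg_semisimple_def
  proof (intro conjI allI ballI impI)
    fix c v w assume v: "v \<in> carrier_vec n" and w: "w \<in> carrier_vec n"
      and eq: "(B * C) *\<^sub>v v = c \<cdot>\<^sub>v v + w \<and> (B * C) *\<^sub>v w = c \<cdot>\<^sub>v w"
    have Cv: "C *\<^sub>v v \<in> carrier_vec n" "C *\<^sub>v w \<in> carrier_vec n" using Cc v w by auto
    show "w = 0\<^sub>v n"
    proof (cases "c = 0")
      case True
      have wv: "w = B *\<^sub>v (C *\<^sub>v v)" and Mw: "B *\<^sub>v (C *\<^sub>v w) = 0\<^sub>v n"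
        using eq M[OF v] M[OF w] v w True by auto
      have "sesq C w w = (C *\<^sub>v w) \<bullet>c (B *\<^sub>v (C *\<^sub>v v))" unfolding sesq_def wv ..
      also have "\<dots> = (B *\<^sub>v (C *\<^sub>v w)) \<bullet>c (C *\<^sub>v v)"
        using adjoint_inner[OF Bc Cv(2) Cv(1)] adj by simp
      finally have "sesq C w w = 0" using Mw Cv by simp
      then have "C *\<^sub>v w = 0\<^sub>v n" using psd_zero_form_imp_kernel[OF C w] by simp
      then have "w \<bullet>c (C *\<^sub>v v) = 0" using adjoint_inner[OF Cc w v] adj v by simp
      then have "sesq B (C *\<^sub>v v) (C *\<^sub>v v) = 0" unfolding sesq_def wv[symmetric] .
      then show ?thesis using psd_zero_form_imp_kernel[OF B Cv(1)] wv by simp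
    next
      case False
      show ?thesis
      proof (rule ccontr)
        assume ne: "w \<noteq> 0\<^sub>v n"
        have Mw: "B *\<^sub>v (C *\<^sub>v w) = c \<cdot>\<^sub>v w" and Mv: "B *\<^sub>v (C *\<^sub>v v) = c \<cdot>\<^sub>v v + w"
          using eq M v w by auto
        note nz = nz[OF w ne False Mw]
        have "c * ((C *\<^sub>v w) \<bullet>c v) + 0 = (C *\<^sub>v (c \<cdot>\<^sub>v w)) \<bullet>c v"
          using Cv v w by (simp add: mult_mat_vec[OF Cc] cinner_smult_left[of _ n])
        also have "\<dots> = (B *\<^sub>v (C *\<^sub>v w)) \<bullet>c (C *\<^sub>v v)"
          unfolding Mw using adjoint_inner[OF Cc, of "c \<cdot>\<^sub>v w" v] adj v w by simp
        also have "\<dots> = (C *\<^sub>v w) \<bullet>c (c \<cdot>\<^sub>v v + w)"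
          unfolding Mv[symmetric] using adjoint_inner[OF Bc Cv(2) Cv(1)] adj by simp
        also have "\<dots> = cnj c * ((C *\<^sub>v w) \<bullet>c v) + sesq C w w"
          using Cv v w by (simp add: cinner_add_right[of _ n] cinner_smult_right[of _ n] sesq_def)
        finally have "c * ((C *\<^sub>v w) \<bullet>c v) = cnj c * ((C *\<^sub>v w) \<bullet>c v) + sesq C w w" by simp
        moreover have "cnj c = c" using nz(1) by (simp add: less_eq_complex_def complex_eq_iff)
        ultimately show False using nz(2) by simp
      qed
    qed
  next
    fix c v assume v: "v \<in> carrier_vec n" "v \<noteq> 0\<^sub>v n \<and> (B * C) *\<^sub>v v = c \<cdot>\<^sub>v v"
    then show "0 \<le> c" using nz(1)[of v c] M by (cases "c = 0") auto
  qed
qed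

lemma nonneg_diagonal_psd:
  assumes D: "D \<in> carrier_mat n n" and nn: "nonneg_diagonal D"
  shows "psd n D"
proof -
  have diag: "diagonal_mat D" and pos: "\<And>i. i < n \<Longrightarrow> 0 \<le> D $$ (i, i)"
    using D nn unfolding nonneg_diagonal_def by auto
  have Da: "mat_adjoint D = D"
  proof (rule eq_matI)
    fix i j assume *: "i < dim_row D" "j < dim_col D"
    show "mat_adjoint D $$ (i, j) = D $$ (i, j)"
      using * D diag pos[of i] by (cases "i = j") (auto simp: diagonal_mat_def less_eq_complex_def complex_eq_iff)
  qed (use D in auto)
  show ?thesis unfolding psd_def
  proof (intro conjI ballI)
    fix x :: "complex vec" assume x: "x \<in> carrier_vec n"
    have "(D *\<^sub>v x) \<bullet>c x = (\<Sum>i<n. D $$ (i, i) * (x $ i * cnj (x $ i)))"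
      using x D by (auto simp: scalar_prod_def[of "D *\<^sub>v x"] diagonal_mat_mult_vec_index[OF D diag x]
        lessThan_atLeast0 simp del: index_mult_mat_vec intro!: sum.cong)
    also have "0 \<le> \<dots>"
    proof (rule sum_nonneg)
      fix i assume "i \<in> {..<n}"
      moreover have "0 \<le> x $ i * cnj (x $ i)" by (simp add: less_eq_complex_def)
      ultimately show "0 \<le> D $$ (i, i) * (x $ i * cnj (x $ i))"
        using pos[of i] mult_nonneg_nonneg[of "D $$ (i, i)" "x $ i * cnj (x $ i)"] by simp
    qed
    finally show "0 \<le> (D *\<^sub>v x) \<bullet>c x" .
  qed (use D Da in auto)
qed

text \<open>If \<open>M = P D P\<^sup>-\<^sup>1\<close> then \<open>M = (P D P\<^sup>*) (P\<^sup>-\<^sup>* P\<^sup>-\<^sup>1)\<close>.\<close>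
lemma cond_P3_factorization:
  assumes "cond_P3 M" and M: "M \<in> carrier_mat n n"
  shows "\<exists>B C. psd n B \<and> pd n C \<and> M = B * C"
proof -
  obtain D P Q where D: "D \<in> carrier_mat n n" and P: "P \<in> carrier_mat n n"
    and Q: "Q \<in> carrier_mat n n"
    and PQ: "P * Q = 1\<^sub>m n" "Q * P = 1\<^sub>m n" "M = P * D * Q" "diagonal_mat D" "\<And>i. i < n \<Longrightarrow> 0 \<le> D $$ (i, i)"
    using assms by (rule cond_P3E) blast
  have "psd n D" using D PQ(4,5) by (intro nonneg_diagonal_psd) (auto simp: nonneg_diagonal_def)
  then have "psd n (P * D * mat_adjoint P)"
    using psd_congruence[of n D "mat_adjoint P" n] P by simp
  moreover have "pd n (mat_adjoint Q * Q)"
  proof -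
    have "psd n (mat_adjoint Q * 1\<^sub>m n * Q)" by (rule psd_congruence[OF psd_one Q])
    moreover have "Determinant.det (mat_adjoint Q * Q) \<noteq> 0"
    proof -
      have "Determinant.det P * Determinant.det Q = 1" using det_mult[OF P Q] PQ(1) by simp
      then have "Determinant.det Q \<noteq> 0" by auto
      then show ?thesis unfolding det_mult[OF adjoint_carrier[OF Q] Q] det_adjoint[OF Q] by simp
    qed
    ultimately show ?thesis using right_mult_one_mat[OF adjoint_carrier[OF Q]] unfolding pd_iff_psd_det by metis
  qed
  moreover have "M = (P * D * mat_adjoint P) * (mat_adjoint Q * Q)"
  proof -
    have "mat_adjoint P * mat_adjoint Q = 1\<^sub>m n" using adjoint_mult[OF Q P] PQ(2) by simp
    moreover have "(P * D * mat_adjoint P) * (mat_adjoint Q * Q) = P * D * (mat_adjoint P * mat_adjoint Q) * Q"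
      using P D Q adjoint_carrier[OF P] adjoint_carrier[OF Q] by (simp add: assoc_mult_mat[of _ n n _ n _ n])
    ultimately show ?thesis using P D Q PQ(3) by simp
  qed
  ultimately show ?thesis by blast
qed

theorem psd_product_2_iff:
  assumes "M \<in> carrier_mat n n"
  shows "psd_product n 2 M \<longleftrightarrow> cond_P3 M"
proof
  assume "psd_product n 2 M"
  then show "cond_P3 M" using psd_mult_semisimple cond_P3_iff_nonneg_semisimple[OF assms]
    by (metis psd_product_2E)
next
  assume "cond_P3 M"
  then show "psd_product n 2 M" using cond_P3_factorization[OF _ assms] psd_product_2 pd_imp_psd by metis
qed

section \<open>Conditions on the blocks and on the minimal polynomial\<close>

lemma mult_diagonal_index:
  fixes q D :: "complex mat"
  assumes "q \<in> carrier_mat m r" "D \<in> carrier_mat r r" "diagonal_mat D" "i < m" "j < r"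
  shows "(q * D) $$ (i, j) = q $$ (i, j) * D $$ (j, j)"
proof -
  have "(q * D) $$ (i, j) = (\<Sum>k<r. q $$ (i, k) * D $$ (k, j))"
    using assms by (auto simp: scalar_prod_def lessThan_atLeast0 intro!: sum.cong)
  also have "\<dots> = (\<Sum>k<r. if k = j then q $$ (i, j) * D $$ (j, j) else 0)"
    using assms by (intro sum.cong) (auto simp: diagonal_mat_def)
  finally show ?thesis using assms by simp
qed

text \<open>The off-diagonal block is removed by solving \<open>q D - c q = X\<close> entrywise.\<close>
lemma scalar_block_similar:
  fixes M D X :: "complex mat"
  assumes M: "M \<in> carrier_mat r r" and sim: "similar_mat M D" and diag: "diagonal_mat D"
    and X: "X \<in> carrier_mat m r" and c: "\<And>j. j < r \<Longrightarrow> D $$ (j, j) \<noteq> c"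
  shows "similar_mat (four_block_mat (c \<cdot>\<^sub>m 1\<^sub>m m) X (0\<^sub>m r m) M)
    (four_block_mat (c \<cdot>\<^sub>m 1\<^sub>m m) (0\<^sub>m m r) (0\<^sub>m r m) D)"
proof -
  have D: "D \<in> carrier_mat r r" by (rule similar_mat_carrier[OF sim M])
  let ?c = "c \<cdot>\<^sub>m 1\<^sub>m m"
  have cc: "?c \<in> carrier_mat m m" by simp
  obtain Y where Y: "Y \<in> carrier_mat m r"
    and s1: "similar_mat (four_block_mat ?c X (0\<^sub>m r m) M) (four_block_mat ?c Y (0\<^sub>m r m) D)"
    using similar_mat_four_block_0_ex[OF similar_mat_refl[OF cc] sim X cc M] by blast
  define q where "q = Matrix.mat m r (\<lambda>(i, j). Y $$ (i, j) / (D $$ (j, j) - c))"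
  have q: "q \<in> carrier_mat m r" by (simp add: q_def)
  let ?P = "four_block_mat (1\<^sub>m m) q (0\<^sub>m r m) (1\<^sub>m r)"
  let ?Q = "four_block_mat (1\<^sub>m m) (- q) (0\<^sub>m r m) (1\<^sub>m r)"
  let ?K = "four_block_mat ?c (0\<^sub>m m r) (0\<^sub>m r m) D"
  have [simp]: "q + - q = 0\<^sub>m m r" "- 0\<^sub>m r r + 1\<^sub>m r = (1\<^sub>m r :: complex mat)"
    using q by (auto intro!: eq_matI)
  have [simp]: "- q + q = 0\<^sub>m m r" using q by (auto intro!: eq_matI)
  have PQ: "?P * ?Q = 1\<^sub>m (m + r)"
    by (subst mult_four_block_mat[of _ m m _ r _ r _ _ m _ r]) (use q in auto)
  have QP: "?Q * ?P = 1\<^sub>m (m + r)"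
    by (subst mult_four_block_mat[of _ m m _ r _ r _ _ m _ r]) (use q in auto)
  have PK: "?P * ?K = four_block_mat ?c (q * D) (0\<^sub>m r m) D"
    by (subst mult_four_block_mat[of _ m m _ r _ r _ _ m _ r]) (use q D in auto)
  have "?P * ?K * ?Q = four_block_mat ?c (?c * (- q) + q * D) (0\<^sub>m r m) D"
    unfolding PK by (subst mult_four_block_mat[of _ m m _ r _ r _ _ m _ r]) (use q D in auto)
  also have "?c * (- q) + q * D = Y"
  proof (rule eq_matI)
    fix i j assume "i < dim_row Y" "j < dim_col Y"
    then have ij: "i < m" "j < r" using Y by auto
    have "(?c * (- q)) $$ (i, j) = - c * q $$ (i, j)"
      using ij q by (simp add: mult_smult_assoc_mat[of _ m m _ r])
    moreover have "D $$ (j, j) - c \<noteq> 0" using c[OF ij(2)] by simp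
    ultimately show "(?c * (- q) + q * D) $$ (i, j) = Y $$ (i, j)"
      using ij q D mult_diagonal_index[OF q D diag ij] by (simp add: q_def field_simps)
  qed (use Y q D in auto)
  finally have "similar_mat (four_block_mat ?c Y (0\<^sub>m r m) D) ?K"
    by (intro similar_matI[of _ _ ?P ?Q "m + r"] PQ QP) (use q D Y in auto)
  then show ?thesis using s1 similar_mat_trans by blast
qed

lemma diagonal_four_block:
  assumes "A \<in> carrier_mat m m" "D \<in> carrier_mat r r" "diagonal_mat A" "diagonal_mat D"
  shows "diagonal_mat (four_block_mat A (0\<^sub>m m r) (0\<^sub>m r m) D)"
  using assms unfolding diagonal_mat_def by auto

text \<open>
  The exceptional scalars are the eigenvalues of \<open>M\<close>.
\<close>
lemma cond_P3_border_finite: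
  assumes "cond_P3 M" and M: "M \<in> carrier_mat r r"
  shows "\<exists>F. finite F \<and> (\<forall>c. 0 \<le> c \<and> c \<notin> F \<longrightarrow> (\<forall>m. \<forall>X\<in>(carrier_mat m r :: complex mat set).
    cond_P3 (four_block_mat (c \<cdot>\<^sub>m 1\<^sub>m m) X (0\<^sub>m r m) M)))"
proof -
  obtain D where sim: "similar_mat M D" and nn: "nonneg_diagonal D" using assms unfolding cond_P3_def by blast
  have D: "D \<in> carrier_mat r r" by (rule similar_mat_carrier[OF sim M])
  have diag: "diagonal_mat D" using nn unfolding nonneg_diagonal_def by blast
  have nnD: "0 \<le> D $$ (i, i)" if "i < r" for i
    using nn D that unfolding nonneg_diagonal_def by auto
  show ?thesis
  proof (intro exI[of _ "(\<lambda>i. D $$ (i, i)) ` {..<r}"] conjI allI impI ballI)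
    fix c m and X :: "complex mat" assume c: "0 \<le> c \<and> c \<notin> (\<lambda>i. D $$ (i, i)) ` {..<r}" and X: "X \<in> carrier_mat m r"
    have ne: "D $$ (j, j) \<noteq> c" if "j < r" for j using c that by auto
    have "nonneg_diagonal (four_block_mat (c \<cdot>\<^sub>m 1\<^sub>m m) (0\<^sub>m m r) (0\<^sub>m r m) D)"
      unfolding nonneg_diagonal_def
      using diagonal_four_block[of "c \<cdot>\<^sub>m 1\<^sub>m m" m D r] D diag nnD c
      by (auto simp: diagonal_mat_def)
    then show "cond_P3 (four_block_mat (c \<cdot>\<^sub>m 1\<^sub>m m) X (0\<^sub>m r m) M)"
      using scalar_block_similar[OF M sim diag X ne] unfolding cond_P3_def by blast
  qed simp
qed

lemma cond_P3_border:
  assumes "cond_P3 M" and M: "M \<in> carrier_mat r r"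
  shows "\<exists>b. \<forall>c>b. \<forall>m. \<forall>X\<in>(carrier_mat m r :: complex mat set).
    cond_P3 (four_block_mat (complex_of_real c \<cdot>\<^sub>m 1\<^sub>m m) X (0\<^sub>m r m) M)"
proof -
  obtain F where F: "finite F" "\<And>c m X. 0 \<le> c \<Longrightarrow> c \<notin> F \<Longrightarrow> X \<in> (carrier_mat m r :: complex mat set) \<Longrightarrow>
      cond_P3 (four_block_mat (c \<cdot>\<^sub>m 1\<^sub>m m) X (0\<^sub>m r m) M)"
    using cond_P3_border_finite[OF assms] by blast
  obtain b where b: "\<And>x. x \<in> F \<Longrightarrow> norm x \<le> b" using finite_imp_bounded[OF F(1)] unfolding bounded_iff by blast
  have "complex_of_real c \<notin> F" if "max 0 b < c" for c using b[of "complex_of_real c"] that by auto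
  then show ?thesis using F(2) by (intro exI[of _ "max 0 b"] allI impI ballI) (auto simp: less_eq_complex_def)
qed

text \<open>
  As the scalars are distinct, \<open>scalar_block_similar\<close> splits off one block after the other.
\<close>
lemma scalar_blocks_diagonalizable:
  assumes "upper_block_triangular (map (\<lambda>(m, c). c \<cdot>\<^sub>m 1\<^sub>m m) bs) B" "distinct (map snd bs)"
  shows "\<exists>r D. B \<in> carrier_mat r r \<and> similar_mat B D \<and> diagonal_mat D \<and> (\<forall>i<r. D $$ (i, i) \<in> snd ` set bs)"
  using assms
proof (induction bs arbitrary: B)
  case Nil
  then show ?case by (intro exI[of _ 0] exI[of _ B]) (auto simp: diagonal_mat_def similar_mat_refl)
next
  case (Cons b bs)
  obtain k c where b: "b = (k, c)" by force
  obtain m r X B' where 1: "c \<cdot>\<^sub>m 1\<^sub>m k \<in> carrier_mat m m" and X: "X \<in> carrier_mat m r"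
    and B': "B' \<in> carrier_mat r r" and ubt: "upper_block_triangular (map (\<lambda>(m, c). c \<cdot>\<^sub>m 1\<^sub>m m) bs) B'"
    and B: "B = four_block_mat (c \<cdot>\<^sub>m 1\<^sub>m k) X (0\<^sub>m r m) B'"
    using Cons.prems(1) unfolding b by auto
  have k: "k = m" using carrier_matD(1)[OF 1] by simp
  obtain r' D where "B' \<in> carrier_mat r' r'" and sim: "similar_mat B' D" and diag: "diagonal_mat D"
    and D': "\<forall>i<r'. D $$ (i, i) \<in> snd ` set bs"
    using Cons.IH[OF ubt] Cons.prems(2) by auto
  have r': "r' = r" using B' \<open>B' \<in> carrier_mat r' r'\<close> by (metis carrier_matD(1))
  have D: "D \<in> carrier_mat r r" by (rule similar_mat_carrier[OF sim B'])
  have ne: "D $$ (j, j) \<noteq> c" if "j < r" for j using D' that Cons.prems(2) r' by (auto simp: b)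
  let ?K = "four_block_mat (c \<cdot>\<^sub>m 1\<^sub>m m) (0\<^sub>m m r) (0\<^sub>m r m) D"
  have "B \<in> carrier_mat (m + r) (m + r)" unfolding B k using B' by auto
  moreover have "similar_mat B ?K" unfolding B k by (rule scalar_block_similar[OF B' sim diag X ne])
  moreover have "diagonal_mat ?K" using D diag
    by (intro diagonal_four_block) (auto simp: diagonal_mat_def)
  moreover have "\<forall>i<m + r. ?K $$ (i, i) \<in> snd ` set (b # bs)" using D D' r' by (auto simp: b)
  ultimately show ?case by blast
qed

lemma unitarily_similar_imp_similar:
  assumes "unitarily_similar n A B"
  shows "similar_mat A B"
proof -
  obtain U where U: "unitary_mat n U" and AB: "A = U * B * mat_adjoint U"
    and "A \<in> carrier_mat n n" "B \<in> carrier_mat n n"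
    using assms unfolding unitarily_similar_def by blast
  then show ?thesis
    by (intro similar_matI[of _ _ U "mat_adjoint U" n]) (auto simp: unitary_mat_def)
qed

lemma cond_P4_imp_P3:
  assumes "cond_P4 n A"
  shows "cond_P3 A"
proof -
  obtain B bs where AB: "unitarily_similar n A B" and bs: "distinct (map snd bs)"
    "\<forall>(m, c)\<in>set bs. 0 < m \<and> 0 \<le> c" and ubt: "upper_block_triangular (map (\<lambda>(m, c). c \<cdot>\<^sub>m 1\<^sub>m m) bs) B"
    using assms unfolding cond_P4_def by blast
  obtain r D where B: "B \<in> carrier_mat r r" and sim: "similar_mat B D" and diag: "diagonal_mat D"
    and D: "\<forall>i<r. D $$ (i, i) \<in> snd ` set bs"
    using scalar_blocks_diagonalizable[OF ubt bs(1)] by blast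
  have Dc: "D \<in> carrier_mat r r" by (rule similar_mat_carrier[OF sim B])
  have "nonneg_diagonal D" unfolding nonneg_diagonal_def using Dc diag D bs(2) by fastforce
  moreover have "similar_mat A D"
    using unitarily_similar_imp_similar[OF AB] sim by (rule similar_mat_trans)
  ultimately show ?thesis unfolding cond_P3_def by blast
qed

lemma poly_pderiv_altdef:
  fixes q :: "complex poly"
  shows "poly (pderiv q) x = (\<Sum>l\<le>degree q. poly.coeff q l * (of_nat l * x ^ (l - 1)))"
proof -
  have "((\<lambda>x. \<Sum>l\<le>degree q. poly.coeff q l * x ^ l) has_field_derivative
     (\<Sum>l\<le>degree q. poly.coeff q l * (of_nat l * x ^ (l - 1)))) (at x)"
    by (auto intro!: derivative_eq_intros sum.cong)
  then have "(poly q has_field_derivative (\<Sum>l\<le>degree q. poly.coeff q l * (of_nat l * x ^ (l - 1)))) (at x)"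
    by (simp add: poly_altdef[abs_def])
  then show ?thesis using poly_DERIV[of q x] DERIV_unique by blast
qed

lemma jordan_chain_pow:
  fixes A :: "complex mat"
  assumes A: "A \<in> carrier_mat n n" and v: "v \<in> carrier_vec n" and w: "w \<in> carrier_vec n"
    and Av: "A *\<^sub>v v = c \<cdot>\<^sub>v v + w" and Aw: "A *\<^sub>v w = c \<cdot>\<^sub>v w"
  shows "A ^\<^sub>m l *\<^sub>v v = c ^ l \<cdot>\<^sub>v v + (of_nat l * c ^ (l - 1)) \<cdot>\<^sub>v w \<and> A ^\<^sub>m l *\<^sub>v w = c ^ l \<cdot>\<^sub>v w"
proof (induction l)
  case 0
  show ?case using A v w by auto
next
  case (Suc l)
  have Al: "A ^\<^sub>m l \<in> carrier_mat n n" using A by simp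
  have step: "A ^\<^sub>m Suc l *\<^sub>v x = A ^\<^sub>m l *\<^sub>v (A *\<^sub>v x)" if "x \<in> carrier_vec n" for x
    using assoc_mult_mat_vec[OF Al A that] by simp
  have "A ^\<^sub>m Suc l *\<^sub>v w = c ^ Suc l \<cdot>\<^sub>v w"
    unfolding step[OF w] Aw using Suc w mult_mat_vec[OF Al w, of c] by (simp add: smult_smult_assoc mult.commute)
  moreover have "A ^\<^sub>m Suc l *\<^sub>v v = c ^ Suc l \<cdot>\<^sub>v v + (of_nat (Suc l) * c ^ l) \<cdot>\<^sub>v w"
  proof -
    have "A ^\<^sub>m Suc l *\<^sub>v v = c \<cdot>\<^sub>v (A ^\<^sub>m l *\<^sub>v v) + A ^\<^sub>m l *\<^sub>v w"
      unfolding step[OF v] Av using v w mult_mat_vec[OF Al v, of c]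
      by (subst mult_add_distrib_mat_vec[OF Al]) auto
    also have "\<dots> = c ^ Suc l \<cdot>\<^sub>v v + (of_nat (Suc l) * c ^ l) \<cdot>\<^sub>v w"
    proof (rule eq_vecI)
      fix i assume "i < dim_vec (c ^ Suc l \<cdot>\<^sub>v v + (of_nat (Suc l) * c ^ l) \<cdot>\<^sub>v w)"
      then have i: "i < n" using w by auto
      show "(c \<cdot>\<^sub>v (A ^\<^sub>m l *\<^sub>v v) + A ^\<^sub>m l *\<^sub>v w) $ i =
          (c ^ Suc l \<cdot>\<^sub>v v + (of_nat (Suc l) * c ^ l) \<cdot>\<^sub>v w) $ i"
        unfolding conjunct1[OF Suc] conjunct2[OF Suc] using i v w by (cases l) (auto simp: algebra_simps)
    qed (use w A v Al in auto)
    finally show ?thesis .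
  qed
  ultimately show ?case by simp
qed

text \<open>Taylor's formula on a Jordan chain.\<close>
lemma poly_at_mat_jordan_chain:
  fixes A :: "complex mat"
  assumes A: "A \<in> carrier_mat n n" and v: "v \<in> carrier_vec n" and w: "w \<in> carrier_vec n"
    and Av: "A *\<^sub>v v = c \<cdot>\<^sub>v v + w" and Aw: "A *\<^sub>v w = c \<cdot>\<^sub>v w"
  shows "poly_at_mat n q A *\<^sub>v v = poly q c \<cdot>\<^sub>v v + poly (pderiv q) c \<cdot>\<^sub>v w"
proof (rule eq_vecI)
  fix i assume "i < dim_vec (poly q c \<cdot>\<^sub>v v + poly (pderiv q) c \<cdot>\<^sub>v w)"
  then have i: "i < n" using w by auto
  have "(poly_at_mat n q A *\<^sub>v v) $ i = (\<Sum>j<n. (\<Sum>l\<le>degree q. poly.coeff q l * (A ^\<^sub>m l) $$ (i, j)) * v $ j)"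
    using i v by (auto simp: poly_at_mat_def scalar_prod_def lessThan_atLeast0 intro!: sum.cong)
  also have "\<dots> = (\<Sum>l\<le>degree q. \<Sum>j<n. poly.coeff q l * (A ^\<^sub>m l) $$ (i, j) * v $ j)"
    by (subst sum.swap) (simp add: sum_distrib_right)
  also have "\<dots> = (\<Sum>l\<le>degree q. poly.coeff q l * (A ^\<^sub>m l *\<^sub>v v) $ i)"
  proof (rule sum.cong[OF refl])
    fix l
    have "A ^\<^sub>m l \<in> carrier_mat n n" using A by simp
    then have "(A ^\<^sub>m l *\<^sub>v v) $ i = (\<Sum>j<n. (A ^\<^sub>m l) $$ (i, j) * v $ j)"
      using i v A by (auto simp: scalar_prod_def lessThan_atLeast0 intro!: sum.cong)
    then show "(\<Sum>j<n. poly.coeff q l * (A ^\<^sub>m l) $$ (i, j) * v $ j) = poly.coeff q l * (A ^\<^sub>m l *\<^sub>v v) $ i"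
      by (simp add: sum_distrib_left mult.assoc)
  qed
  also have "\<dots> = (\<Sum>l\<le>degree q. poly.coeff q l * c ^ l * v $ i +
      poly.coeff q l * (of_nat l * c ^ (l - 1)) * w $ i)"
    unfolding conjunct1[OF jordan_chain_pow[OF A v w Av Aw]] using i v w by (simp add: algebra_simps)
  also have "\<dots> = (poly q c \<cdot>\<^sub>v v + poly (pderiv q) c \<cdot>\<^sub>v w) $ i"
    using i v w by (simp add: poly_altdef[of q] poly_pderiv_altdef sum.distrib sum_distrib_right)
  finally show "(poly_at_mat n q A *\<^sub>v v) $ i = (poly q c \<cdot>\<^sub>v v + poly (pderiv q) c \<cdot>\<^sub>v w) $ i" .
qed (use w in \<open>auto simp: poly_at_mat_def\<close>)

text \<open>
  Applied to a Jordan chain \<open>v\<close>, \<open>w\<close> for \<open>c\<close>, the minimal polynomial \<open>q\<close> gives \<open>q'(c) w = 0\<close>, and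
  \<open>q'(c) \<noteq> 0\<close> at a simple zero.
\<close>
lemma cond_P5_imp_P3:
  assumes "cond_P5 n A" and A: "A \<in> carrier_mat n n"
  shows "cond_P3 A"
proof -
  obtain q where "is_minimal_polynomial n A q"
    and roots: "\<And>z. poly q z = 0 \<Longrightarrow> Polynomial.order z q = 1 \<and> 0 \<le> z"
    using assms unfolding cond_P5_def by blast
  then have q0: "q \<noteq> 0" and qA: "poly_at_mat n q A = 0\<^sub>m n n" unfolding is_minimal_polynomial_def by auto
  have ev: "poly q c = 0" if v: "v \<in> carrier_vec n" "v \<noteq> 0\<^sub>v n" and Av: "A *\<^sub>v v = c \<cdot>\<^sub>v v" for c v
  proof (rule ccontr)
    assume ne: "poly q c \<noteq> 0"
    have "0\<^sub>m n n *\<^sub>v v = poly q c \<cdot>\<^sub>v v + poly (pderiv q) c \<cdot>\<^sub>v 0\<^sub>v n"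
      unfolding qA[symmetric] by (rule poly_at_mat_jordan_chain[OF A v(1)]) (use v Av A in \<open>auto simp: zero_mult_vec\<close>)
    also have "\<dots> = poly q c \<cdot>\<^sub>v v" using v by (intro eq_vecI) auto
    finally have "poly q c \<cdot>\<^sub>v v = 0\<^sub>v n" using zero_mat_mult_vec[OF v(1)] by simp
    from smult_vec_eq_0D[OF this ne v(1)] v(2) show False by simp
  qed
  have "nonneg_semisimple n A" unfolding nonneg_semisimple_def
  proof (intro conjI allI ballI impI)
    fix c v w assume v: "v \<in> carrier_vec n" and w: "w \<in> carrier_vec n"
      and eq: "A *\<^sub>v v = c \<cdot>\<^sub>v v + w \<and> A *\<^sub>v w = c \<cdot>\<^sub>v w"
    show "w = 0\<^sub>v n"
    proof (rule ccontr)
      assume ne: "w \<noteq> 0\<^sub>v n"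
      have z: "poly q c = 0" by (rule ev[OF w ne]) (use eq in simp)
      then have "Polynomial.order c q = 1" using roots by blast
      then obtain g where g: "q = [:- c, 1:] * g" "\<not> [:- c, 1:] dvd g" using order_decomp[OF q0, of c] by auto
      have "poly (pderiv q) c = poly g c" unfolding g(1) by (simp only: pderiv_mult) (simp add: pderiv_pCons)
      then have d: "poly (pderiv q) c \<noteq> 0" using g(2) poly_eq_0_iff_dvd[of g c] by simp
      have "0\<^sub>m n n *\<^sub>v v = poly q c \<cdot>\<^sub>v v + poly (pderiv q) c \<cdot>\<^sub>v w"
        unfolding qA[symmetric] by (rule poly_at_mat_jordan_chain[OF A v w]) (use eq in auto)
      also have "\<dots> = poly (pderiv q) c \<cdot>\<^sub>v w" using v w z by (intro eq_vecI) auto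
      finally have "poly (pderiv q) c \<cdot>\<^sub>v w = 0\<^sub>v n" using zero_mat_mult_vec[OF v] by simp
      from smult_vec_eq_0D[OF this d w] ne show False by simp
    qed
  next
    fix c v assume "v \<in> carrier_vec n" "v \<noteq> 0\<^sub>v n \<and> A *\<^sub>v v = c \<cdot>\<^sub>v v"
    then show "0 \<le> c" using ev roots by blast
  qed
  then show ?thesis using cond_P3_iff_nonneg_semisimple[OF A] by blast
qed

lemma cond_P_iff_psd_product_2:
  assumes A: "A \<in> carrier_mat n n"
  shows "cond_P n A \<longleftrightarrow> psd_product n 2 A"
proof -
  have "cond_P2 n A \<Longrightarrow> psd_product n 2 A" using psd_product_2 unfolding cond_P2_def by blast
  then show ?thesis unfolding cond_P_def cond_P1_def
    using psd_product_2_iff[OF A] cond_P4_imp_P3[of n A] cond_P5_imp_P3[OF _ A] by blast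
qed

section \<open>Splitting off a vector by congruence\<close>

lemma det_inverse:
  fixes A :: "complex mat"
  assumes A: "A \<in> carrier_mat n n" and det: "Determinant.det A \<noteq> 0"
  obtains B where "B \<in> carrier_mat n n" "A * B = 1\<^sub>m n" "B * A = 1\<^sub>m n"
  using det_non_zero_imp_unit[OF A det, of undefined] unfolding Units_def ring_mat_simps by auto

lemma inverse_det:
  fixes A :: "complex mat"
  assumes "A \<in> carrier_mat n n" "B \<in> carrier_mat n n" "A * B = 1\<^sub>m n"
  shows "Determinant.det A * Determinant.det B = 1"
  using det_mult[OF assms(1,2)] assms(3) by simp

text \<open>
  The coordinates adapted to the block form with a \<open>1 \<times> 1\<close> corner.
\<close>
definition bvec :: "complex \<Rightarrow> complex vec \<Rightarrow> complex vec" where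
  "bvec a v = Matrix.vec 1 (\<lambda>_. a) @\<^sub>v v"

lemma bvec_carrier [simp]: "v \<in> carrier_vec m \<Longrightarrow> bvec a v \<in> carrier_vec (1 + m)"
  unfolding bvec_def by (intro append_carrier_vec) auto

lemma bvec_carrier_Suc [simp]: "v \<in> carrier_vec m \<Longrightarrow> bvec a v \<in> carrier_vec (Suc m)"
  using bvec_carrier[of v m a] by simp

lemma bvec_index:
  "bvec a v $ 0 = a" "i < dim_vec v \<Longrightarrow> bvec a v $ Suc i = v $ i"
  by (auto simp: bvec_def append_vec_def)

lemma bvec_cases:
  assumes "x \<in> carrier_vec (1 + m)"
  obtains v where "v \<in> carrier_vec m" "x = bvec (x $ 0) v"
proof
  show "Matrix.vec m (\<lambda>i. x $ Suc i) \<in> carrier_vec m" by simp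
  show "x = bvec (x $ 0) (Matrix.vec m (\<lambda>i. x $ Suc i))"
    using assms by (intro eq_vecI) (auto simp: bvec_def append_vec_def)
qed

lemma bvec_0: "bvec 0 (0\<^sub>v m) = 0\<^sub>v (1 + m)"
  by (rule eq_vecI) (auto simp: bvec_def append_vec_def)

lemma unit_vec_bvec: "unit_vec (1 + m) 0 = bvec 1 (0\<^sub>v m)" "i < m \<Longrightarrow> unit_vec (1 + m) (Suc i) = bvec 0 (unit_vec m i)"
  by (auto simp: bvec_def append_vec_def unit_vec_def intro!: eq_vecI)

lemma cinner_bvec:
  assumes "v \<in> carrier_vec m" "w \<in> carrier_vec m"
  shows "bvec a v \<bullet>c bvec b w = a * cnj b + v \<bullet>c w"
proof -
  have "bvec a v \<bullet>c bvec b w = (\<Sum>i<Suc m. bvec a v $ i * cnj (bvec b w $ i))"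
    using bvec_carrier[OF assms(1), of a] bvec_carrier[OF assms(2), of b]
    by (auto simp: scalar_prod_def lessThan_atLeast0 intro!: sum.cong)
  also have "\<dots> = a * cnj b + (\<Sum>i<m. v $ i * cnj (w $ i))"
    using assms by (subst sum.lessThan_Suc_shift) (auto simp: bvec_index)
  also have "(\<Sum>i<m. v $ i * cnj (w $ i)) = v \<bullet>c w"
    using assms by (auto simp: scalar_prod_def lessThan_atLeast0 intro!: sum.cong)
  finally show ?thesis .
qed

lemma block_mult_bvec:
  assumes "r \<in> carrier_mat 1 m" "T \<in> carrier_mat m m" "v \<in> carrier_vec m"
  shows "four_block_mat (c \<cdot>\<^sub>m 1\<^sub>m 1) r (0\<^sub>m m 1) T *\<^sub>v bvec a v = bvec (c * a + (r *\<^sub>v v) $ 0) (T *\<^sub>v v)"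
proof -
  have "four_block_mat (c \<cdot>\<^sub>m 1\<^sub>m 1) r (0\<^sub>m m 1) T *\<^sub>v bvec a v =
    ((c \<cdot>\<^sub>m 1\<^sub>m 1) *\<^sub>v Matrix.vec 1 (\<lambda>_. a) + r *\<^sub>v v) @\<^sub>v (0\<^sub>m m 1 *\<^sub>v Matrix.vec 1 (\<lambda>_. a) + T *\<^sub>v v)"
    unfolding bvec_def by (rule four_block_mat_mult_vec) (use assms in auto)
  also have "(c \<cdot>\<^sub>m 1\<^sub>m 1) *\<^sub>v Matrix.vec 1 (\<lambda>_. a) + r *\<^sub>v v = Matrix.vec 1 (\<lambda>_. c * a + (r *\<^sub>v v) $ 0)"
    using assms by (intro eq_vecI) (auto simp: scalar_prod_def)
  also have "0\<^sub>m m 1 *\<^sub>v Matrix.vec 1 (\<lambda>_. a) + T *\<^sub>v v = T *\<^sub>v v"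
    using assms by (intro eq_vecI) (auto simp: scalar_prod_def)
  finally show ?thesis by (simp add: bvec_def)
qed

lemma sesq_block:
  assumes "r \<in> carrier_mat 1 m" "T \<in> carrier_mat m m" "v \<in> carrier_vec m" "w \<in> carrier_vec m"
  shows "sesq (four_block_mat (c \<cdot>\<^sub>m 1\<^sub>m 1) r (0\<^sub>m m 1) T) (bvec b w) (bvec a v) =
    (c * a + (r *\<^sub>v v) $ 0) * cnj b + sesq T w v"
  unfolding sesq_def block_mult_bvec[OF assms(1-3)]
  by (rule cinner_bvec) (use assms in auto)

text \<open>
  Gram-Schmidt, started with \<open>u\<close>.
\<close>
lemma orthogonal_completion:
  fixes u :: "complex vec"
  assumes u: "u \<in> carrier_vec n" "u \<noteq> 0\<^sub>v n"
  shows "\<exists>W\<in>carrier_mat n n. Determinant.det W \<noteq> 0 \<and> col W 0 = u \<and> (\<forall>i<n. 0 < i \<longrightarrow> col W i \<bullet>c u = 0)"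
proof -
  have n: "0 < n" using u by (cases n) auto
  interpret cof_vec_space n "TYPE(complex)" .
  define b where "b = basis_completion u"
  define ws where "ws = gram_schmidt n b"
  define W where "W = mat_of_cols n ws"
  from basis_completion[OF u, folded b_def]
  have dist_b: "distinct b" and indep: "\<not> lin_dep (set b)" and b: "set b \<subseteq> carrier_vec n"
    and hdb: "hd b = u" and len_b: "length b = n" by auto
  from hdb len_b n obtain vs where bv: "b = u # vs" by (cases b) auto
  from gram_schmidt_result[OF b dist_b indep refl, folded ws_def]
  have ws: "set ws \<subseteq> carrier_vec n" "corthogonal ws" "length ws = n"
    by (auto simp: len_b)
  from gram_schmidt_hd[OF u(1), of vs, folded bv] have hdws: "hd ws = u" unfolding ws_def .
  have orth: "corthogonal_mat W" using orthogonal_mat_of_cols[OF ws] unfolding W_def .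
  have W: "W \<in> carrier_mat n n" using ws mat_of_cols_carrier(1)[of n ws] unfolding W_def by simp
  have "ws ! 0 = u" using hdws n ws(3) by (cases ws) auto
  then have c0: "col W 0 = u" unfolding W_def using ws n by (subst col_mat_of_cols) auto
  have "corthogonal_inv W \<in> carrier_mat n n" unfolding corthogonal_inv_def using W
    by (auto simp: mat_of_rows_def)
  moreover have "corthogonal_inv W * W = 1\<^sub>m n" using corthogonal_inv_result[OF orth] W
    unfolding inverts_mat_def corthogonal_inv_def by (auto simp: mat_of_rows_def)
  ultimately have "Determinant.det W \<noteq> 0" using inverse_det[of "corthogonal_inv W" n W] W by auto
  moreover have "col W i \<bullet>c u = 0" if "i < n" "0 < i" for i
    using corthogonal_matD[OF orth, of i 0] that W n unfolding c0 by auto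
  ultimately show ?thesis using W c0 by blast
qed

lemma mult_unit_vec:
  fixes A :: "complex mat"
  assumes "A \<in> carrier_mat n m" "i < m"
  shows "A *\<^sub>v unit_vec m i = col A i"
  using assms by (intro eq_vecI) auto

text \<open>
  Orthogonality to \<open>u\<close> only involves the columns \<open>1, \<dots>, m\<close>; the column \<open>0\<close> of an orthogonal
  basis starting with \<open>u\<close> can then be replaced by any vector that is not orthogonal to \<open>u\<close>.
\<close>
lemma adapted_basis:
  fixes u x :: "complex vec"
  assumes u: "u \<in> carrier_vec (1 + m)" and x: "x \<in> carrier_vec (1 + m)" and xu: "x \<bullet>c u \<noteq> 0"
  shows "\<exists>S\<in>carrier_mat (1 + m) (1 + m). Determinant.det S \<noteq> 0 \<and> S *\<^sub>v bvec 1 (0\<^sub>v m) = x \<and>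
    (\<forall>v\<in>carrier_vec m. (S *\<^sub>v bvec 0 v) \<bullet>c u = 0)"
proof -
  let ?n = "1 + m"
  have "u \<noteq> 0\<^sub>v ?n" using xu x by auto
  then obtain W where W: "W \<in> carrier_mat ?n ?n" and dW: "Determinant.det W \<noteq> 0" and c0: "col W 0 = u"
    and orth: "\<And>i. i < ?n \<Longrightarrow> 0 < i \<Longrightarrow> col W i \<bullet>c u = 0"
    using orthogonal_completion[OF u] by blast
  have Wu: "mat_adjoint W *\<^sub>v u = bvec (u \<bullet>c u) (0\<^sub>v m)"
  proof (rule eq_vecI)
    fix i assume "i < dim_vec (bvec (u \<bullet>c u) (0\<^sub>v m))"
    then have i: "i < ?n" by (simp add: bvec_def)
    have "(mat_adjoint W *\<^sub>v u) $ i = cnj (col W i \<bullet>c u)"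
      using W u i by (auto simp: scalar_prod_def mult.commute)
    then show "(mat_adjoint W *\<^sub>v u) $ i = bvec (u \<bullet>c u) (0\<^sub>v m) $ i"
      using orth[OF i] i c0 cinner_commute[OF u u] by (cases i) (auto simp: bvec_index)
  qed (use W in \<open>auto simp: bvec_def\<close>)
  have inner: "(W *\<^sub>v bvec a v) \<bullet>c u = a * cnj (u \<bullet>c u)" if "v \<in> carrier_vec m" for a v
    using adjoint_inner[OF W bvec_carrier[OF that] u, of a] that
    by (simp add: Wu cinner_bvec[of _ m])
  obtain W' where W': "W' \<in> carrier_mat ?n ?n" "W * W' = 1\<^sub>m ?n" using det_inverse[OF W dW] by blast
  obtain f where f: "f \<in> carrier_vec m" and fx: "W' *\<^sub>v x = bvec ((W' *\<^sub>v x) $ 0) f"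
    using bvec_cases[of "W' *\<^sub>v x" m] W' x by auto
  define f0 where "f0 = (W' *\<^sub>v x) $ 0"
  have Wf: "W *\<^sub>v bvec f0 f = x"
    unfolding f0_def fx[symmetric] using assoc_mult_mat_vec[OF W W'(1) x] W'(2) x by simp
  have f0: "f0 \<noteq> 0" using inner[OF f, of f0] xu unfolding Wf by auto
  define F where "F = four_block_mat (f0 \<cdot>\<^sub>m 1\<^sub>m 1) (0\<^sub>m 1 m) (Matrix.mat m 1 (\<lambda>(i, j). f $ i)) (1\<^sub>m m)"
  have F: "F \<in> carrier_mat ?n ?n" unfolding F_def by (rule four_block_carrier_mat) auto
  have "Determinant.det F = Determinant.det (f0 \<cdot>\<^sub>m 1\<^sub>m 1) * Determinant.det (1\<^sub>m m)"
    unfolding F_def by (rule det_four_block_mat_upper_right_zero) auto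
  then have dF: "Determinant.det F \<noteq> 0" using f0 by (simp add: det_smult)
  have Fb: "F *\<^sub>v bvec a v = bvec (f0 * a) (a \<cdot>\<^sub>v f + v)" if "v \<in> carrier_vec m" for a v
  proof -
    have "F *\<^sub>v bvec a v = ((f0 \<cdot>\<^sub>m 1\<^sub>m 1) *\<^sub>v Matrix.vec 1 (\<lambda>_. a) + 0\<^sub>m 1 m *\<^sub>v v) @\<^sub>v
       (Matrix.mat m 1 (\<lambda>(i, j). f $ i) *\<^sub>v Matrix.vec 1 (\<lambda>_. a) + 1\<^sub>m m *\<^sub>v v)"
      unfolding bvec_def F_def by (rule four_block_mat_mult_vec) (use that in auto)
    also have "(f0 \<cdot>\<^sub>m 1\<^sub>m 1) *\<^sub>v Matrix.vec 1 (\<lambda>_. a) + 0\<^sub>m 1 m *\<^sub>v v = Matrix.vec 1 (\<lambda>_. f0 * a)"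
      using that by (intro eq_vecI) (auto simp: scalar_prod_def)
    also have "Matrix.mat m 1 (\<lambda>(i, j). f $ i) *\<^sub>v Matrix.vec 1 (\<lambda>_. a) + 1\<^sub>m m *\<^sub>v v = a \<cdot>\<^sub>v f + v"
      using that f by (intro eq_vecI) (auto simp: scalar_prod_def)
    finally show ?thesis by (simp add: bvec_def)
  qed
  have SF: "(W * F) *\<^sub>v bvec a v = W *\<^sub>v bvec (f0 * a) (a \<cdot>\<^sub>v f + v)" if "v \<in> carrier_vec m" for a v
    using assoc_mult_mat_vec[OF W F bvec_carrier[OF that]] Fb[OF that] by simp
  show ?thesis
  proof (intro bexI[of _ "W * F"] conjI ballI)
    show "Determinant.det (W * F) \<noteq> 0" using det_mult[OF W F] dW dF by simp
    show "(W * F) *\<^sub>v bvec 1 (0\<^sub>v m) = x" using SF[of "0\<^sub>v m" 1] f Wf by simp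
    show "((W * F) *\<^sub>v bvec 0 v) \<bullet>c u = 0" if v: "v \<in> carrier_vec m" for v
    proof -
      have "0 \<cdot>\<^sub>v f + v = v" using f v by (intro eq_vecI) auto
      then show ?thesis using SF[OF v, of 0] inner[OF v, of 0] by simp
    qed
  qed (use W F in simp)
qed

text \<open>
  The basis consists of \<open>x\<close> and a basis of the hyperplane of all \<open>y\<close> with \<open>y\<^sup>* T x = 0\<close>, whence the
  zeros below the corner; \<open>T'\<close> is the compression of \<open>T\<close> to this hyperplane.
\<close>
lemma split_off_vector:
  assumes T: "T \<in> carrier_mat (1 + m) (1 + m)" and x: "x \<in> carrier_vec (1 + m)"
    and c: "sesq T x x = c" "c \<noteq> 0"
  obtains S r T' where "S \<in> carrier_mat (1 + m) (1 + m)" "Determinant.det S \<noteq> 0"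
    "r \<in> carrier_mat 1 m" "T' \<in> carrier_mat m m"
    "mat_adjoint S * T * S = four_block_mat (c \<cdot>\<^sub>m 1\<^sub>m 1) r (0\<^sub>m m 1) T'"
    "S *\<^sub>v bvec 1 (0\<^sub>v m) = x"
    "\<And>v w. v \<in> carrier_vec m \<Longrightarrow> w \<in> carrier_vec m \<Longrightarrow>
       sesq T' w v = sesq T (S *\<^sub>v bvec 0 w) (S *\<^sub>v bvec 0 v)"
    "\<And>v. v \<in> carrier_vec m \<Longrightarrow> sesq T (S *\<^sub>v bvec 0 v) x = 0"
    "\<And>y. y \<in> carrier_vec (1 + m) \<Longrightarrow> sesq T y x = 0 \<Longrightarrow> \<exists>v\<in>carrier_vec m. y = S *\<^sub>v bvec 0 v"
proof -
  let ?n = "1 + m"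
  have Tx: "T *\<^sub>v x \<in> carrier_vec ?n" using T x by auto
  have "x \<bullet>c (T *\<^sub>v x) \<noteq> 0" using cinner_commute[OF x Tx] c by (auto simp: sesq_def)
  then obtain S where S: "S \<in> carrier_mat ?n ?n" and dS: "Determinant.det S \<noteq> 0"
    and Sx: "S *\<^sub>v bvec 1 (0\<^sub>v m) = x" and orth: "\<And>v. v \<in> carrier_vec m \<Longrightarrow> (S *\<^sub>v bvec 0 v) \<bullet>c (T *\<^sub>v x) = 0"
    using adapted_basis[OF Tx x] by blast
  have Sb: "S *\<^sub>v bvec a v \<in> carrier_vec ?n" if "v \<in> carrier_vec m" for a v
    using S that by (intro mult_mat_vec_carrier[OF S]) auto
  have orth': "sesq T (S *\<^sub>v bvec 0 v) x = 0" if "v \<in> carrier_vec m" for v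
    unfolding sesq_def using cinner_commute[OF Tx Sb[OF that, of 0]] orth[OF that] by simp
  define K where "K = mat_adjoint S * T * S"
  have K: "K \<in> carrier_mat ?n ?n" unfolding K_def using S T adjoint_carrier[OF S] by simp
  have sK: "sesq K (bvec a v) (bvec b w) = sesq T (S *\<^sub>v bvec a v) (S *\<^sub>v bvec b w)"
    if "v \<in> carrier_vec m" "w \<in> carrier_vec m" for a v b w
    unfolding K_def using that by (intro sesq_congruence[OF T S]) auto
  define r where "r = Matrix.mat 1 m (\<lambda>(i, j). K $$ (0, Suc j))"
  define T' where "T' = Matrix.mat m m (\<lambda>(i, j). K $$ (Suc i, Suc j))"
  have r: "r \<in> carrier_mat 1 m" and T': "T' \<in> carrier_mat m m" by (auto simp: r_def T'_def)
  have K00: "K $$ (0, 0) = c"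
    using sesq_unit[OF K, of 0 0] sK[of "0\<^sub>v m" "0\<^sub>v m" 1 1] Sx c(1) by (simp add: unit_vec_bvec[of m, simplified])
  have Ki0: "K $$ (Suc i, 0) = 0" if "i < m" for i
    using sesq_unit[OF K, of "Suc i" 0] sK[of "unit_vec m i" "0\<^sub>v m" 0 1] Sx orth'[of "unit_vec m i"] that
      unit_vec_bvec(2)[OF that]
    by (simp add: unit_vec_bvec(1)[of m, simplified])
  have Kb: "K = four_block_mat (c \<cdot>\<^sub>m 1\<^sub>m 1) r (0\<^sub>m m 1) T'"
  proof (rule eq_matI)
    fix i j assume "i < dim_row (four_block_mat (c \<cdot>\<^sub>m 1\<^sub>m 1) r (0\<^sub>m m 1) T')" "j < dim_col (four_block_mat (c \<cdot>\<^sub>m 1\<^sub>m 1) r (0\<^sub>m m 1) T')"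
    then have ij: "i < Suc m" "j < Suc m" using T' by auto
    show "K $$ (i, j) = four_block_mat (c \<cdot>\<^sub>m 1\<^sub>m 1) r (0\<^sub>m m 1) T' $$ (i, j)"
      using ij T' K00 Ki0 by (cases i; cases j) (auto simp: r_def T'_def)
  qed (use K T' in auto)
  have sT': "sesq T' w v = sesq T (S *\<^sub>v bvec 0 w) (S *\<^sub>v bvec 0 v)"
    if "v \<in> carrier_vec m" "w \<in> carrier_vec m" for v w
    using sK[OF that(2,1), of 0 0] sesq_block[OF r T' that, of c 0 0] unfolding Kb by simp
  have compl: "\<exists>v\<in>carrier_vec m. y = S *\<^sub>v bvec 0 v" if y: "y \<in> carrier_vec ?n" "sesq T y x = 0" for y
  proof -
    obtain S' where S': "S' \<in> carrier_mat ?n ?n" "S * S' = 1\<^sub>m ?n" using det_inverse[OF S dS] by blast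
    obtain v where v: "v \<in> carrier_vec m" and yv: "S' *\<^sub>v y = bvec ((S' *\<^sub>v y) $ 0) v"
      using bvec_cases[of "S' *\<^sub>v y" m] S' y by auto
    define a where "a = (S' *\<^sub>v y) $ 0"
    have Sy: "S *\<^sub>v bvec a v = y"
      unfolding a_def yv[symmetric] using assoc_mult_mat_vec[OF S S'(1) y(1)] S'(2) y by simp
    have "bvec a v = a \<cdot>\<^sub>v bvec 1 (0\<^sub>v m) + bvec 0 v"
      using v by (intro eq_vecI) (auto simp: bvec_def append_vec_def)
    then have "y = a \<cdot>\<^sub>v x + S *\<^sub>v bvec 0 v"
      using v unfolding Sy[symmetric] Sx[symmetric]
      by (simp add: mult_add_distrib_mat_vec[OF S] mult_mat_vec[OF S])
    then have "sesq T y x = cnj a * c"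
      using sesq_add_left[OF T, of "a \<cdot>\<^sub>v x" "S *\<^sub>v bvec 0 v" x] sesq_smult_left[OF T x x, of a] orth'[OF v] Sb[OF v] x c by simp
    then have "a = 0" using y c by auto
    then show ?thesis using Sy v by auto
  qed
  show thesis by (rule that[OF S dS r T' Kb[unfolded K_def] Sx sT' orth' compl])
qed

section \<open>Matrices congruent to a matrix similar to a nonnegative diagonal one\<close>

text \<open>
  This is the property on which the inductions are run: it is invariant under congruence, passes
  from the compression to the whole matrix, and yields three factors.
\<close>
definition congruent_nonneg :: "nat \<Rightarrow> complex mat \<Rightarrow> bool" where
  "congruent_nonneg n T \<longleftrightarrow> T \<in> carrier_mat n n \<and>
    (\<exists>S\<in>carrier_mat n n. Determinant.det S \<noteq> 0 \<and> cond_P3 (mat_adjoint S * T * S))"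

lemma congruent_nonneg_congruence:
  assumes T: "T \<in> carrier_mat n n" and S: "S \<in> carrier_mat n n" and dS: "Determinant.det S \<noteq> 0"
    and cn: "congruent_nonneg n (mat_adjoint S * T * S)"
  shows "congruent_nonneg n T"
proof -
  obtain S' where S': "S' \<in> carrier_mat n n" and dS': "Determinant.det S' \<noteq> 0"
    and P3: "cond_P3 (mat_adjoint S' * (mat_adjoint S * T * S) * S')"
    using cn unfolding congruent_nonneg_def by blast
  have "mat_adjoint S' * (mat_adjoint S * T * S) * S' = mat_adjoint (S * S') * T * (S * S')"
    using T S S' adjoint_carrier[OF S] adjoint_carrier[OF S']
    by (simp add: adjoint_mult[OF S S'] assoc_mult_mat[of _ n n _ n _ n])
  moreover have "Determinant.det (S * S') \<noteq> 0" using det_mult[OF S S'] dS dS' by simp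
  ultimately show ?thesis using P3 T S S' unfolding congruent_nonneg_def
    by (intro conjI bexI[of _ "S * S'"]) auto
qed

text \<open>
  Scaling the first basis vector moves the new eigenvalue beyond the spectrum of the
  compression, so that no Jordan block can arise.
\<close>
lemma congruent_nonneg_block:
  assumes c: "0 < c" and r: "r \<in> carrier_mat 1 m" and T: "congruent_nonneg m T"
  shows "congruent_nonneg (1 + m) (four_block_mat (c \<cdot>\<^sub>m 1\<^sub>m 1) r (0\<^sub>m m 1) T)"
proof -
  let ?K = "four_block_mat (c \<cdot>\<^sub>m 1\<^sub>m 1) r (0\<^sub>m m 1) T"
  obtain S where S: "S \<in> carrier_mat m m" and dS: "Determinant.det S \<noteq> 0"
    and P3: "cond_P3 (mat_adjoint S * T * S)" and Tc: "T \<in> carrier_mat m m"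
    using T unfolding congruent_nonneg_def by blast
  have Sa: "mat_adjoint S \<in> carrier_mat m m" using S by simp
  have "mat_adjoint S * T * S \<in> carrier_mat m m" using Sa Tc S by simp
  from cond_P3_border[OF P3 this] obtain b
    where b: "\<And>c k X. b < c \<Longrightarrow> X \<in> carrier_mat k m \<Longrightarrow>
      cond_P3 (four_block_mat (complex_of_real c \<cdot>\<^sub>m 1\<^sub>m k) X (0\<^sub>m m k) (mat_adjoint S * T * S))"
    by blast
  define c' where "c' = Re c"
  have c': "c = of_real c'" "0 < c'" using c by (auto simp: c'_def less_complex_def complex_eq_iff)
  define s where "s = sqrt ((\<bar>b\<bar> + 1) / c')"
  have "s * s = (\<bar>b\<bar> + 1) / c'" using c' by (simp add: s_def)
  then have "s * c' * s = \<bar>b\<bar> + 1" using c' by (simp add: field_simps)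
  moreover have "0 < s" using c' by (simp add: s_def)
  ultimately have s: "0 < s" "b < s * c' * s" by auto
  let ?s = "complex_of_real s \<cdot>\<^sub>m 1\<^sub>m 1"
  define F where "F = four_block_mat ?s (0\<^sub>m 1 m) (0\<^sub>m m 1) S"
  have F: "F \<in> carrier_mat (1 + m) (1 + m)" unfolding F_def using S by (intro four_block_carrier_mat) auto
  have "Determinant.det F = Determinant.det ?s * Determinant.det S"
    unfolding F_def by (rule det_four_block_mat_upper_right_zero) (use S in auto)
  then have dF: "Determinant.det F \<noteq> 0" using s dS by (simp add: det_smult)
  have Fa: "mat_adjoint F = four_block_mat ?s (0\<^sub>m 1 m) (0\<^sub>m m 1) (mat_adjoint S)"
    unfolding F_def by (subst adjoint_four_block[of _ 1 1 _ m _ m]) (use S in \<open>auto simp: adjoint_smult\<close>)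
  have "mat_adjoint F * ?K = four_block_mat (?s * (c \<cdot>\<^sub>m 1\<^sub>m 1)) (?s * r) (0\<^sub>m m 1) (mat_adjoint S * T)"
    unfolding Fa by (subst mult_four_block_mat[of _ 1 1 _ m _ m _ _ 1 _ m]) (use r Tc S Sa in auto)
  then have "mat_adjoint F * ?K * F = four_block_mat (?s * (c \<cdot>\<^sub>m 1\<^sub>m 1)) (?s * r) (0\<^sub>m m 1) (mat_adjoint S * T) * F"
    by simp
  also have "\<dots> = four_block_mat (?s * (c \<cdot>\<^sub>m 1\<^sub>m 1) * ?s) (?s * r * S) (0\<^sub>m m 1) (mat_adjoint S * T * S)"
    unfolding F_def by (subst mult_four_block_mat[of _ 1 1 _ m _ m _ _ 1 _ m]) (use r Tc S Sa in auto)
  also have "?s * (c \<cdot>\<^sub>m 1\<^sub>m 1) * ?s = complex_of_real (s * c' * s) \<cdot>\<^sub>m 1\<^sub>m 1"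
    unfolding c' by (rule eq_matI) (auto simp: scalar_prod_def)
  finally have eq: "mat_adjoint F * ?K * F =
    four_block_mat (complex_of_real (s * c' * s) \<cdot>\<^sub>m 1\<^sub>m 1) (?s * r * S) (0\<^sub>m m 1) (mat_adjoint S * T * S)" .
  have "?s * r * S \<in> carrier_mat 1 m" using r S by auto
  then have "cond_P3 (mat_adjoint F * ?K * F)" unfolding eq using b[OF s(2)] by blast
  moreover have "?K \<in> carrier_mat (1 + m) (1 + m)" using Tc by (intro four_block_carrier_mat) auto
  ultimately show ?thesis unfolding congruent_nonneg_def using F dF by blast
qed

lemma diagonal_congruent_nonneg:
  assumes "T \<in> carrier_mat n n" "cond_P3 T"
  shows "congruent_nonneg n T"
  unfolding congruent_nonneg_def using assms by (intro conjI bexI[of _ "1\<^sub>m n"]) auto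

text \<open>
  From \<open>S\<^sup>* T S = B C\<close> follows \<open>T = (S\<^sup>-\<^sup>* B S\<^sup>-\<^sup>1) (S C S\<^sup>*) (S\<^sup>-\<^sup>* S\<^sup>-\<^sup>1)\<close>.
\<close>
lemma congruent_nonneg_factorization:
  assumes "congruent_nonneg n T"
  shows "\<exists>B C D. psd n B \<and> pd n C \<and> pd n D \<and> T = B * (C * D)"
proof -
  obtain S where T: "T \<in> carrier_mat n n" and S: "S \<in> carrier_mat n n" and dS: "Determinant.det S \<noteq> 0"
    and P3: "cond_P3 (mat_adjoint S * T * S)"
    using assms unfolding congruent_nonneg_def by blast
  obtain R where R: "R \<in> carrier_mat n n" and SR: "S * R = 1\<^sub>m n" and RS: "R * S = 1\<^sub>m n"
    using det_inverse[OF S dS] by blast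
  have Sa: "mat_adjoint S \<in> carrier_mat n n" and Ra: "mat_adjoint R \<in> carrier_mat n n" using S R by auto
  have RSa: "mat_adjoint R * mat_adjoint S = 1\<^sub>m n" and SRa: "mat_adjoint S * mat_adjoint R = 1\<^sub>m n"
    by (simp_all add: adjoint_mult[OF S R, symmetric] adjoint_mult[OF R S, symmetric] SR RS)
  note a = assoc_mult_mat[of _ n n _ n _ n]
  obtain B C where B: "psd n B" and C: "pd n C" and BC: "mat_adjoint S * T * S = B * C"
    using cond_P3_factorization[OF P3 mult_carrier_sq[OF mult_carrier_sq[OF Sa T] S]] by blast
  have Bc: "B \<in> carrier_mat n n" and Cc: "C \<in> carrier_mat n n" using B C by (auto simp: psd_def pd_def)
  have dR: "Determinant.det R \<noteq> 0" using inverse_det[OF S R SR] by auto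
  define B' where "B' = mat_adjoint R * B * R"
  define C' where "C' = S * C * mat_adjoint S"
  define D' where "D' = mat_adjoint R * R"
  have "psd n B'" unfolding B'_def by (rule psd_congruence[OF B R])
  moreover have "pd n C'"
  proof -
    have "psd n C'" using psd_congruence[OF pd_imp_psd[OF C] Sa] unfolding C'_def adjoint_adjoint .
    moreover have "Determinant.det C' = Determinant.det S * Determinant.det C * cnj (Determinant.det S)"
      unfolding C'_def det_mult[OF mult_carrier_sq[OF S Cc] Sa] det_mult[OF S Cc] det_adjoint[OF S] ..
    ultimately show ?thesis using dS C unfolding pd_iff_psd_det by simp
  qed
  moreover have "pd n D'"
  proof -
    have "psd n D'" using psd_congruence[OF psd_one R] unfolding D'_def right_mult_one_mat[OF Ra] .
    moreover have "Determinant.det D' \<noteq> 0"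
      unfolding D'_def det_mult[OF Ra R] det_adjoint[OF R] using dR by simp
    ultimately show ?thesis unfolding pd_iff_psd_det by simp
  qed
  moreover have "T = B' * (C' * D')"
  proof -
    have "B' * (C' * D') = mat_adjoint R * B * (R * S) * C * (mat_adjoint S * mat_adjoint R) * R"
      unfolding B'_def C'_def D'_def using Bc Cc S R Sa Ra by (simp add: a)
    also have "\<dots> = mat_adjoint R * (B * C) * R"
      unfolding RS SRa using Bc Cc S R Sa Ra by (simp add: a)
    also have "\<dots> = (mat_adjoint R * mat_adjoint S) * T * (S * R)"
      unfolding BC[symmetric] using T S R Sa Ra by (simp add: a)
    also have "\<dots> = T" unfolding RSa SR using T by simp
    finally show ?thesis ..
  qed
  ultimately show ?thesis by blast
qed

lemma congruent_nonneg_psd_product_3: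
  assumes "congruent_nonneg n T"
  shows "psd_product n 3 T"
proof -
  obtain B C D where *: "psd n B" "pd n C" "pd n D" "T = B * (C * D)"
    using congruent_nonneg_factorization[OF assms] by blast
  have "psd_product n (1 + 2) T" unfolding *(4)
    using * by (intro psd_product_mult psd_product_2) (auto simp: psd_product_1[unfolded One_nat_def] pd_imp_psd)
  then show ?thesis by (simp add: numeral_3_eq_3)
qed

lemma congruent_nonneg_pd_product_3:
  assumes "congruent_nonneg n T" "Determinant.det T \<noteq> 0"
  shows "pd_product n 3 T"
proof -
  obtain B C D where *: "psd n B" "pd n C" "pd n D" "T = B * (C * D)"
    using congruent_nonneg_factorization[OF assms(1)] by blast
  have c: "B \<in> carrier_mat n n" "C * D \<in> carrier_mat n n" using * by (auto simp: psd_def pd_def)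
  have "Determinant.det B \<noteq> 0" using det_mult[OF c] assms(2) *(4) by auto
  then have "pd n B" using *(1) pd_iff_psd_det by blast
  then show ?thesis using * pd_product_3 by blast
qed

lemma mult_vec_eq_0I:
  assumes T: "T \<in> carrier_mat n n" and y: "y \<in> carrier_vec n"
    and "\<And>x. x \<in> carrier_vec n \<Longrightarrow> sesq T x y = 0"
  shows "T *\<^sub>v y = 0\<^sub>v n"
proof -
  have "T *\<^sub>v y \<in> carrier_vec n" using T y by auto
  moreover from assms(3)[OF this] have "(T *\<^sub>v y) \<bullet>c (T *\<^sub>v y) = 0" by (simp add: sesq_def)
  ultimately show ?thesis using conjugate_square_eq_0_vec by blast
qed

lemma sesq_adjoint_inner:
  assumes "T \<in> carrier_mat n n" "x \<in> carrier_vec n" "y \<in> carrier_vec n"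
  shows "sesq T x y = y \<bullet>c (mat_adjoint T *\<^sub>v x)"
  using adjoint_inner[of T n n y x] assms by (simp add: sesq_def)

text \<open>
  Let \<open>g = T\<^sup>* z \<noteq> 0\<close>. As \<open>z\<^sup>* T y\<close> is not identically zero while \<open>y\<^sup>* T z\<close> is, adding a multiple of \<open>z\<close>
  to \<open>y\<close> changes the value \<open>y\<^sup>* T y\<close> at will, so there is \<open>x\<close> with \<open>x\<^sup>* T x = 1\<close>. If \<open>T\<^sup>*\<close> maps all vectors
  to multiples of \<open>g\<close>, the compression vanishes. Otherwise \<open>x\<close> can be chosen with \<open>T\<^sup>* x\<close> not a multiple
  of \<open>g\<close>; then the projection \<open>z - b x\<close> of \<open>z\<close> to the hyperplane is a kernel vector of the compression,
  and it is not killed by the adjoint since \<open>g = b T\<^sup>* x\<close> is impossible.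
\<close>
theorem congruent_nonneg_of_kernel:
  assumes "T \<in> carrier_mat n n" "z \<in> carrier_vec n" "T *\<^sub>v z = 0\<^sub>v n" "mat_adjoint T *\<^sub>v z \<noteq> 0\<^sub>v n"
  shows "congruent_nonneg n T"
  using assms
proof (induction n arbitrary: T z)
  case 0
  then have "mat_adjoint T *\<^sub>v z = 0\<^sub>v 0" by (intro eq_vecI) auto
  then show ?case using 0 by simp
next
  case (Suc m)
  let ?n = "1 + m"
  have T: "T \<in> carrier_mat ?n ?n" and z: "z \<in> carrier_vec ?n" and Tz: "T *\<^sub>v z = 0\<^sub>v ?n"
    and Taz: "mat_adjoint T *\<^sub>v z \<noteq> 0\<^sub>v ?n" using Suc.prems by auto
  have Ta: "mat_adjoint T \<in> carrier_mat ?n ?n" using T by auto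
  define g where "g = mat_adjoint T *\<^sub>v z"
  have g: "g \<in> carrier_vec ?n" "g \<noteq> 0\<^sub>v ?n" using Ta z Taz by (auto simp: g_def)
  have sz: "sesq T y z = 0" if "y \<in> carrier_vec ?n" for y using that Tz by (simp add: sesq_def)
  have zs: "sesq T z y = y \<bullet>c g" if "y \<in> carrier_vec ?n" for y
    unfolding g_def by (rule sesq_adjoint_inner[OF T z that])
  have zg: "sesq T z g \<noteq> 0" using zs[OF g(1)] g conjugate_square_eq_0_vec[OF g(1)] by simp
  define sp where "sp y \<longleftrightarrow> (\<exists>a. mat_adjoint T *\<^sub>v y = a \<cdot>\<^sub>v g)" for y
  have sp_lin: "sp (a \<cdot>\<^sub>v y + b \<cdot>\<^sub>v y')" if sps: "sp y" "sp y'" "y \<in> carrier_vec ?n" "y' \<in> carrier_vec ?n" for a b y y'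
  proof -
    obtain \<alpha> \<beta> where ab: "mat_adjoint T *\<^sub>v y = \<alpha> \<cdot>\<^sub>v g" "mat_adjoint T *\<^sub>v y' = \<beta> \<cdot>\<^sub>v g"
      using sps(1,2) unfolding sp_def by blast
    have "mat_adjoint T *\<^sub>v (a \<cdot>\<^sub>v y + b \<cdot>\<^sub>v y') = a \<cdot>\<^sub>v (\<alpha> \<cdot>\<^sub>v g) + b \<cdot>\<^sub>v (\<beta> \<cdot>\<^sub>v g)"
      using that by (simp add: mult_add_distrib_mat_vec[OF Ta] mult_mat_vec[OF Ta] ab)
    also have "\<dots> = (a * \<alpha> + b * \<beta>) \<cdot>\<^sub>v g" using g by (intro eq_vecI) (auto simp: algebra_simps)
    finally show ?thesis unfolding sp_def by blast
  qed
  have spz: "sp z" unfolding sp_def g_def by (rule exI[of _ 1]) (auto intro!: eq_vecI)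
  have ex1: "\<exists>y\<in>carrier_vec ?n. sesq T z y \<noteq> 0 \<and> (\<not> sp y \<or> (\<forall>v\<in>carrier_vec ?n. sp v))"
  proof (cases "\<forall>v\<in>carrier_vec ?n. sp v")
    case True
    then show ?thesis using zg g by blast
  next
    case False
    then obtain x0 where x0: "x0 \<in> carrier_vec ?n" "\<not> sp x0" by blast
    show ?thesis
    proof (cases "sesq T z x0 = 0")
      case False
      then show ?thesis using x0 by blast
    next
      case True
      have val: "sesq T z (x0 + a \<cdot>\<^sub>v g) = a * sesq T z g" for a
        using x0 g z True by (simp add: sesq_bilinear[OF T])
      have "\<not> sp (x0 + 1 \<cdot>\<^sub>v g) \<or> \<not> sp (x0 + (-1) \<cdot>\<^sub>v g)"
      proof (rule ccontr)
        assume "\<not> (\<not> sp (x0 + 1 \<cdot>\<^sub>v g) \<or> \<not> sp (x0 + (-1) \<cdot>\<^sub>v g))"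
        then have "sp ((1/2) \<cdot>\<^sub>v (x0 + 1 \<cdot>\<^sub>v g) + (1/2) \<cdot>\<^sub>v (x0 + (-1) \<cdot>\<^sub>v g))"
          using x0 g by (intro sp_lin) auto
        moreover have "(1/2) \<cdot>\<^sub>v (x0 + 1 \<cdot>\<^sub>v g) + (1/2) \<cdot>\<^sub>v (x0 + (-1) \<cdot>\<^sub>v g) = x0"
          using x0 g by (intro eq_vecI) (auto simp: field_simps)
        ultimately show False using x0 by simp
      qed
      then obtain a where "\<not> sp (x0 + a \<cdot>\<^sub>v g)" "a \<noteq> 0" by (metis zero_neq_neg_one zero_neq_one)
      moreover then have "sesq T z (x0 + a \<cdot>\<^sub>v g) \<noteq> 0" using val zg by simp
      ultimately show ?thesis using x0 g by (intro bexI[of _ "x0 + a \<cdot>\<^sub>v g"]) auto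
    qed
  qed
  then obtain y where y: "y \<in> carrier_vec ?n" "sesq T z y \<noteq> 0" "\<not> sp y \<or> (\<forall>v\<in>carrier_vec ?n. sp v)" by blast
  \<comment> \<open>The term \<open>y\<^sup>* T (l z)\<close> vanishes, so the value changes by \<open>cnj l * (z\<^sup>* T y)\<close> only.\<close>
  define l where "l = cnj ((1 - sesq T y y) / sesq T z y)"
  define x where "x = y + l \<cdot>\<^sub>v z"
  have x: "x \<in> carrier_vec ?n" using y z by (simp add: x_def)
  have xx: "sesq T x x = 1"
    unfolding x_def using y z by (simp add: sesq_bilinear[OF T] sz l_def)
  have spx: "\<not> sp x \<or> (\<forall>v\<in>carrier_vec ?n. sp v)"
  proof -
    have "sp y" if "sp x"
    proof -
      have "sp (1 \<cdot>\<^sub>v x + (-l) \<cdot>\<^sub>v z)" using that spz x z by (intro sp_lin)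
      moreover have "1 \<cdot>\<^sub>v x + (-l) \<cdot>\<^sub>v z = y" using y z by (intro eq_vecI) (auto simp: x_def)
      ultimately show ?thesis by simp
    qed
    then show ?thesis using y by blast
  qed
  have "(1::complex) \<noteq> 0" by simp
  then obtain S r T' where S: "S \<in> carrier_mat ?n ?n" "Determinant.det S \<noteq> 0"
    and r: "r \<in> carrier_mat 1 m" and T': "T' \<in> carrier_mat m m"
    and K: "mat_adjoint S * T * S = four_block_mat (1 \<cdot>\<^sub>m 1\<^sub>m 1) r (0\<^sub>m m 1) T'"
    and Sx: "S *\<^sub>v bvec 1 (0\<^sub>v m) = x"
    and sT': "\<And>v w. v \<in> carrier_vec m \<Longrightarrow> w \<in> carrier_vec m \<Longrightarrow>
       sesq T' w v = sesq T (S *\<^sub>v bvec 0 w) (S *\<^sub>v bvec 0 v)"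
    and orth: "\<And>v. v \<in> carrier_vec m \<Longrightarrow> sesq T (S *\<^sub>v bvec 0 v) x = 0"
    and compl: "\<And>y. y \<in> carrier_vec ?n \<Longrightarrow> sesq T y x = 0 \<Longrightarrow> \<exists>v\<in>carrier_vec m. y = S *\<^sub>v bvec 0 v"
    by (rule split_off_vector[OF T x xx]) blast
  have Sb: "S *\<^sub>v bvec a v \<in> carrier_vec ?n" if "v \<in> carrier_vec m" for a v
    using S that by (intro mult_mat_vec_carrier[OF S(1)]) auto
  have "congruent_nonneg m T'"
  proof (cases "\<forall>v\<in>carrier_vec ?n. sp v")
    case True
    have "T' = 0\<^sub>m m m"
    proof (rule sesq_cong[OF T'])
      fix w v :: "complex vec" assume wv: "w \<in> carrier_vec m" "v \<in> carrier_vec m"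
      obtain a b where ab: "mat_adjoint T *\<^sub>v (S *\<^sub>v bvec 0 w) = a \<cdot>\<^sub>v g" "mat_adjoint T *\<^sub>v x = b \<cdot>\<^sub>v g"
        using True x Sb[OF wv(1), of 0] unfolding sp_def by metis
      have "sesq T x x = cnj b * (x \<bullet>c g)" unfolding sesq_adjoint_inner[OF T x x] ab by (rule cinner_smult_right[OF g(1) x])
      then have "x \<bullet>c g \<noteq> 0" using xx by auto
      moreover have "sesq T (S *\<^sub>v bvec 0 w) x = cnj a * (x \<bullet>c g)"
        unfolding sesq_adjoint_inner[OF T Sb[OF wv(1)] x] ab by (rule cinner_smult_right[OF g(1) x])
      ultimately have "a = 0" using orth[OF wv(1)] by simp
      then have "sesq T (S *\<^sub>v bvec 0 w) (S *\<^sub>v bvec 0 v) = 0"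
        unfolding sesq_adjoint_inner[OF T Sb[OF wv(1)] Sb[OF wv(2)]] ab
        using cinner_smult_right[OF g(1) Sb[OF wv(2)], of 0 0] by simp
      then show "sesq T' w v = sesq (0\<^sub>m m m) w v"
        using sT'[OF wv(2,1)] wv by (simp add: sesq_def zero_mat_mult_vec)
    qed simp
    moreover have "nonneg_diagonal (0\<^sub>m m m)" by (auto simp: nonneg_diagonal_def diagonal_mat_def)
    then have "cond_P3 (0\<^sub>m m m)" unfolding cond_P3_def using similar_mat_refl[of "0\<^sub>m m m" m] by auto
    ultimately show ?thesis by (intro diagonal_congruent_nonneg) auto
  next
    case False
    then have nsp: "\<not> sp x" using spx by blast
    define b where "b = cnj (sesq T z x)"
    have "sesq T (z + (- b) \<cdot>\<^sub>v x) x = 0" using z x xx by (simp add: sesq_bilinear[OF T] b_def)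
    then obtain v where v: "v \<in> carrier_vec m" and zv: "z + (- b) \<cdot>\<^sub>v x = S *\<^sub>v bvec 0 v"
      using compl[of "z + (- b) \<cdot>\<^sub>v x"] z x by auto
    have "T' *\<^sub>v v = 0\<^sub>v m"
    proof (rule mult_vec_eq_0I[OF T' v])
      fix w :: "complex vec" assume w: "w \<in> carrier_vec m"
      have "sesq T' w v = sesq T (S *\<^sub>v bvec 0 w) (z + (- b) \<cdot>\<^sub>v x)" using sT'[OF v w] zv by simp
      also have "\<dots> = 0" using z x Sb[OF w, of 0] orth[OF w] sz by (simp add: sesq_bilinear[OF T])
      finally show "sesq T' w v = 0" .
    qed
    moreover have "mat_adjoint T' *\<^sub>v v \<noteq> 0\<^sub>v m"
    proof
      assume 0: "mat_adjoint T' *\<^sub>v v = 0\<^sub>v m"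
      let ?p = "S *\<^sub>v bvec 0 v"
      have "mat_adjoint T *\<^sub>v ?p = 0\<^sub>v ?n"
      proof (rule mult_vec_eq_0I[OF Ta Sb[OF v]])
        fix s :: "complex vec" assume s: "s \<in> carrier_vec ?n"
        define a where "a = cnj (sesq T s x)"
        have "sesq T (s + (- a) \<cdot>\<^sub>v x) x = 0" using s x xx by (simp add: sesq_bilinear[OF T] a_def)
        then obtain w where w: "w \<in> carrier_vec m" and sw: "s + (- a) \<cdot>\<^sub>v x = S *\<^sub>v bvec 0 w"
          using compl[of "s + (- a) \<cdot>\<^sub>v x"] s x by auto
        have "sesq T ?p (s + (- a) \<cdot>\<^sub>v x) = sesq T' v w" unfolding sw using sT'[OF w v] by simp
        also have "\<dots> = 0" unfolding sesq_adjoint_inner[OF T' v w] 0 using w by simp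
        finally have "sesq T ?p s = 0" using s x Sb[OF v, of 0] orth[OF v] by (simp add: sesq_bilinear[OF T])
        then show "sesq (mat_adjoint T) s ?p = 0" using sesq_adjoint[OF T s Sb[OF v]] by simp
      qed
      then have eq: "g + (- b) \<cdot>\<^sub>v (mat_adjoint T *\<^sub>v x) = 0\<^sub>v ?n"
        unfolding zv[symmetric] g_def using z x
        by (simp add: mult_add_distrib_mat_vec[OF Ta] mult_mat_vec[OF Ta])
      have Tax: "mat_adjoint T *\<^sub>v x \<in> carrier_vec ?n" using Ta x by auto
      have eqi: "g $ i = b * (mat_adjoint T *\<^sub>v x) $ i" if "i < ?n" for i
      proof -
        have "(g + (- b) \<cdot>\<^sub>v (mat_adjoint T *\<^sub>v x)) $ i = g $ i - b * (mat_adjoint T *\<^sub>v x) $ i"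
          using that Tax carrier_vecD[OF Tax] carrier_vecD[OF g(1)] by (simp del: index_mult_mat_vec)
        then show ?thesis using eq that by simp
      qed
      have "b \<noteq> 0" using eqi g by (metis carrier_vecD eq_vecI index_zero_vec mult_zero_left)
      then have "mat_adjoint T *\<^sub>v x = (1 / b) \<cdot>\<^sub>v g"
        using eqi g carrier_vecD[OF Tax] by (intro eq_vecI) (auto simp del: index_mult_mat_vec)
      then show False using nsp unfolding sp_def by blast
    qed
    ultimately show ?thesis using Suc.IH[OF T' v] by blast
  qed
  then have "congruent_nonneg ?n (mat_adjoint S * T * S)"
    unfolding K using r by (intro congruent_nonneg_block) (auto simp: less_complex_def)
  then show ?case using congruent_nonneg_congruence[OF T S] by simp
qed

section \<open>The numerical range\<close>

lemma unit_rotation: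
  fixes z k :: complex
  obtains e where "norm e = 1" "Im (e * z) = 0" "0 \<le> Re (e * k)"
proof -
  obtain e where e: "norm e = 1" "Im (e * z) = 0"
  proof (cases "z = 0")
    case True
    then show thesis using that[of 1] by simp
  next
    case False
    then have "norm (cnj z / of_real (norm z)) = 1" by (simp add: norm_divide)
    moreover have "cnj z / of_real (norm z) * z = of_real (norm z)"
      using False complex_norm_square[of z] by (simp add: field_simps power2_eq_square)
    ultimately show thesis using that[of "cnj z / of_real (norm z)"] by simp
  qed
  show thesis
  proof (cases "0 \<le> Re (e * k)")
    case True
    then show thesis using that e by blast
  next
    case False
    then show thesis using that[of "- e"] e by simp
  qed
qed

lemma numerical_range_sesq:
  "T \<in> carrier_mat n n \<Longrightarrow> numerical_range T = {sesq T x x | x. x \<in> carrier_vec n \<and> x \<bullet>c x = 1}"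
  unfolding numerical_range_def sesq_def by auto

lemma sesq_one: "sesq (1\<^sub>m n) x y = y \<bullet>c x" if "y \<in> carrier_vec n" for x y :: "complex vec"
  using that by (simp add: sesq_def)

lemma sesq_combination:
  assumes T: "T \<in> carrier_mat n n" and x: "x \<in> carrier_vec n" and y: "y \<in> carrier_vec n"
  shows "sesq T (a \<cdot>\<^sub>v x + b \<cdot>\<^sub>v y) (a \<cdot>\<^sub>v x + b \<cdot>\<^sub>v y) =
    cnj a * a * sesq T x x + cnj b * b * sesq T y y + cnj a * b * sesq T x y + cnj b * a * sesq T y x"
  using x y by (simp add: sesq_bilinear[OF T] algebra_simps)

text \<open>
  Toeplitz-Hausdorff: normalizing the two given values to \<open>1\<close> and \<open>0\<close>, a rotation of one of the
  vectors makes the form real on the segment between them; then the intermediate value theorem applies.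
\<close>
theorem convex_numerical_range:
  assumes T: "T \<in> carrier_mat n n"
  shows "convex (numerical_range T)"
  unfolding convex_alt
proof (intro ballI allI impI)
  fix b a u assume "b \<in> numerical_range T" "a \<in> numerical_range T" and u: "0 \<le> u \<and> u \<le> (1::real)"
  then obtain x y where x: "x \<in> carrier_vec n" "x \<bullet>c x = 1" "a = sesq T x x"
    and y: "y \<in> carrier_vec n" "y \<bullet>c y = 1" "b = sesq T y y"
    unfolding numerical_range_sesq[OF T] by blast
  show "(1 - u) *\<^sub>R b + u *\<^sub>R a \<in> numerical_range T"
  proof (cases "a = b")
    case True
    then show ?thesis using \<open>a \<in> numerical_range T\<close> by (simp add: scaleR_conv_of_real algebra_simps)
  next
    case False
    define k where "k = y \<bullet>c x"
    have k': "x \<bullet>c y = cnj k" unfolding k_def using cinner_commute[OF x(1) y(1)] .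
    define p where "p = (sesq T x y - b * k) / (a - b)"
    define q where "q = (sesq T y x - b * cnj k) / (a - b)"
    obtain e where e: "norm e = 1" "Im (e * (p - cnj q)) = 0" "0 \<le> Re (e * k)"
      by (rule unit_rotation)
    have ee: "cnj e * e = 1" using e(1) complex_norm_square[of e] by (simp add: mult.commute)
    define g where "g = Re (e * p + cnj e * q)"
    have g: "e * p + cnj e * q = of_real g"
      using e(2) by (simp add: g_def complex_eq_iff algebra_simps)
    define v where "v s = complex_of_real s \<cdot>\<^sub>v x + (of_real (1 - s) * e) \<cdot>\<^sub>v y" for s
    have v: "v s \<in> carrier_vec n" for s using x y by (simp add: v_def)
    define N where "N s = s * s + (1 - s) * (1 - s) + 2 * s * (1 - s) * Re (e * k)" for s
    define F where "F s = s * s + s * (1 - s) * g" for s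
    have vN: "v s \<bullet>c v s = of_real (N s)" for s
    proof -
      have "v s \<bullet>c v s = sesq (1\<^sub>m n) (v s) (v s)" using sesq_one[OF v] by simp
      also have "\<dots> = of_real (s * s) + of_real ((1 - s) * (1 - s)) * (cnj e * e) +
          of_real (s * (1 - s)) * (e * k + cnj (e * k))"
        unfolding v_def sesq_combination[OF one_carrier_mat x(1) y(1)]
        using x y by (simp add: sesq_one k_def[symmetric] k' algebra_simps)
      also have "\<dots> = of_real (N s)"
        unfolding ee complex_add_cnj by (simp add: N_def del: times_complex.sel)
      finally show ?thesis .
    qed
    have vF: "sesq T (v s) (v s) = b * of_real (N s) + (a - b) * of_real (F s)" for s
    proof -
      have pq: "sesq T x y = (a - b) * p + b * k" "sesq T y x = (a - b) * q + b * cnj k"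
        using False by (simp_all add: p_def q_def)
      have "sesq T (v s) (v s) = of_real (s * s) * a + of_real ((1 - s) * (1 - s)) * (cnj e * e) * b +
          of_real (s * (1 - s)) * (e * sesq T x y + cnj e * sesq T y x)"
        unfolding v_def sesq_combination[OF T x(1) y(1)] using x y by (simp add: algebra_simps)
      also have "e * sesq T x y + cnj e * sesq T y x = (a - b) * (e * p + cnj e * q) + b * (e * k + cnj (e * k))"
        unfolding pq by (simp add: algebra_simps)
      also have "\<dots> = (a - b) * of_real g + b * of_real (2 * Re (e * k))"
        unfolding g complex_add_cnj by simp
      finally show ?thesis unfolding ee by (simp add: N_def F_def algebra_simps)
    qed
    have Npos: "0 < N s" if "0 \<le> s" "s \<le> 1" for s
    proof -
      have "0 < s * s + (1 - s) * (1 - s)" by (simp add: sum_squares_gt_zero_iff)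
      moreover have "0 \<le> 2 * s * (1 - s) * Re (e * k)" using that e(3) by (intro mult_nonneg_nonneg) auto
      ultimately show ?thesis unfolding N_def by linarith
    qed
    have "\<exists>s\<ge>0. s \<le> 1 \<and> F s / N s = u"
    proof (rule IVT')
      show "F 0 / N 0 \<le> u" "u \<le> F 1 / N 1" using u by (auto simp: F_def N_def)
      show "continuous_on {0..1} (\<lambda>s. F s / N s)"
        using Npos by (intro continuous_on_divide) (fastforce simp: F_def[abs_def] N_def[abs_def] intro!: continuous_intros)+
    qed simp
    then obtain s where s: "0 \<le> s" "s \<le> 1" "F s / N s = u" by blast
    define r where "r = complex_of_real (1 / sqrt (N s))"
    have r: "cnj r * r = of_real (1 / N s)"
      using Npos[OF s(1,2)] by (simp add: r_def of_real_mult[symmetric] del: of_real_mult of_real_divide)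
    let ?w = "r \<cdot>\<^sub>v v s"
    have "?w \<bullet>c ?w = cnj r * r * (v s \<bullet>c v s)"
      using v[of s] by (simp add: cinner_smult_left[of _ n] cinner_smult_right[of _ n])
    then have w1: "?w \<bullet>c ?w = 1" unfolding r vN using Npos[OF s(1,2)] by simp
    have "sesq T ?w ?w = cnj r * r * sesq T (v s) (v s)" using v[of s] by (simp add: sesq_bilinear[OF T])
    also have "\<dots> = b + (a - b) * of_real (F s / N s)" unfolding r vF using Npos[OF s(1,2)]
      by (simp add: field_simps)
    also have "\<dots> = (1 - u) *\<^sub>R b + u *\<^sub>R a" unfolding s(3) by (simp add: scaleR_conv_of_real algebra_simps)
    finally show ?thesis unfolding numerical_range_sesq[OF T] using w1 v[of s]
      by (intro CollectI exI[of _ ?w]) auto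
  qed
qed

text \<open>
  The ray of argument \<open>\<phi>\<close> is the axis of the half-plane, not its boundary.
\<close>
definition half_plane :: "nat \<Rightarrow> real \<Rightarrow> complex mat \<Rightarrow> bool" where
  "half_plane n \<phi> T \<longleftrightarrow> (\<forall>x\<in>carrier_vec n. 0 \<le> Re (cis (- \<phi>) * sesq T x x))"

lemma normalize_vec:
  fixes x :: "complex vec"
  assumes x: "x \<in> carrier_vec n" "x \<noteq> 0\<^sub>v n"
  obtains r where "0 < r" "(complex_of_real r \<cdot>\<^sub>v x) \<bullet>c (complex_of_real r \<cdot>\<^sub>v x) = 1"
proof -
  note c = cinner_self[OF x(1)]
  define r where "r = 1 / sqrt (Re (x \<bullet>c x))"
  have r: "0 < r" "r * r = 1 / Re (x \<bullet>c x)" using c(2) c(3)[OF x(2)] by (simp_all add: r_def)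
  have "(complex_of_real r \<cdot>\<^sub>v x) \<bullet>c (complex_of_real r \<cdot>\<^sub>v x) = of_real (r * r) * (x \<bullet>c x)"
    using x by (simp add: cinner_smult_left[of _ n] cinner_smult_right[of _ n])
  also have "\<dots> = of_real (r * r * Re (x \<bullet>c x))" by (subst c(1)) simp
  also have "r * r * Re (x \<bullet>c x) = 1" unfolding r(2) using c(3)[OF x(2)] by simp
  finally show thesis using that[OF r(1)] by simp
qed

lemma sesq_scale:
  "T \<in> carrier_mat n n \<Longrightarrow> x \<in> carrier_vec n \<Longrightarrow>
    sesq T (complex_of_real r \<cdot>\<^sub>v x) (complex_of_real r \<cdot>\<^sub>v x) = of_real (r * r) * sesq T x x"
  by (simp add: sesq_bilinear)

lemma zero_sesq: "T \<in> carrier_mat n n \<Longrightarrow> sesq T (0\<^sub>v n) (0\<^sub>v n) = 0"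
  by (simp add: sesq_def zero_mult_vec)

lemma half_plane_iff_numerical_range:
  assumes T: "T \<in> carrier_mat n n"
  shows "half_plane n \<phi> T \<longleftrightarrow> (\<forall>w\<in>numerical_range T. 0 \<le> Re (cis (- \<phi>) * w))"
proof
  assume "half_plane n \<phi> T"
  then show "\<forall>w\<in>numerical_range T. 0 \<le> Re (cis (- \<phi>) * w)"
    unfolding half_plane_def numerical_range_sesq[OF T] by blast
next
  assume W: "\<forall>w\<in>numerical_range T. 0 \<le> Re (cis (- \<phi>) * w)"
  show "half_plane n \<phi> T" unfolding half_plane_def
  proof
    fix x :: "complex vec" assume x: "x \<in> carrier_vec n"
    show "0 \<le> Re (cis (- \<phi>) * sesq T x x)"
    proof (cases "x = 0\<^sub>v n")
      case True
      then show ?thesis using zero_sesq[OF T] by simp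
    next
      case False
      then obtain r where r: "0 < r" "(complex_of_real r \<cdot>\<^sub>v x) \<bullet>c (complex_of_real r \<cdot>\<^sub>v x) = 1"
        using normalize_vec x by blast
      then have "0 \<le> Re (cis (- \<phi>) * sesq T (complex_of_real r \<cdot>\<^sub>v x) (complex_of_real r \<cdot>\<^sub>v x))"
        using W x unfolding numerical_range_sesq[OF T] by (metis (mono_tags, lifting) mem_Collect_eq smult_carrier_vec)
      also have "\<dots> = Re (of_real (r * r) * (cis (- \<phi>) * sesq T x x))"
        unfolding sesq_scale[OF T x] by (simp only: mult.left_commute)
      also have "\<dots> = r * r * Re (cis (- \<phi>) * sesq T x x)" by (subst times_complex.sel) simp
      finally show ?thesis using r(1) by (simp add: zero_le_mult_iff mult_le_0_iff del: times_complex.sel)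
    qed
  qed
qed

text \<open>
  A convex set has a supporting line at any point outside its interior; if the interior is empty, the
  set lies on a line.
\<close>
lemma not_interior_imp_half_plane:
  assumes T: "T \<in> carrier_mat n n" and int: "0 \<notin> interior (numerical_range T)"
  shows "\<exists>\<phi>. half_plane n \<phi> T"
proof -
  let ?W = "numerical_range T"
  note conv = convex_numerical_range[OF T]
  have "\<exists>a. a \<noteq> 0 \<and> (\<forall>w\<in>?W. 0 \<le> a \<bullet> w)"
  proof (cases "0 \<in> ?W")
    case False
    then show ?thesis using separating_hyperplane_set_0[OF conv] by blast
  next
    case True
    show ?thesis
    proof (cases "interior ?W = {}")
      case True
      then obtain a b where a: "a \<noteq> 0" "?W \<subseteq> {x. a \<bullet> x = b}"
        using empty_interior_subset_hyperplane[OF conv] by metis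
      then have "b = 0" using \<open>0 \<in> ?W\<close> by auto
      then show ?thesis using a by (intro exI[of _ a]) auto
    next
      case False
      then have "0 \<notin> rel_interior ?W" using int rel_interior_nonempty_interior by blast
      then obtain a where "a \<noteq> 0" "\<And>y. y \<in> ?W \<Longrightarrow> a \<bullet> 0 \<le> a \<bullet> y"
        using supporting_hyperplane_rel_boundary[OF conv \<open>0 \<in> ?W\<close>] by metis
      then show ?thesis by (intro exI[of _ a]) auto
    qed
  qed
  then obtain a where a: "a \<noteq> 0" "\<And>w. w \<in> ?W \<Longrightarrow> 0 \<le> a \<bullet> w" by blast
  have "0 \<le> Re (cis (- Arg a) * w)" if "w \<in> ?W" for w
  proof -
    have "a \<bullet> w = Re (cnj a * w)" by (simp add: inner_complex_def)
    also have "cnj a = of_real (norm a) * cis (- Arg a)"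
      using rcis_cmod_Arg[of a] by (metis cis_cnj complex_cnj_complex_of_real complex_cnj_mult rcis_def)
    also have "Re (of_real (norm a) * cis (- Arg a) * w) = norm a * Re (cis (- Arg a) * w)"
      by (simp add: mult.assoc)
    finally show ?thesis using a(2)[OF that] a(1) by (simp add: zero_le_mult_iff)
  qed
  then show ?thesis using half_plane_iff_numerical_range[OF T] by blast
qed

lemma interior_imp_not_half_plane:
  assumes T: "T \<in> carrier_mat n n" and int: "0 \<in> interior (numerical_range T)"
  shows "\<not> half_plane n \<phi> T"
proof
  assume hp: "half_plane n \<phi> T"
  obtain e where e: "0 < e" "ball 0 e \<subseteq> numerical_range T" using int mem_interior by blast
  have "- of_real (e / 2) * cis \<phi> \<in> numerical_range T" using e by (intro subsetD[OF e(2)]) (auto simp: norm_mult)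
  then have "0 \<le> Re (cis (- \<phi>) * (- of_real (e / 2) * cis \<phi>))"
    using hp half_plane_iff_numerical_range[OF T] by blast
  also have "cis (- \<phi>) * (- of_real (e / 2) * cis \<phi>) = - of_real (e / 2) * (cis (- \<phi>) * cis \<phi>)" by simp
  also have "\<dots> = - of_real (e / 2)" by (simp only: cis_mult) simp
  finally show False using e(1) by simp
qed

lemma interior_iff_not_half_plane:
  assumes T: "T \<in> carrier_mat n n"
  shows "0 \<in> interior (numerical_range T) \<longleftrightarrow> (\<forall>\<phi>. \<not> half_plane n \<phi> T)"
  using not_interior_imp_half_plane[OF T] interior_imp_not_half_plane[OF T] by blast

text \<open>
  The numerical range contains a disc around \<open>0\<close>, and scaling the vector reaches the rest.
\<close>
lemma not_half_plane_imp_onto: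
  assumes T: "T \<in> carrier_mat n n" and nhp: "\<forall>\<phi>. \<not> half_plane n \<phi> T"
  shows "\<exists>v\<in>carrier_vec n. sesq T v v = c"
proof -
  have "0 \<in> interior (numerical_range T)" using interior_iff_not_half_plane[OF T] nhp by blast
  then obtain e where e: "0 < e" "ball 0 e \<subseteq> numerical_range T" using mem_interior by blast
  define r where "r = e / (2 * (norm c + 1))"
  have r: "0 < r" using e by (auto simp: r_def intro!: divide_pos_pos add_nonneg_pos)
  have "r * norm c < e"
  proof -
    have "r * norm c \<le> r * (norm c + 1)" using r by simp
    also have "\<dots> = e / 2"
    proof -
      have "norm c + 1 \<noteq> 0" using norm_ge_zero[of c] by linarith
      then show ?thesis unfolding r_def by (simp add: field_simps)
    qed
    finally show ?thesis using e by simp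
  qed
  then have "of_real r * c \<in> numerical_range T" using e(2) r by (auto simp: norm_mult)
  then obtain v where v: "v \<in> carrier_vec n" "sesq T v v = of_real r * c"
    unfolding numerical_range_sesq[OF T] by force
  have "sesq T (complex_of_real (1 / sqrt r) \<cdot>\<^sub>v v) (complex_of_real (1 / sqrt r) \<cdot>\<^sub>v v) = of_real (1 / sqrt r * (1 / sqrt r)) * (of_real r * c)"
    unfolding sesq_scale[OF T v(1)] v(2) ..
  also have "1 / sqrt r * (1 / sqrt r) = 1 / r" using r by simp
  also have "of_real (1 / r) * (of_real r * c) = c" using r by simp
  finally show ?thesis using v(1) smult_carrier_vec by blast
qed

section \<open>Isotropic vectors when the form takes all complex values\<close>

text \<open>
  A matrix with two prescribed rows and zeros below is singular in dimension at least three.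
\<close>
lemma orthogonal_to_two:
  fixes x y :: "complex vec"
  assumes n: "3 \<le> n" and x: "x \<in> carrier_vec n" and y: "y \<in> carrier_vec n"
  shows "\<exists>v\<in>carrier_vec n. v \<noteq> 0\<^sub>v n \<and> v \<bullet>c x = 0 \<and> v \<bullet>c y = 0"
proof -
  define M where "M = Matrix.mat n n (\<lambda>(i, j). if i = 0 then cnj (x $ j) else if i = 1 then cnj (y $ j) else 0)"
  have M: "M \<in> carrier_mat n n" by (simp add: M_def)
  have "transpose_mat M *\<^sub>v unit_vec n 2 = 0\<^sub>v n"
    using n M by (subst mult_unit_vec[of _ n n]) (auto simp: M_def intro!: eq_vecI)
  moreover have "(unit_vec n 2 :: complex vec) \<noteq> 0\<^sub>v n" using n by simp
  ultimately have "Determinant.det (transpose_mat M) = 0"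
    using det_0_iff_vec_prod_zero[of "transpose_mat M" n] M unit_vec_carrier[of n 2] by (meson transpose_carrier_mat)
  then have "Determinant.det M = 0" using det_transpose[OF M] by simp
  then obtain v where v: "v \<in> carrier_vec n" "v \<noteq> 0\<^sub>v n" "M *\<^sub>v v = 0\<^sub>v n"
    using det_0_iff_vec_prod_zero[OF M] by auto
  have "(M *\<^sub>v v) $ 0 = v \<bullet>c x" "(M *\<^sub>v v) $ 1 = v \<bullet>c y"
    using n x y v(1) by (auto simp: M_def scalar_prod_def mult.commute intro!: sum.cong)
  then show ?thesis using v n by auto
qed

text \<open>
  In the plane spanned by \<open>v\<close> and a vector with the opposite value there are two isotropic
  lines, so the isotropic vectors span the whole space.
\<close>
lemma isotropic_span:
  assumes T: "T \<in> carrier_mat n n" and onto: "\<And>c. \<exists>v\<in>carrier_vec n. sesq T v v = c"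
    and v: "v \<in> carrier_vec n"
  shows "\<exists>x\<in>carrier_vec n. \<exists>y\<in>carrier_vec n. sesq T x x = 0 \<and> sesq T y y = 0 \<and>
    (\<exists>a b. v = a \<cdot>\<^sub>v x + b \<cdot>\<^sub>v y)"
proof (cases "sesq T v v = 0")
  case True
  have "v = 1 \<cdot>\<^sub>v v + 0 \<cdot>\<^sub>v v" using v by (intro eq_vecI) auto
  then show ?thesis using True v by blast
next
  case False
  define a where "a = sesq T v v"
  obtain w where w: "w \<in> carrier_vec n" "sesq T w w = - a" using onto by blast
  define p where "p = sesq T v w / a"
  define q where "q = sesq T w v / a"
  obtain e where e: "norm e = 1" "Im (e * (p - cnj q)) = 0" by (rule unit_rotation)
  have ee: "cnj e * e = 1" using e(1) complex_norm_square[of e] by (simp add: mult.commute)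
  define g where "g = Re (e * p + cnj e * q)"
  have g: "e * p + cnj e * q = of_real g"
    using e(2) by (simp add: g_def complex_eq_iff algebra_simps)
  define z where "z s = complex_of_real s \<cdot>\<^sub>v v + e \<cdot>\<^sub>v w" for s
  have z: "z s \<in> carrier_vec n" for s using v w by (simp add: z_def)
  have val: "sesq T (z s) (z s) = a * of_real (s * s + s * g - 1)" for s
  proof -
    have "sesq T (z s) (z s) = of_real (s * s) * a - (cnj e * e) * a + of_real s * (e * sesq T v w + cnj e * sesq T w v)"
      unfolding z_def sesq_combination[OF T v w(1)] w(2) a_def[symmetric] by (simp add: algebra_simps)
    also have "e * sesq T v w + cnj e * sesq T w v = a * (e * p + cnj e * q)"
      using False by (simp add: p_def q_def a_def algebra_simps)
    finally show ?thesis unfolding g ee by (simp add: algebra_simps)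
  qed
  define d where "d = sqrt (g * g + 4)"
  have d: "d * d = g * g + 4" "0 < d" by (simp_all add: d_def add_nonneg_pos)
  define s1 where "s1 = (d - g) / 2"
  define s2 where "s2 = (- d - g) / 2"
  have "4 * (s1 * s1 + s1 * g - 1) = d * d - g * g - 4" "4 * (s2 * s2 + s2 * g - 1) = d * d - g * g - 4"
    by (auto simp: s1_def s2_def field_simps)
  then have roots: "s1 * s1 + s1 * g - 1 = 0" "s2 * s2 + s2 * g - 1 = 0" using d(1) by auto
  have "s1 - s2 = d" by (simp add: s1_def s2_def field_simps)
  then have ds: "complex_of_real s1 - of_real s2 = of_real d" by (metis of_real_diff)
  have "v = (1 / of_real d) \<cdot>\<^sub>v z s1 + (- 1 / of_real d) \<cdot>\<^sub>v z s2"
  proof (rule eq_vecI)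
    fix i assume "i < dim_vec ((1 / of_real d) \<cdot>\<^sub>v z s1 + (- 1 / of_real d) \<cdot>\<^sub>v z s2)"
    then have i: "i < n" using carrier_vecD[OF z] by simp
    have "((1 / of_real d) \<cdot>\<^sub>v z s1 + (- 1 / of_real d) \<cdot>\<^sub>v z s2) $ i =
      1 / of_real d * (of_real s1 * v $ i + e * w $ i) + (- 1 / of_real d) * (of_real s2 * v $ i + e * w $ i)"
      using i v w(1) by (simp add: z_def)
    also have "\<dots> = (complex_of_real s1 - of_real s2) / of_real d * v $ i"
      using d(2) by (simp add: field_simps)
    finally show "v $ i = ((1 / of_real d) \<cdot>\<^sub>v z s1 + (- 1 / of_real d) \<cdot>\<^sub>v z s2) $ i" unfolding ds using d(2) by simp
  qed (use carrier_vecD[OF z] v in auto)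
  moreover have "sesq T (z s1) (z s1) = 0" "sesq T (z s2) (z s2) = 0" unfolding val roots by simp_all
  ultimately show ?thesis using z by blast
qed

lemma smult_add_cancel:
  fixes x y :: "complex vec"
  assumes x: "x \<in> carrier_vec n" and y: "y \<in> carrier_vec n" and 0: "a \<cdot>\<^sub>v x + b \<cdot>\<^sub>v y = 0\<^sub>v n" and a: "a \<noteq> 0"
  shows "x = (- b / a) \<cdot>\<^sub>v y"
proof (rule eq_vecI)
  fix i assume "i < dim_vec ((- b / a) \<cdot>\<^sub>v y)"
  then have i: "i < n" using y by auto
  have "(a \<cdot>\<^sub>v x + b \<cdot>\<^sub>v y) $ i = a * x $ i + b * y $ i" using i x y by simp
  then have "a * x $ i + b * y $ i = 0" using 0 i by simp
  then show "x $ i = ((- b / a) \<cdot>\<^sub>v y) $ i" using i y a by (simp add: field_simps add_eq_0_iff2)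
qed (use x y in auto)

text \<open>
  Write \<open>(x, y) = x\<^sup>* T y\<close> and suppose that every isotropic \<open>x\<close> satisfies \<open>T x = \<mu>(x) T\<^sup>* x\<close>, so that
  \<open>(y, x) = \<mu>(x) cnj (x, y)\<close>. If \<open>\<mu>\<close> were constant, then since isotropic vectors span, all values of the
  form would lie on a line. If \<open>\<mu>(x) \<noteq> \<mu>(y)\<close> then \<open>(x, y) \<noteq> 0\<close>, as otherwise \<open>x + y\<close> would be isotropic
  without a common \<open>\<mu>\<close>; hence \<open>cnj (\<mu>(x)) \<mu>(y) = 1\<close>. So \<open>\<mu>\<close> takes only two values, each on a single line,
  and the isotropic vectors span a plane, which is too small in dimension at least three.
\<close>
lemma isotropic_not_proportional:
  assumes T: "T \<in> carrier_mat n n" and det: "Determinant.det T \<noteq> 0" and n: "3 \<le> n"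
    and onto: "\<And>c. \<exists>v\<in>carrier_vec n. sesq T v v = c"
  shows "\<exists>x\<in>carrier_vec n. x \<noteq> 0\<^sub>v n \<and> sesq T x x = 0 \<and> (\<forall>\<mu>. T *\<^sub>v x \<noteq> \<mu> \<cdot>\<^sub>v (mat_adjoint T *\<^sub>v x))"
proof (rule ccontr)
  assume contra: "\<not> ?thesis"
  define Z where "Z = {x \<in> carrier_vec n. x \<noteq> 0\<^sub>v n \<and> sesq T x x = 0}"
  have "\<forall>x\<in>Z. \<exists>\<mu>. T *\<^sub>v x = \<mu> \<cdot>\<^sub>v (mat_adjoint T *\<^sub>v x)" using contra unfolding Z_def by blast
  then obtain \<mu> where \<mu>: "\<And>x. x \<in> Z \<Longrightarrow> T *\<^sub>v x = \<mu> x \<cdot>\<^sub>v (mat_adjoint T *\<^sub>v x)" by metis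
  have Zc: "x \<in> carrier_vec n" "x \<noteq> 0\<^sub>v n" "sesq T x x = 0" if "x \<in> Z" for x using that by (auto simp: Z_def)
  have Ta: "mat_adjoint T \<in> carrier_mat n n" using T by auto
  have deta: "Determinant.det (mat_adjoint T) \<noteq> 0" using det det_adjoint[OF T] by simp
  have inja: "x = 0\<^sub>v n" if "mat_adjoint T *\<^sub>v x = 0\<^sub>v n" "x \<in> carrier_vec n" for x
    using det_0_iff_vec_prod_zero[OF Ta] deta that by blast
  have Tac: "mat_adjoint T *\<^sub>v x \<in> carrier_vec n" if "x \<in> carrier_vec n" for x using Ta that by auto
  have rel: "sesq T y x = \<mu> x * cnj (sesq T x y)" if "x \<in> Z" "y \<in> carrier_vec n" for x y
  proof -
    have "sesq T y x = (\<mu> x \<cdot>\<^sub>v (mat_adjoint T *\<^sub>v x)) \<bullet>c y" unfolding sesq_def \<mu>[OF that(1)] ..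
    also have "\<dots> = \<mu> x * ((mat_adjoint T *\<^sub>v x) \<bullet>c y)"
      by (rule cinner_smult_left[OF Tac[OF Zc(1)[OF that(1)]] that(2)])
    also have "(mat_adjoint T *\<^sub>v x) \<bullet>c y = sesq (mat_adjoint T) y x" by (simp add: sesq_def)
    also have "\<dots> = cnj (sesq T x y)" by (rule sesq_adjoint[OF T that(2) Zc(1)[OF that(1)]])
    finally show ?thesis .
  qed
  have uniq: "\<mu> x = c" if x: "x \<in> Z" and Tx: "T *\<^sub>v x = c \<cdot>\<^sub>v (mat_adjoint T *\<^sub>v x)" for x c
  proof (rule ccontr)
    assume "\<mu> x \<noteq> c"
    have "(\<mu> x - c) \<cdot>\<^sub>v (mat_adjoint T *\<^sub>v x) = \<mu> x \<cdot>\<^sub>v (mat_adjoint T *\<^sub>v x) - c \<cdot>\<^sub>v (mat_adjoint T *\<^sub>v x)"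
      by (rule eq_vecI) (auto simp: algebra_simps)
    also have "\<dots> = 0\<^sub>v n" using \<mu>[OF x] Tx Tac[OF Zc(1)[OF x]] by auto
    finally have "mat_adjoint T *\<^sub>v x = 0\<^sub>v n"
      using smult_vec_eq_0D[of "\<mu> x - c"] \<open>\<mu> x \<noteq> c\<close> Tac[OF Zc(1)[OF x]] by simp
    then show False using inja Zc[OF x] by blast
  qed
  have mult: "\<mu> x = \<mu> y" if "x \<in> Z" "y \<in> Z" "x = c \<cdot>\<^sub>v y" for x y c
  proof (rule uniq[OF that(1)])
    show "T *\<^sub>v x = \<mu> y \<cdot>\<^sub>v (mat_adjoint T *\<^sub>v x)"
      unfolding that(3) mult_mat_vec[OF T Zc(1)[OF that(2)]] mult_mat_vec[OF Ta Zc(1)[OF that(2)]] \<mu>[OF that(2)]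
      by (simp add: smult_smult_assoc mult.commute)
  qed
  have ex2: "\<exists>x\<in>Z. \<exists>y\<in>Z. \<mu> x \<noteq> \<mu> y"
  proof (rule ccontr)
    assume same: "\<not> (\<exists>x\<in>Z. \<exists>y\<in>Z. \<mu> x \<noteq> \<mu> y)"
    obtain m where m: "\<And>x. x \<in> Z \<Longrightarrow> \<mu> x = m" using same by metis
    have iso: "T *\<^sub>v x = m \<cdot>\<^sub>v (mat_adjoint T *\<^sub>v x)" if "x \<in> carrier_vec n" "sesq T x x = 0" for x
    proof (cases "x = 0\<^sub>v n")
      case True
      then show ?thesis using zero_mult_vec[OF T] zero_mult_vec[OF Ta] by auto
    next
      case False
      then have "x \<in> Z" using that by (simp add: Z_def)
      then show ?thesis using \<mu> m by simp
    qed
    have all: "sesq T v v = m * cnj (sesq T v v)" if v: "v \<in> carrier_vec n" for v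
    proof -
      obtain x y a b where xy: "x \<in> carrier_vec n" "y \<in> carrier_vec n" "sesq T x x = 0" "sesq T y y = 0"
        "v = a \<cdot>\<^sub>v x + b \<cdot>\<^sub>v y" using isotropic_span[OF T onto v] by blast
      have "T *\<^sub>v v = m \<cdot>\<^sub>v (mat_adjoint T *\<^sub>v v)"
        unfolding xy(5) using xy(1,2) iso[OF xy(1,3)] iso[OF xy(2,4)] Tac[OF xy(1)] Tac[OF xy(2)]
        by (simp add: mult_add_distrib_mat_vec[OF T] mult_add_distrib_mat_vec[OF Ta]
            mult_mat_vec[OF T] mult_mat_vec[OF Ta] smult_add_distrib_vec[of _ n] smult_smult_assoc mult.commute)
      then have "sesq T v v = m * sesq (mat_adjoint T) v v"
        unfolding sesq_def using cinner_smult_left[OF Tac[OF v] v, of m] by simp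
      then show ?thesis using sesq_adjoint[OF T v v] by simp
    qed
    obtain v where v: "v \<in> carrier_vec n" "sesq T v v = 1" using onto by blast
    obtain w where w: "w \<in> carrier_vec n" "sesq T w w = \<i>" using onto by blast
    show False using all[OF v(1)] all[OF w(1)] v(2) w(2) by (auto simp: complex_eq_iff)
  qed
  have nz: "sesq T x y \<noteq> 0" if xy: "x \<in> Z" "y \<in> Z" "\<mu> x \<noteq> \<mu> y" for x y
  proof
    assume 0: "sesq T x y = 0"
    then have yx0: "sesq T y x = 0" using rel[OF xy(1) Zc(1)[OF xy(2)]] by simp
    note c = Zc(1)[OF xy(1)] Zc(1)[OF xy(2)]
    have "sesq T (x + y) (x + y) = 0"
      using c 0 yx0 Zc(3)[OF xy(1)] Zc(3)[OF xy(2)] by (simp add: sesq_bilinear[OF T])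
    moreover have "x + y \<noteq> 0\<^sub>v n"
    proof
      assume "x + y = 0\<^sub>v n"
      then have "1 \<cdot>\<^sub>v x + 1 \<cdot>\<^sub>v y = 0\<^sub>v n" by simp
      then have "x = (- 1 / 1) \<cdot>\<^sub>v y" by (rule smult_add_cancel[OF c]) simp
      then show False using mult[OF xy(1,2)] xy(3) by blast
    qed
    ultimately have "x + y \<in> Z" using c by (simp add: Z_def)
    define m where "m = \<mu> (x + y)"
    have "T *\<^sub>v (x + y) = m \<cdot>\<^sub>v (mat_adjoint T *\<^sub>v (x + y))" unfolding m_def by (rule \<mu>) fact
    then have eq: "\<mu> x \<cdot>\<^sub>v (mat_adjoint T *\<^sub>v x) + \<mu> y \<cdot>\<^sub>v (mat_adjoint T *\<^sub>v y) =
        m \<cdot>\<^sub>v (mat_adjoint T *\<^sub>v x + mat_adjoint T *\<^sub>v y)"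
      unfolding mult_add_distrib_mat_vec[OF T c] mult_add_distrib_mat_vec[OF Ta c] \<mu>[OF xy(1)] \<mu>[OF xy(2)] .
    have "mat_adjoint T *\<^sub>v ((\<mu> x - m) \<cdot>\<^sub>v x + (\<mu> y - m) \<cdot>\<^sub>v y) = 0\<^sub>v n"
    proof -
      define X where "X = mat_adjoint T *\<^sub>v x"
      define Y where "Y = mat_adjoint T *\<^sub>v y"
      have XY: "X \<in> carrier_vec n" "Y \<in> carrier_vec n" using Tac c by (auto simp: X_def Y_def)
      have "mat_adjoint T *\<^sub>v ((\<mu> x - m) \<cdot>\<^sub>v x + (\<mu> y - m) \<cdot>\<^sub>v y) = (\<mu> x - m) \<cdot>\<^sub>v X + (\<mu> y - m) \<cdot>\<^sub>v Y"
        using c by (simp add: mult_add_distrib_mat_vec[OF Ta] mult_mat_vec[OF Ta] X_def Y_def)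
      also have "\<dots> = (\<mu> x \<cdot>\<^sub>v X + \<mu> y \<cdot>\<^sub>v Y) - m \<cdot>\<^sub>v (X + Y)"
        using XY by (intro eq_vecI) (auto simp: algebra_simps)
      also have "\<dots> = 0\<^sub>v n" unfolding eq[folded X_def Y_def] using XY by auto
      finally show ?thesis .
    qed
    then have z: "(\<mu> x - m) \<cdot>\<^sub>v x + (\<mu> y - m) \<cdot>\<^sub>v y = 0\<^sub>v n" using inja c by auto
    show False
    proof (cases "\<mu> x = m")
      case False
      then have "x = (- (\<mu> y - m) / (\<mu> x - m)) \<cdot>\<^sub>v y" using smult_add_cancel[OF c z] by simp
      then show False using mult[OF xy(1,2)] xy(3) by blast
    next
      case True
      then have "\<mu> y - m \<noteq> 0" using xy(3) by simp
      moreover have "(\<mu> y - m) \<cdot>\<^sub>v y + (\<mu> x - m) \<cdot>\<^sub>v x = 0\<^sub>v n"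
        using z c comm_add_vec[of "(\<mu> x - m) \<cdot>\<^sub>v x" n "(\<mu> y - m) \<cdot>\<^sub>v y"] by simp
      ultimately have "y = (- (\<mu> x - m) / (\<mu> y - m)) \<cdot>\<^sub>v x" using smult_add_cancel[OF c(2,1)] by blast
      then show False using mult[OF xy(2,1)] xy(3) by metis
    qed
  qed
  have recip: "cnj (\<mu> x) * \<mu> y = 1" if xy: "x \<in> Z" "y \<in> Z" "\<mu> x \<noteq> \<mu> y" for x y
  proof -
    have "sesq T x y = \<mu> y * cnj (sesq T y x)" by (rule rel[OF xy(2) Zc(1)[OF xy(1)]])
    also have "sesq T y x = \<mu> x * cnj (sesq T x y)" by (rule rel[OF xy(1) Zc(1)[OF xy(2)]])
    finally have "sesq T x y * (cnj (\<mu> x) * \<mu> y) = sesq T x y * 1" by (simp add: mult.commute mult.left_commute)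
    then show ?thesis using nz[OF xy] by (metis mult_cancel_left)
  qed
  \<comment> \<open>The combination of \<open>w\<close> and \<open>x\<close> that is orthogonal to \<open>y\<close> is isotropic because \<open>\<bar>\<mu>(x)\<bar> \<noteq> 1\<close>, hence zero.\<close>
  have line: "\<exists>c. w = c \<cdot>\<^sub>v x" if xyw: "x \<in> Z" "y \<in> Z" "w \<in> Z" "\<mu> x \<noteq> \<mu> y" "\<mu> w = \<mu> x" for x y w
  proof -
    note c = Zc(1)[OF xyw(1)] Zc(1)[OF xyw(2)] Zc(1)[OF xyw(3)]
    have ne1: "cnj (\<mu> x) * \<mu> x \<noteq> 1"
    proof
      assume "cnj (\<mu> x) * \<mu> x = 1"
      then have "cnj (\<mu> x) * \<mu> x = cnj (\<mu> x) * \<mu> y" "cnj (\<mu> x) \<noteq> 0" using recip[OF xyw(1,2,4)] by auto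
      then show False using xyw(4) by (metis mult_cancel_left)
    qed
    define k where "k = cnj (sesq T w y / sesq T x y)"
    define u where "u = w + (- k) \<cdot>\<^sub>v x"
    have u: "u \<in> carrier_vec n" using c by (simp add: u_def)
    have uy: "sesq T u y = 0"
      unfolding u_def using c nz[OF xyw(1,2,4)] by (simp add: sesq_bilinear[OF T] k_def)
    have Tu: "T *\<^sub>v u = \<mu> x \<cdot>\<^sub>v (mat_adjoint T *\<^sub>v u)"
      unfolding u_def using c \<mu>[OF xyw(1)] \<mu>[OF xyw(3)] xyw(5) Tac[OF c(1)] Tac[OF c(3)]
      by (simp add: mult_add_distrib_mat_vec[OF T] mult_add_distrib_mat_vec[OF Ta]
            mult_mat_vec[OF T] mult_mat_vec[OF Ta] smult_add_distrib_vec[of _ n] smult_smult_assoc mult.commute)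
    have "sesq T u u = \<mu> x * sesq (mat_adjoint T) u u"
      unfolding sesq_def using cinner_smult_left[OF Tac[OF u] u, of "\<mu> x"] Tu by simp
    then have s: "sesq T u u = \<mu> x * cnj (sesq T u u)" using sesq_adjoint[OF T u u] by simp
    then have "sesq T u u = \<mu> x * cnj (\<mu> x * cnj (sesq T u u))" by metis
    then have "sesq T u u * (cnj (\<mu> x) * \<mu> x) = sesq T u u * 1" by (simp add: mult.commute mult.left_commute)
    then have uu: "sesq T u u = 0" using ne1 by (metis mult_cancel_left)
    have "u = 0\<^sub>v n"
    proof (rule ccontr)
      assume "u \<noteq> 0\<^sub>v n"
      then have "u \<in> Z" using u uu by (simp add: Z_def)
      moreover then have "\<mu> u = \<mu> x" using uniq Tu by blast
      ultimately show False using nz[of u y] xyw uy by auto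
    qed
    then have "1 \<cdot>\<^sub>v w + (- k) \<cdot>\<^sub>v x = 0\<^sub>v n" by (simp add: u_def)
    then show ?thesis using smult_add_cancel[OF c(3,1)] by (metis one_neq_zero)
  qed
  obtain x y where xy: "x \<in> Z" "y \<in> Z" "\<mu> x \<noteq> \<mu> y" using ex2 by blast
  note c = Zc(1)[OF xy(1)] Zc(1)[OF xy(2)]
  have two: "\<exists>a b. w = a \<cdot>\<^sub>v x + b \<cdot>\<^sub>v y" if "w \<in> carrier_vec n" "sesq T w w = 0" for w
  proof -
    have x0: "a \<cdot>\<^sub>v x = a \<cdot>\<^sub>v x + 0 \<cdot>\<^sub>v y" "a \<cdot>\<^sub>v y = 0 \<cdot>\<^sub>v x + a \<cdot>\<^sub>v y" for a
      using c by (auto intro!: eq_vecI)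
    show ?thesis
    proof (cases "w = 0\<^sub>v n")
      case True
      then have "w = 0 \<cdot>\<^sub>v x + 0 \<cdot>\<^sub>v y" using c by (auto intro!: eq_vecI)
      then show ?thesis by blast
    next
      case False
      then have w: "w \<in> Z" using that by (simp add: Z_def)
      have "\<mu> w = \<mu> x \<or> \<mu> w = \<mu> y"
      proof (rule ccontr)
        assume "\<not> ?thesis"
        then have "cnj (\<mu> x) * \<mu> w = cnj (\<mu> x) * \<mu> y" "cnj (\<mu> x) \<noteq> 0" "\<mu> w \<noteq> \<mu> y"
          using recip[OF xy] recip[OF xy(1) w] by auto
        then show False by (metis mult_cancel_left)
      qed
      then show ?thesis using line[OF xy(1,2) w xy(3)] line[OF xy(2,1) w] xy(3) x0 by metis
    qed
  qed
  obtain v where v: "v \<in> carrier_vec n" "v \<noteq> 0\<^sub>v n" "v \<bullet>c x = 0" "v \<bullet>c y = 0"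
    using orthogonal_to_two[OF n c] by blast
  obtain x1 x2 a b where x12: "x1 \<in> carrier_vec n" "x2 \<in> carrier_vec n" "sesq T x1 x1 = 0" "sesq T x2 x2 = 0"
    "v = a \<cdot>\<^sub>v x1 + b \<cdot>\<^sub>v x2" using isotropic_span[OF T onto v(1)] by blast
  obtain a1 b1 where 1: "x1 = a1 \<cdot>\<^sub>v x + b1 \<cdot>\<^sub>v y" using two x12 by blast
  obtain a2 b2 where 2: "x2 = a2 \<cdot>\<^sub>v x + b2 \<cdot>\<^sub>v y" using two x12 by blast
  have vx: "v \<bullet>c (\<alpha> \<cdot>\<^sub>v x + \<beta> \<cdot>\<^sub>v y) = 0" for \<alpha> \<beta>
    using v c by (simp add: cinner_add_right[of _ n] cinner_smult_right[of _ n])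
  have "v \<bullet>c v = cnj a * (v \<bullet>c x1) + cnj b * (v \<bullet>c x2)"
    using v(1) x12(1,2) by (subst (2) x12(5)) (simp add: cinner_add_right[of _ n] cinner_smult_right[of _ n])
  also have "\<dots> = 0" unfolding 1 2 vx by simp
  finally show False using v conjugate_square_eq_0_vec[OF v(1)] by simp
qed

text \<open>
  The component of \<open>a\<close> orthogonal to \<open>b\<close>, normalized.
\<close>
lemma dual_vector:
  fixes a b :: "complex vec"
  assumes a: "a \<in> carrier_vec n" and b: "b \<in> carrier_vec n" "b \<noteq> 0\<^sub>v n" and ne: "\<And>\<mu>. a \<noteq> \<mu> \<cdot>\<^sub>v b"
  shows "\<exists>u\<in>carrier_vec n. a \<bullet>c u = 1 \<and> b \<bullet>c u = 0"
proof -
  define k where "k = (a \<bullet>c b) / (b \<bullet>c b)"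
  have bb: "b \<bullet>c b \<noteq> 0" using conjugate_square_eq_0_vec[OF b(1)] b(2) by simp
  define u where "u = a + (- k) \<cdot>\<^sub>v b"
  have u: "u \<in> carrier_vec n" using a b by (simp add: u_def)
  have "u \<bullet>c b = 0" unfolding u_def using a b bb
    by (simp add: cinner_add_left[of _ n] cinner_smult_left[of _ n] k_def)
  then have bu: "b \<bullet>c u = 0" using cinner_commute[OF b(1) u] by simp
  have a': "a = u + k \<cdot>\<^sub>v b" using a b by (intro eq_vecI) (auto simp: u_def)
  have "a \<bullet>c u = u \<bullet>c u + k * (b \<bullet>c u)"
    using u b by (subst a') (simp add: cinner_add_left[of _ n] cinner_smult_left[of _ n])
  then have au: "a \<bullet>c u = u \<bullet>c u" using bu by simp
  have "u \<noteq> 0\<^sub>v n"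
  proof
    assume "u = 0\<^sub>v n"
    then have "a = k \<cdot>\<^sub>v b" using a' b by auto
    then show False using ne by blast
  qed
  then have "a \<bullet>c u \<noteq> 0" using au conjugate_square_eq_0_vec[OF u] by simp
  then show ?thesis using u a b bu
    by (intro bexI[of _ "(1 / cnj (a \<bullet>c u)) \<cdot>\<^sub>v u"]) (auto simp: cinner_smult_right[of _ n])
qed

section \<open>Forms taking all complex values, with positive determinant\<close>

text \<open>
  For isotropic \<open>x\<close> with \<open>T x\<close> and \<open>T\<^sup>* x\<close> not proportional there are \<open>u\<close> and \<open>y\<^sub>0\<close> dual to these two
  vectors. A multiple of \<open>x\<close> gives \<open>u\<close> any value, here a large \<open>r > 0\<close>, at no cost for \<open>x\<close>; correcting
  \<open>y\<^sub>0\<close> by a multiple of \<open>u\<close> to be in the hyperplane costs a term of modulus less than one.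
\<close>
lemma tilted_vector:
  assumes T: "T \<in> carrier_mat n n" and det: "Determinant.det T \<noteq> 0" and n: "3 \<le> n"
    and onto: "\<And>c. \<exists>v\<in>carrier_vec n. sesq T v v = c"
  shows "\<exists>x'\<in>carrier_vec n. \<exists>x\<in>carrier_vec n. \<exists>y\<in>carrier_vec n. 0 < sesq T x' x' \<and>
    sesq T x x' = 0 \<and> sesq T y x' = 0 \<and> sesq T x x = 0 \<and> sesq T x y = 1 \<and> norm (sesq T y x) < 1"
proof -
  obtain x where x: "x \<in> carrier_vec n" "x \<noteq> 0\<^sub>v n" "sesq T x x = 0"
    and ne: "\<And>\<mu>. T *\<^sub>v x \<noteq> \<mu> \<cdot>\<^sub>v (mat_adjoint T *\<^sub>v x)"
    using isotropic_not_proportional[OF T det n onto] by blast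
  have Ta: "mat_adjoint T \<in> carrier_mat n n" using T by auto
  have gh: "T *\<^sub>v x \<in> carrier_vec n" "mat_adjoint T *\<^sub>v x \<in> carrier_vec n"
    using mult_mat_vec_carrier[OF T x(1)] mult_mat_vec_carrier[OF Ta x(1)] by auto
  have g0: "T *\<^sub>v x \<noteq> 0\<^sub>v n" using det_0_iff_vec_prod_zero[OF T] det x by blast
  have "Determinant.det (mat_adjoint T) \<noteq> 0" using det det_adjoint[OF T] by simp
  then have h0: "mat_adjoint T *\<^sub>v x \<noteq> 0\<^sub>v n" using det_0_iff_vec_prod_zero[OF Ta] x by blast
  have ne': "mat_adjoint T *\<^sub>v x \<noteq> \<mu> \<cdot>\<^sub>v (T *\<^sub>v x)" for \<mu>
  proof
    assume eq: "mat_adjoint T *\<^sub>v x = \<mu> \<cdot>\<^sub>v (T *\<^sub>v x)"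
    moreover have "0 \<cdot>\<^sub>v (T *\<^sub>v x) = 0\<^sub>v n" using carrier_vecD[OF gh(1)] by (intro eq_vecI) auto
    ultimately have "\<mu> \<noteq> 0" using h0 by auto
    with eq have "T *\<^sub>v x = (1 / \<mu>) \<cdot>\<^sub>v (mat_adjoint T *\<^sub>v x)" unfolding eq by (simp add: smult_smult_assoc)
    then show False using ne by blast
  qed
  have flip: "sesq T x w = cnj ((mat_adjoint T *\<^sub>v x) \<bullet>c w)" if "w \<in> carrier_vec n" for w
    using sesq_adjoint_inner[OF T x(1) that] cinner_commute[OF gh(2) that] by simp
  obtain u where u: "u \<in> carrier_vec n" "sesq T u x = 1" "sesq T x u = 0"
    using dual_vector[OF gh h0 ne] flip unfolding sesq_def by force
  obtain y0 where y0: "y0 \<in> carrier_vec n" "sesq T y0 x = 0" "sesq T x y0 = 1"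
    using dual_vector[OF gh(2,1) g0 ne'] flip unfolding sesq_def by force
  define r where "r = norm (sesq T y0 u) + 1"
  have r: "0 < r" by (simp add: r_def add_nonneg_pos)
  define l where "l = of_real r - sesq T u u"
  define s where "s = - sesq T y0 u / of_real r"
  define x' where "x' = u + l \<cdot>\<^sub>v x"
  define y where "y = y0 + cnj s \<cdot>\<^sub>v u"
  have "norm s = norm (sesq T y0 u) / r" using r by (simp add: s_def norm_divide)
  also have "\<dots> < 1" using r by (simp add: r_def)
  finally have s: "norm s < 1" .
  have "sesq T x' x' = of_real r"
    unfolding x'_def using u x by (simp add: sesq_bilinear[OF T] l_def)
  moreover have "sesq T x x' = 0" unfolding x'_def using u x by (simp add: sesq_bilinear[OF T])
  moreover have "sesq T y x' = 0"
    unfolding x'_def y_def using u x y0 r by (simp add: sesq_bilinear[OF T] l_def s_def field_simps)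
  moreover have "sesq T x y = 1" "sesq T y x = s"
    unfolding y_def using u x y0 by (simp_all add: sesq_bilinear[OF T])
  moreover have "x' \<in> carrier_vec n" "y \<in> carrier_vec n" using u x y0 by (auto simp: x'_def y_def)
  ultimately show ?thesis using x r s by (intro bexI[of _ x'] bexI[of _ x] bexI[of _ y]) (auto simp: less_complex_def)
qed

text \<open>
  For \<open>a\<close> large the value at \<open>a x + y\<close> is dominated by \<open>cnj a + a s\<close> with \<open>\<bar>s\<bar> < 1\<close>, which takes all
  directions.
\<close>
lemma not_half_plane_of_pair:
  assumes T: "T \<in> carrier_mat n n" and x: "x \<in> carrier_vec n" and y: "y \<in> carrier_vec n"
    and xx: "sesq T x x = 0" and xy: "sesq T x y = 1" and yx: "norm (sesq T y x) < 1"
  shows "\<not> half_plane n \<phi> T"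
proof
  assume hp: "half_plane n \<phi> T"
  define s where "s = sesq T y x"
  define t where "t = (norm (sesq T y y) + 1) / (1 - norm s)"
  have t: "t * (1 - norm s) = norm (sesq T y y) + 1" "0 \<le> t" using yx by (auto simp: t_def s_def)
  define a where "a = complex_of_real (- t) * cis (- \<phi>)"
  define v where "v = a \<cdot>\<^sub>v x + 1 \<cdot>\<^sub>v y"
  have "sesq T v v = sesq T y y + cnj a + a * s"
    unfolding v_def sesq_combination[OF T x y] by (simp add: xx xy s_def)
  moreover have "0 \<le> Re (cis (- \<phi>) * sesq T v v)" using hp x y unfolding half_plane_def v_def by auto
  ultimately have "0 \<le> Re (cis (- \<phi>) * sesq T y y) + Re (cis (- \<phi>) * cnj a) + Re (cis (- \<phi>) * a * s)"
    by (simp add: algebra_simps)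
  moreover have "Re (cis (- \<phi>) * sesq T y y) \<le> norm (sesq T y y)"
    using complex_Re_le_cmod[of "cis (- \<phi>) * sesq T y y"] by (simp add: norm_mult)
  moreover have "cis (- \<phi>) * cnj a = of_real (- t)"
  proof -
    have "cis (- \<phi>) * cnj a = of_real (- t) * (cis (- \<phi>) * cis \<phi>)" by (simp add: a_def cis_cnj)
    also have "cis (- \<phi>) * cis \<phi> = 1" by (simp only: cis_mult) simp
    finally show ?thesis by simp
  qed
  then have "Re (cis (- \<phi>) * cnj a) = - t" by simp
  moreover have "Re (cis (- \<phi>) * a * s) \<le> t * norm s"
    using complex_Re_le_cmod[of "cis (- \<phi>) * a * s"] t(2) by (simp add: norm_mult a_def)
  ultimately have "0 \<le> norm (sesq T y y) - t * (1 - norm s)" by (simp add: algebra_simps)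
  then show False using t(1) by simp
qed

lemma det_split_off:
  fixes S T T' r :: "complex mat"
  assumes S: "S \<in> carrier_mat (1 + m) (1 + m)" and T: "T \<in> carrier_mat (1 + m) (1 + m)"
    and r: "r \<in> carrier_mat 1 m" and T': "T' \<in> carrier_mat m m"
    and K: "mat_adjoint S * T * S = four_block_mat (c \<cdot>\<^sub>m 1\<^sub>m 1) r (0\<^sub>m m 1) T'"
  shows "c * Determinant.det T' = of_real ((norm (Determinant.det S))\<^sup>2) * Determinant.det T"
proof -
  have Sa: "mat_adjoint S \<in> carrier_mat (1 + m) (1 + m)" by (rule adjoint_carrier[OF S])
  have "Determinant.det (mat_adjoint S * T * S) = cnj (Determinant.det S) * Determinant.det T * Determinant.det S"
    unfolding det_mult[OF mult_carrier_sq[OF Sa T] S] det_mult[OF Sa T] det_adjoint[OF S] ..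
  moreover have "Determinant.det (mat_adjoint S * T * S) = Determinant.det (c \<cdot>\<^sub>m 1\<^sub>m 1) * Determinant.det T'"
    unfolding K by (rule det_four_block_mat_lower_left_zero) (use r T' in auto)
  ultimately show ?thesis unfolding complex_norm_square by (simp add: det_smult ac_simps)
qed

lemma divide_pos_pos_complex: "0 < (a::complex) \<Longrightarrow> 0 < b \<Longrightarrow> 0 < a / b"
  by (simp add: less_complex_def Re_divide Im_divide power2_eq_square add_pos_nonneg)

lemma cond_P3_dim_le_1:
  assumes T: "T \<in> carrier_mat m m" and m: "m \<le> 1" and det: "0 \<le> Determinant.det T"
  shows "cond_P3 T"
proof -
  have "0 \<le> T $$ (i, i)" if "i < m" for i
  proof -
    have "m = 1" "i = 0" using that m by auto
    then show ?thesis using det T det_single[of T] by auto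
  qed
  then have "nonneg_diagonal T" unfolding nonneg_diagonal_def diagonal_mat_def using T m by auto
  then show ?thesis unfolding cond_P3_def using similar_mat_refl[OF T] by blast
qed

text \<open>
  Congruence multiplies the determinant by a positive number, so the determinant of the compression
  remains positive. For a compression of size at least two, the pair from \<open>tilted_vector\<close> lies in the
  hyperplane and keeps the numerical range from lying in a half-plane; a smaller one is empty or a positive
  number.
\<close>
theorem congruent_nonneg_of_interior:
  assumes "T \<in> carrier_mat n n" "0 < Determinant.det T" "\<forall>\<phi>. \<not> half_plane n \<phi> T"
  shows "congruent_nonneg n T"
  using assms
proof (induction n arbitrary: T)
  case 0
  have "half_plane 0 0 T" unfolding half_plane_def using 0(1) by (auto simp: sesq_def scalar_prod_def)
  then show ?case using 0 by blast
next
  case (Suc m)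
  let ?n = "1 + m"
  have T: "T \<in> carrier_mat ?n ?n" and det: "0 < Determinant.det T" and nhp: "\<forall>\<phi>. \<not> half_plane ?n \<phi> T"
    using Suc.prems by auto
  have onto: "\<exists>v\<in>carrier_vec ?n. sesq T v v = c" for c by (rule not_half_plane_imp_onto[OF T nhp])
  have ex: "\<exists>x\<in>carrier_vec ?n. 0 < sesq T x x \<and> (1 < m \<longrightarrow> (\<exists>y\<in>carrier_vec ?n. \<exists>z\<in>carrier_vec ?n.
    sesq T y x = 0 \<and> sesq T z x = 0 \<and> sesq T y y = 0 \<and> sesq T y z = 1 \<and> norm (sesq T z y) < 1))"
  proof (cases "1 < m")
    case True
    then have "3 \<le> ?n" by simp
    moreover have "Determinant.det T \<noteq> 0" using det by auto
    ultimately show ?thesis using tilted_vector[OF T _ _ onto] by blast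
  next
    case False
    obtain v where "v \<in> carrier_vec ?n" "sesq T v v = 1" using onto by blast
    then show ?thesis using False by (intro bexI[of _ v]) (auto simp: less_complex_def)
  qed
  then obtain x where x: "x \<in> carrier_vec ?n" "0 < sesq T x x"
    and pair: "1 < m \<Longrightarrow> \<exists>y\<in>carrier_vec ?n. \<exists>z\<in>carrier_vec ?n.
    sesq T y x = 0 \<and> sesq T z x = 0 \<and> sesq T y y = 0 \<and> sesq T y z = 1 \<and> norm (sesq T z y) < 1" by blast
  define c where "c = sesq T x x"
  have c0: "c \<noteq> 0" using x by (auto simp: c_def)
  obtain S r T' where S: "S \<in> carrier_mat ?n ?n" "Determinant.det S \<noteq> 0"
    and r: "r \<in> carrier_mat 1 m" and T': "T' \<in> carrier_mat m m"
    and K: "mat_adjoint S * T * S = four_block_mat (c \<cdot>\<^sub>m 1\<^sub>m 1) r (0\<^sub>m m 1) T'"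
    and sT': "\<And>v w. v \<in> carrier_vec m \<Longrightarrow> w \<in> carrier_vec m \<Longrightarrow>
       sesq T' w v = sesq T (S *\<^sub>v bvec 0 w) (S *\<^sub>v bvec 0 v)"
    and compl: "\<And>y. y \<in> carrier_vec ?n \<Longrightarrow> sesq T y x = 0 \<Longrightarrow> \<exists>v\<in>carrier_vec m. y = S *\<^sub>v bvec 0 v"
    by (rule split_off_vector[OF T x(1) c_def[symmetric] c0]) blast
  have "Determinant.det T' = of_real ((norm (Determinant.det S))\<^sup>2) * Determinant.det T / c"
    using det_split_off[OF S(1) T r T' K] c0 by (simp add: field_simps)
  moreover have "0 < of_real ((norm (Determinant.det S))\<^sup>2) * Determinant.det T"
    using S(2) det by (auto simp: less_complex_def)
  ultimately have det': "0 < Determinant.det T'" using divide_pos_pos_complex x(2) c_def by metis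
  have "congruent_nonneg m T'"
  proof (cases "1 < m")
    case False
    then show ?thesis using cond_P3_dim_le_1[OF T'] det' T' by (intro diagonal_congruent_nonneg) auto
  next
    case True
    then obtain y z where yz: "y \<in> carrier_vec ?n" "z \<in> carrier_vec ?n" "sesq T y x = 0" "sesq T z x = 0"
      "sesq T y y = 0" "sesq T y z = 1" "norm (sesq T z y) < 1" using pair by blast
    obtain v w where vw: "v \<in> carrier_vec m" "y = S *\<^sub>v bvec 0 v" "w \<in> carrier_vec m" "z = S *\<^sub>v bvec 0 w"
      using compl[OF yz(1,3)] compl[OF yz(2,4)] by blast
    have "\<not> half_plane m \<phi> T'" for \<phi>
      using yz(5-7) vw by (intro not_half_plane_of_pair[OF T' vw(1,3)]) (simp_all add: sT')
    then show ?thesis using Suc.IH[OF T' det'] by blast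
  qed
  then have "congruent_nonneg ?n (mat_adjoint S * T * S)"
    unfolding K using r x(2) unfolding c_def by (intro congruent_nonneg_block)
  then show ?case using congruent_nonneg_congruence[OF T S] by simp
qed

section \<open>The sum of the arguments of the eigenvalues\<close>

lemma root_eigenvector:
  fixes T :: "complex mat"
  assumes T: "T \<in> carrier_mat n n" and es: "char_poly T = (\<Prod>e\<leftarrow>es. [:- e, 1:])" and e: "e \<in> set es"
  shows "\<exists>v\<in>carrier_vec n. v \<noteq> 0\<^sub>v n \<and> T *\<^sub>v v = e \<cdot>\<^sub>v v"
proof -
  have "poly (char_poly T) e = 0" unfolding es using e by (induction es) auto
  then show ?thesis using eigenvalue_root_char_poly[OF T] T unfolding eigenvalue_def eigenvector_def by auto
qed

lemma root_nonzero:
  fixes T :: "complex mat"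
  assumes T: "T \<in> carrier_mat n n" and es: "char_poly T = (\<Prod>e\<leftarrow>es. [:- e, 1:])" and e: "e \<in> set es"
    and det: "Determinant.det T \<noteq> 0"
  shows "e \<noteq> 0"
proof
  assume "e = 0"
  then obtain v where "v \<in> carrier_vec n" "v \<noteq> 0\<^sub>v n" "T *\<^sub>v v = 0 \<cdot>\<^sub>v v" using root_eigenvector[OF T es e] by blast
  moreover have "0 \<cdot>\<^sub>v v = 0\<^sub>v n" using \<open>v \<in> carrier_vec n\<close> by (intro eq_vecI) auto
  ultimately show False using det_0_iff_vec_prod_zero[OF T] det by metis
qed

lemma char_poly_roots_length:
  fixes T :: "complex mat"
  assumes T: "T \<in> carrier_mat n n" and es: "char_poly T = (\<Prod>e\<leftarrow>es. [:- e, 1:])"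
  shows "length es = n"
proof -
  have "degree (\<Prod>e\<leftarrow>es. [:- e, 1:]) = length es" by (rule degree_linear_factors)
  then show ?thesis using degree_monic_char_poly[OF T] es by simp
qed

text \<open>
  The characteristic polynomial in homogeneous form.
\<close>
lemma det_affine:
  fixes T :: "complex mat"
  assumes T: "T \<in> carrier_mat n n" and es: "char_poly T = (\<Prod>e\<leftarrow>es. [:- e, 1:])"
  shows "Determinant.det (a \<cdot>\<^sub>m T + b \<cdot>\<^sub>m 1\<^sub>m n) = (\<Prod>e\<leftarrow>es. a * e + b)"
proof (cases "a = 0")
  case True
  have "a \<cdot>\<^sub>m T + b \<cdot>\<^sub>m 1\<^sub>m n = b \<cdot>\<^sub>m 1\<^sub>m n" using T True by (intro eq_matI) auto
  then have "Determinant.det (a \<cdot>\<^sub>m T + b \<cdot>\<^sub>m 1\<^sub>m n) = b ^ n" by (simp add: det_smult)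
  also have "\<dots> = (\<Prod>e\<leftarrow>es. a * e + b)"
    unfolding char_poly_roots_length[OF T es, symmetric] True by (induction es) auto
  finally show ?thesis .
next
  case False
  have "Determinant.det (- char_matrix T (- b / a)) = poly (char_poly T) (- b / a)" using char_poly_matrix[OF T] by simp
  also have "\<dots> = (\<Prod>e\<leftarrow>es. - b / a - e)" unfolding es by (induction es) (auto simp: algebra_simps)
  finally have *: "Determinant.det (- char_matrix T (- b / a)) = (\<Prod>e\<leftarrow>es. - b / a - e)" .
  have "a \<cdot>\<^sub>m T + b \<cdot>\<^sub>m 1\<^sub>m n = (- a) \<cdot>\<^sub>m (- char_matrix T (- b / a))"
    using T False by (intro eq_matI) (auto simp: char_matrix_def field_simps)
  then have "Determinant.det (a \<cdot>\<^sub>m T + b \<cdot>\<^sub>m 1\<^sub>m n) = (- a) ^ n * (\<Prod>e\<leftarrow>es. - b / a - e)"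
    using carrier_matD(2)[OF uminus_carrier_mat[OF char_matrix_closed[OF T]]] * by (simp add: det_smult)
  also have "\<dots> = (\<Prod>e\<leftarrow>es. a * e + b)"
    unfolding char_poly_roots_length[OF T es, symmetric] using False
    by (induction es) (auto simp: field_simps)
  finally show ?thesis .
qed

text \<open>
  The determinant is the product of the eigenvalues.
\<close>
lemma pd_det_pos:
  assumes P: "pd n P"
  shows "0 < Determinant.det P"
proof -
  note Pc = pd_carrier[OF P]
  obtain es where es: "char_poly P = (\<Prod>e\<leftarrow>es. [:- e, 1:])" using char_poly_factorized[OF Pc] by blast
  have "nonneg_semisimple n P" using psd_mult_semisimple[OF pd_imp_psd[OF P] psd_one] Pc by simp
  then have pos: "0 \<le> e" if "e \<in> set es" for e
    using root_eigenvector[OF Pc es that] nonneg_semisimpleD2 by blast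
  have "1 \<cdot>\<^sub>m P + 0 \<cdot>\<^sub>m 1\<^sub>m n = P" using Pc by (intro eq_matI) auto
  then have "Determinant.det P = (\<Prod>e\<leftarrow>es. 1 * e + 0)" using det_affine[OF Pc es, of 1 0] by simp
  also have "0 \<le> \<dots>" using pos
  proof (induction es)
    case (Cons e es)
    then show ?case using mult_nonneg_nonneg[of e "\<Prod>e\<leftarrow>es. 1 * e + 0"] by simp
  qed (auto simp: less_eq_complex_def)
  finally have "0 \<le> Determinant.det P" .
  then show ?thesis using P pd_iff_psd_det by (auto simp: order.strict_iff_order)
qed

lemma sesq_add_mat:
  assumes "A \<in> carrier_mat n n" "B \<in> carrier_mat n n" "x \<in> carrier_vec n" "y \<in> carrier_vec n"
  shows "sesq (A + B) x y = sesq A x y + sesq B x y"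
  unfolding sesq_def using assms
  by (subst add_mult_distrib_mat_vec[of _ n n]) (auto intro!: cinner_add_left[of _ n])

lemma sesq_smult_mat:
  assumes "A \<in> carrier_mat n n" "x \<in> carrier_vec n" "y \<in> carrier_vec n"
  shows "sesq (c \<cdot>\<^sub>m A) x y = c * sesq A x y"
proof -
  have "(c \<cdot>\<^sub>m A) *\<^sub>v y = c \<cdot>\<^sub>v (A *\<^sub>v y)" using assms by (intro eq_vecI) auto
  then show ?thesis unfolding sesq_def using assms by simp
qed

lemma continuous_on_det:
  fixes F :: "'a::topological_space \<Rightarrow> complex mat"
  assumes F: "\<And>s. F s \<in> carrier_mat n n"
    and cont: "\<And>i j. i < n \<Longrightarrow> j < n \<Longrightarrow> continuous_on S (\<lambda>s. F s $$ (i, j))"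
  shows "continuous_on S (\<lambda>s. Determinant.det (F s))"
proof -
  have "Determinant.det (F s) = (\<Sum>p | p permutes {0..<n}. signof p * (\<Prod>i = 0..<n. F s $$ (i, p i)))" for s
    using F[of s] by (simp add: det_def)
  moreover have "continuous_on S (\<lambda>s. \<Sum>p | p permutes {0..<n}. signof p * (\<Prod>i = 0..<n. F s $$ (i, p i)))"
  proof (intro continuous_on_sum continuous_on_mult continuous_on_prod continuous_on_const)
    fix p i assume "p \<in> {p. p permutes {0..<n}}" "i \<in> {0..<n}"
    then have "i < n" "p i < n" using permutes_in_image[of p "{0..<n}" i] by auto
    then show "continuous_on S (\<lambda>s. F s $$ (i, p i))" by (rule cont)
  qed
  ultimately show ?thesis by simp
qed

text \<open>
  The difference takes values in the discrete set \<open>2 \<pi> \<i> \<int>\<close>.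
\<close>
lemma equal_exp_const:
  fixes f g :: "'a::topological_space \<Rightarrow> complex"
  assumes S: "connected S" and f: "continuous_on S f" and g: "continuous_on S g"
    and eq: "\<And>x. x \<in> S \<Longrightarrow> exp (f x) = exp (g x)" and x: "x \<in> S" and y: "y \<in> S"
  shows "f x - g x = f y - g y"
proof -
  have "(\<lambda>x. f x - g x) constant_on S"
  proof (rule continuous_discrete_range_constant[OF S])
    show "continuous_on S (\<lambda>x. f x - g x)" using f g by (rule continuous_on_diff)
    fix x assume x: "x \<in> S"
    show "\<exists>e>0. \<forall>y. y \<in> S \<and> f y - g y \<noteq> f x - g x \<longrightarrow> e \<le> norm (f y - g y - (f x - g x))"
    proof (intro exI[of _ "2 * pi"] conjI allI impI)
      fix y assume y: "y \<in> S \<and> f y - g y \<noteq> f x - g x"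
      obtain k l :: int where kl: "f x = g x + (of_int (2 * k) * pi) * \<i>" "f y = g y + (of_int (2 * l) * pi) * \<i>"
        using eq[OF x] eq[of y] y unfolding exp_eq by blast
      then have d: "f y - g y - (f x - g x) = of_real (2 * pi * of_int (l - k)) * \<i>" by (simp add: algebra_simps)
      then have "l - k \<noteq> 0" using y by auto
      then have "1 \<le> \<bar>real_of_int (l - k)\<bar>" by linarith
      then have "2 * pi * 1 \<le> 2 * pi * \<bar>real_of_int (l - k)\<bar>" by (intro mult_left_mono) auto
      then show "2 * pi \<le> norm (f y - g y - (f x - g x))" unfolding d norm_mult norm_of_real abs_mult by simp
    qed simp
  qed
  then show ?thesis using x y unfolding constant_on_def by metis
qed

lemma right_half_plane_segment:
  assumes "0 \<le> Re z" "z \<noteq> 0" "0 \<le> t" "t \<le> (1::real)"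
  shows "of_real (1 - t) * z + of_real t \<notin> \<real>\<^sub>\<le>\<^sub>0"
proof
  assume *: "of_real (1 - t) * z + of_real t \<in> \<real>\<^sub>\<le>\<^sub>0"
  have "0 \<le> (1 - t) * Re z" using assms by simp
  then have "(1 - t) * Re z + t \<le> 0" "(1 - t) * Im z = 0"
    using * by (auto simp: complex_nonpos_Reals_iff)
  moreover from this have "t = 0" using assms \<open>0 \<le> (1 - t) * Re z\<close> by linarith
  ultimately have "Re z = 0" "Im z = 0" using assms by auto
  then show False using assms(2) by (simp add: complex_eq_iff)
qed

lemma continuous_on_sum_list_Ln:
  assumes "\<And>e. e \<in> set es \<Longrightarrow> 0 \<le> Re (c * e) \<and> c * e \<noteq> 0"
  shows "continuous_on {0..1} (\<lambda>t. \<Sum>e\<leftarrow>es. Ln (of_real (1 - t) * (c * e) + of_real t))"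
  using assms
proof (induction es)
  case (Cons e es)
  have "of_real (1 - t) * (c * e) + of_real t \<notin> \<real>\<^sub>\<le>\<^sub>0" if "t \<in> {0..1}" for t
    using right_half_plane_segment[of "c * e" t] Cons.prems[of e] that by simp
  then have "continuous_on {0..1} (\<lambda>t. Ln (of_real (1 - t) * (c * e) + of_real t))"
    by (intro continuous_on_Ln') (auto intro!: continuous_intros)
  then show ?case using Cons by (auto intro!: continuous_on_add)
qed simp

lemma exp_sum_list_Ln:
  assumes "\<And>e. e \<in> set es \<Longrightarrow> 0 \<le> Re (c * e) \<and> c * e \<noteq> 0" and t: "t \<in> {0..1}"
  shows "exp (\<Sum>e\<leftarrow>es. Ln (of_real (1 - t) * (c * e) + of_real t)) =
      (\<Prod>e\<leftarrow>es. of_real (1 - t) * (c * e) + of_real t)"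
  using assms(1)
proof (induction es)
  case (Cons e es)
  have "of_real (1 - t) * (c * e) + of_real t \<noteq> 0"
    using right_half_plane_segment[of "c * e" t] Cons.prems[of e] t nonpos_Reals_zero_I by fastforce
  moreover have "exp (\<Sum>e\<leftarrow>es. Ln (of_real (1 - t) * (c * e) + of_real t)) =
      (\<Prod>e\<leftarrow>es. of_real (1 - t) * (c * e) + of_real t)"
    by (rule Cons.IH, rule Cons.prems) simp
  ultimately show ?case by (simp add: exp_add)
qed simp

lemma sum_list_Arg:
  assumes "\<And>e. e \<in> set es \<Longrightarrow> c * e \<noteq> 0"
  shows "Im (\<Sum>e\<leftarrow>es. Ln (c * e)) = (\<Sum>e\<leftarrow>es. Arg (c * e))"
  using assms
proof (induction es)
  case (Cons e es)
  then show ?case using Arg_eq_Im_Ln[of "c * e"] Cons.prems[of e] by simp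
qed simp

text \<open>
  For fixed \<open>s\<close> the argument of \<open>det ((1 - t) w T + t ((1 - s) I + s Q))\<close>, where \<open>w = cis (- \<phi>)\<close>, is
  followed from \<open>t = 1\<close> to \<open>t = 0\<close>. For \<open>s = 0\<close> it changes by the argument sum of \<open>w T\<close>, and for
  \<open>s = 1\<close>, where \<open>Q\<close> can be factored out, by that of \<open>w P T\<close>. The determinant has no zero on the
  square, since \<open>w T\<close> has values in the right half-plane, and its argument is constant on the sides
  \<open>t = 0\<close> and \<open>t = 1\<close>; so a continuous logarithm on the square shows that the two sums agree.
\<close>
theorem arg_sum_invariant:
  assumes T: "T \<in> carrier_mat n n" and hp: "half_plane n \<phi> T" and det: "Determinant.det T \<noteq> 0"
    and Q: "pd n Q" and P: "P \<in> carrier_mat n n" and QP: "Q * P = 1\<^sub>m n"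
    and es: "char_poly T = (\<Prod>e\<leftarrow>es. [:- e, 1:])" and fs: "char_poly (P * T) = (\<Prod>e\<leftarrow>fs. [:- e, 1:])"
  shows "(\<Sum>e\<leftarrow>es. Arg (cis (- \<phi>) * e)) = (\<Sum>e\<leftarrow>fs. Arg (cis (- \<phi>) * e))"
proof -
  define w where "w = cis (- \<phi>)"
  have w0: "w \<noteq> 0" by (simp add: w_def)
  note Qc = pd_carrier[OF Q]
  have PT: "P * T \<in> carrier_mat n n" using P T by simp
  have hp': "0 \<le> Re (w * sesq T x x)" if "x \<in> carrier_vec n" for x
    using hp that unfolding half_plane_def w_def by blast
  have unit: "0 < Re (x \<bullet>c x)" if "x \<in> carrier_vec n" "x \<noteq> 0\<^sub>v n" for x :: "complex vec"
    using cinner_self[OF that(1)] that by simp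
  have Qpos: "0 < Re (sesq Q x x)" "Im (sesq Q x x) = 0" if "x \<in> carrier_vec n" "x \<noteq> 0\<^sub>v n" for x
    using Q that unfolding pd_sesq less_complex_def by auto
  have es_rhp: "0 \<le> Re (w * e) \<and> w * e \<noteq> 0" if "e \<in> set es" for e
  proof -
    obtain v where v: "v \<in> carrier_vec n" "v \<noteq> 0\<^sub>v n" "T *\<^sub>v v = e \<cdot>\<^sub>v v" using root_eigenvector[OF T es \<open>e \<in> set es\<close>] by blast
    have "sesq T v v = e * of_real (Re (v \<bullet>c v))"
      unfolding sesq_def v(3) using cinner_smult_left[OF v(1) v(1)] cinner_self(1)[OF v(1)] by simp
    then have "Re (w * e * of_real (Re (v \<bullet>c v))) \<ge> 0" using hp'[OF v(1)] by (simp add: mult.assoc)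
    then have "0 \<le> Re (w * e) * Re (v \<bullet>c v)" by (subst (asm) times_complex.sel) simp
    then show ?thesis using unit[OF v(1,2)] root_nonzero[OF T es that det] w0 by (auto simp: zero_le_mult_iff)
  qed
  have dP: "Determinant.det (P * T) \<noteq> 0" using det_mult[OF P T] inverse_det[OF Qc P QP] det by auto
  have fs_rhp: "0 \<le> Re (w * f) \<and> w * f \<noteq> 0" if f: "f \<in> set fs" for f
  proof -
    obtain v where v: "v \<in> carrier_vec n" "v \<noteq> 0\<^sub>v n" "(P * T) *\<^sub>v v = f \<cdot>\<^sub>v v" using root_eigenvector[OF PT fs f] by blast
    have "T *\<^sub>v v = (Q * P * T) *\<^sub>v v" using T QP by simp
    also have "\<dots> = Q *\<^sub>v ((P * T) *\<^sub>v v)" using Qc P T v by (simp add: assoc_mult_mat_vec[of Q n n "P * T" n v])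
    also have "\<dots> = f \<cdot>\<^sub>v (Q *\<^sub>v v)" unfolding v(3) by (rule mult_mat_vec[OF Qc v(1)])
    finally have "sesq T v v = f * sesq Q v v"
      unfolding sesq_def using cinner_smult_left[OF mult_mat_vec_carrier[OF Qc v(1)] v(1)] by simp
    also have "sesq Q v v = of_real (Re (sesq Q v v))" using Qpos[OF v(1,2)] by (simp add: complex_eq_iff)
    finally have "Re (w * f * of_real (Re (sesq Q v v))) \<ge> 0" using hp'[OF v(1)] by (simp add: mult.assoc)
    then have "0 \<le> Re (w * f) * Re (sesq Q v v)" by (subst (asm) times_complex.sel) simp
    then show ?thesis using Qpos[OF v(1,2)] root_nonzero[OF PT fs f dP] w0 by (auto simp: zero_le_mult_iff)
  qed
  define R where "R s = complex_of_real (1 - s) \<cdot>\<^sub>m 1\<^sub>m n + complex_of_real s \<cdot>\<^sub>m Q" for s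
  have Rc: "R s \<in> carrier_mat n n" for s using Qc by (simp add: R_def)
  have Rsesq: "sesq (R s) x x = of_real (1 - s) * (x \<bullet>c x) + of_real s * sesq Q x x" if "x \<in> carrier_vec n" for s x
    unfolding R_def using Qc that by (simp add: sesq_add_mat[of _ n] sesq_smult_mat[of _ n] sesq_one)
  have Rpd: "pd n (R s)" if "s \<in> {0..1}" for s
    unfolding pd_sesq
  proof (intro conjI ballI impI)
    show "R s \<in> carrier_mat n n" by (rule Rc)
    have "mat_adjoint Q = Q" using Q by (simp add: pd_def)
    then show "mat_adjoint (R s) = R s"
      unfolding R_def using Qc by (subst adjoint_add[of _ n n]) (auto simp: adjoint_smult)
    fix x :: "complex vec" assume x: "x \<in> carrier_vec n" "x \<noteq> 0\<^sub>v n"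
    have "0 < (1 - s) * Re (x \<bullet>c x) + s * Re (sesq Q x x)"
      using that unit[OF x] Qpos[OF x] by (cases "s = 0") (auto intro!: add_nonneg_pos mult_nonneg_nonneg mult_pos_pos)
    moreover have "sesq Q x x = of_real (Re (sesq Q x x))" using Qpos[OF x] by (simp add: complex_eq_iff)
    then have "sesq (R s) x x = of_real ((1 - s) * Re (x \<bullet>c x) + s * Re (sesq Q x x))"
      unfolding Rsesq[OF x(1)] using cinner_self(1)[OF x(1)] by (metis of_real_add of_real_mult)
    ultimately show "0 < sesq (R s) x x" by (simp add: less_complex_def)
  qed
  define G where "G p = (complex_of_real (1 - snd p) * w) \<cdot>\<^sub>m T + complex_of_real (snd p) \<cdot>\<^sub>m R (fst p)" for p
  have Gc: "G p \<in> carrier_mat n n" for p using Rc by (simp add: G_def)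
  define sq where "sq = {0..1::real} \<times> {0..1::real}"
  have Gdet: "Determinant.det (G p) \<noteq> 0" if p: "p \<in> sq" for p
  proof
    obtain s t where st: "p = (s, t)" "s \<in> {0..1}" "t \<in> {0..1}" using p by (auto simp: sq_def)
    assume "Determinant.det (G p) = 0"
    then obtain v where v: "v \<in> carrier_vec n" "v \<noteq> 0\<^sub>v n" "G p *\<^sub>v v = 0\<^sub>v n"
      using det_0_iff_vec_prod_zero[OF Gc] by blast
    have "0 = sesq (G p) v v" unfolding sesq_def v(3) using v(1) by simp
    also have "\<dots> = of_real (1 - t) * (w * sesq T v v) + of_real t * sesq (R s) v v"
      unfolding G_def st using T Rc v(1) by (simp add: sesq_add_mat[of _ n] sesq_smult_mat[of _ n] mult.assoc)
    finally have eq0: "Re (of_real (1 - t) * (w * sesq T v v) + of_real t * sesq (R s) v v) = 0" by simp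
    have "0 = (1 - t) * Re (w * sesq T v v) + t * Re (sesq (R s) v v)"
      unfolding eq0[symmetric] plus_complex.sel times_complex.sel(1)[of "of_real _"] by simp
    moreover have "0 < Re (sesq (R s) v v)" using Rpd[OF st(2)] v unfolding pd_sesq less_complex_def by auto
    ultimately have "t = 0"
      using st(3) hp'[OF v(1)] by (smt (verit, best) atLeastAtMost_iff mult_nonneg_nonneg mult_pos_pos)
    have "T *\<^sub>v v = 0\<^sub>v n"
    proof -
      have "G p = w \<cdot>\<^sub>m T" unfolding G_def st \<open>t = 0\<close> using T Rc[of s] by (intro eq_matI) auto
      moreover have "(w \<cdot>\<^sub>m T) *\<^sub>v v = w \<cdot>\<^sub>v (T *\<^sub>v v)" using T v by (intro eq_vecI) auto
      ultimately have "w \<cdot>\<^sub>v (T *\<^sub>v v) = 0\<^sub>v n" using v(3) by simp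
      then show ?thesis using smult_vec_eq_0D[OF _ w0] T v by auto
    qed
    then show False using det_0_iff_vec_prod_zero[OF T] det v by blast
  qed
  have "continuous_on sq (\<lambda>p. Determinant.det (G p))"
  proof (rule continuous_on_det[OF Gc])
    fix i j assume ij: "i < n" "j < n"
    have "G p $$ (i, j) = of_real (1 - snd p) * w * T $$ (i, j) +
       of_real (snd p) * (of_real (1 - fst p) * 1\<^sub>m n $$ (i, j) + of_real (fst p) * Q $$ (i, j))" for p
      unfolding G_def R_def using ij T Qc by simp
    then show "continuous_on sq (\<lambda>p. G p $$ (i, j))" by (simp only:) (intro continuous_intros)
  qed
  then have "\<exists>h. continuous_on sq h \<and> (\<forall>p\<in>sq. Determinant.det (G p) = exp (h p))"
  proof (rule continuous_logarithm_on_contractible)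
    show "contractible sq" unfolding sq_def by (intro convex_imp_contractible convex_Times) auto
  qed (use Gdet in auto)
  then obtain h where h: "continuous_on sq h" and hG: "\<And>p. p \<in> sq \<Longrightarrow> Determinant.det (G p) = exp (h p)" by blast
  have side: "continuous_on {0..1} (\<lambda>t. h (s, t))" "continuous_on {0..1} (\<lambda>t. h (t, s))" if "s \<in> {0..1}" for s
    using that by (auto intro!: continuous_on_compose2[OF h] continuous_intros simp: sq_def)
  have con: "connected {0..1::real}" by simp
  have i01: "0 \<in> {0..1::real}" "1 \<in> {0..1::real}" by auto
  define F where "F ds t = (\<Sum>e\<leftarrow>ds. Ln (of_real (1 - t) * (w * e) + of_real t))" for ds t
  have F1: "F ds 1 = 0" for ds unfolding F_def by (induction ds) auto
  have F0: "Im (F ds 0) = (\<Sum>e\<leftarrow>ds. Arg (w * e))" if "\<And>e. e \<in> set ds \<Longrightarrow> w * e \<noteq> 0" for ds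
    unfolding F_def using sum_list_Arg[of ds w] that by simp
  have s0: "h (0, 0) - F es 0 = h (0, 1) - F es 1"
  proof (rule equal_exp_const[OF con side(1)[OF i01(1)] _ _ i01])
    show "continuous_on {0..1} (F es)" unfolding F_def[abs_def] by (rule continuous_on_sum_list_Ln[OF es_rhp])
    fix t :: real assume t: "t \<in> {0..1}"
    have "exp (h (0, t)) = Determinant.det (G (0, t))" using hG[of "(0, t)"] t by (simp add: sq_def)
    also have "G (0, t) = (of_real (1 - t) * w) \<cdot>\<^sub>m T + of_real t \<cdot>\<^sub>m 1\<^sub>m n"
      unfolding G_def R_def using T Qc by (intro eq_matI) auto
    also have "Determinant.det \<dots> = exp (F es t)"
    proof -
      have "exp (F es t) = (\<Prod>e\<leftarrow>es. of_real (1 - t) * (w * e) + of_real t)"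
        unfolding F_def by (rule exp_sum_list_Ln[OF es_rhp t])
      then show ?thesis unfolding det_affine[OF T es] by (simp add: mult.assoc)
    qed
    finally show "exp (h (0, t)) = exp (F es t)" .
  qed
  have s1: "h (1, 0) - (Ln (Determinant.det Q) + F fs 0) = h (1, 1) - (Ln (Determinant.det Q) + F fs 1)"
  proof (rule equal_exp_const[OF con side(1)[OF i01(2)] _ _ i01])
    show "continuous_on {0..1} (\<lambda>t. Ln (Determinant.det Q) + F fs t)"
      unfolding F_def[abs_def] by (intro continuous_on_add continuous_on_const continuous_on_sum_list_Ln[OF fs_rhp])
    fix t :: real assume t: "t \<in> {0..1}"
    have "exp (h (1, t)) = Determinant.det (G (1, t))" using hG[of "(1, t)"] t by (simp add: sq_def)
    also have "G (1, t) = Q * ((of_real (1 - t) * w) \<cdot>\<^sub>m (P * T) + of_real t \<cdot>\<^sub>m 1\<^sub>m n)"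
    proof -
      have "Q * ((of_real (1 - t) * w) \<cdot>\<^sub>m (P * T) + of_real t \<cdot>\<^sub>m 1\<^sub>m n) =
          (of_real (1 - t) * w) \<cdot>\<^sub>m (Q * (P * T)) + of_real t \<cdot>\<^sub>m Q"
        using Qc PT by (simp add: mult_add_distrib_mat[of _ n n _ n] mult_smult_distrib[of _ n n _ n])
      also have "Q * (P * T) = T" using assoc_mult_mat[OF Qc P T] QP T by simp
      also have "of_real t \<cdot>\<^sub>m Q = of_real t \<cdot>\<^sub>m R 1" unfolding R_def using Qc by (intro eq_matI) auto
      finally show ?thesis by (simp add: G_def)
    qed
    also have "Determinant.det \<dots> = Determinant.det Q * (\<Prod>e\<leftarrow>fs. of_real (1 - t) * w * e + of_real t)"
      using det_mult[of Q n "(of_real (1 - t) * w) \<cdot>\<^sub>m (P * T) + of_real t \<cdot>\<^sub>m 1\<^sub>m n"] Qc PT det_affine[OF PT fs] by simp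
    also have "\<dots> = exp (Ln (Determinant.det Q) + F fs t)"
    proof -
      have "exp (F fs t) = (\<Prod>e\<leftarrow>fs. of_real (1 - t) * (w * e) + of_real t)"
        unfolding F_def by (rule exp_sum_list_Ln[OF fs_rhp t])
      moreover have "Determinant.det Q \<noteq> 0" using pd_det_pos[OF Q] by auto
      ultimately show ?thesis by (simp add: exp_add mult.assoc)
    qed
    finally show "exp (h (1, t)) = exp (Ln (Determinant.det Q) + F fs t)" .
  qed
  have t0: "h (0, 0) - Ln (Determinant.det (w \<cdot>\<^sub>m T)) = h (1, 0) - Ln (Determinant.det (w \<cdot>\<^sub>m T))"
  proof (rule equal_exp_const[OF con side(2)[OF i01(1)] _ _ i01])
    fix s :: real assume s: "s \<in> {0..1}"
    have "exp (h (s, 0)) = Determinant.det (G (s, 0))" using hG[of "(s, 0)"] s by (simp add: sq_def)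
    also have "G (s, 0) = w \<cdot>\<^sub>m T" unfolding G_def using T Rc[of s] by (intro eq_matI) auto
    also have "Determinant.det (w \<cdot>\<^sub>m T) = exp (Ln (Determinant.det (w \<cdot>\<^sub>m T)))"
      using T det w0 by (simp add: det_smult)
    finally show "exp (h (s, 0)) = exp (Ln (Determinant.det (w \<cdot>\<^sub>m T)))" .
  qed simp
  have Rpos: "0 < Determinant.det (R s)" if "s \<in> {0..1}" for s by (rule pd_det_pos[OF Rpd[OF that]])
  have t1: "h (0, 1) - Ln (Determinant.det (R 0)) = h (1, 1) - Ln (Determinant.det (R 1))"
  proof (rule equal_exp_const[OF con side(2)[OF i01(2)] _ _ i01])
    have "continuous_on {0..1} (\<lambda>s. Determinant.det (R s))"
    proof (rule continuous_on_det[OF Rc])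
      fix i j assume ij: "i < n" "j < n"
      have "R s $$ (i, j) = of_real (1 - s) * 1\<^sub>m n $$ (i, j) + of_real s * Q $$ (i, j)" for s
        unfolding R_def using ij Qc by simp
      then show "continuous_on {0..1} (\<lambda>s. R s $$ (i, j))" by (simp only:) (intro continuous_intros)
    qed
    then show "continuous_on {0..1} (\<lambda>s. Ln (Determinant.det (R s)))"
    proof (rule continuous_on_Ln')
      fix s :: real assume "s \<in> {0..1}"
      from Rpos[OF this] show "Determinant.det (R s) \<notin> \<real>\<^sub>\<le>\<^sub>0"
        unfolding complex_nonpos_Reals_iff less_complex_def by auto
    qed
    fix s :: real assume s: "s \<in> {0..1}"
    have "exp (h (s, 1)) = Determinant.det (G (s, 1))" using hG[of "(s, 1)"] s by (simp add: sq_def)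
    also have "G (s, 1) = R s" unfolding G_def using T Rc[of s] by (intro eq_matI) auto
    also have "Determinant.det (R s) = exp (Ln (Determinant.det (R s)))" using Rpos[OF s] by simp
    finally show "exp (h (s, 1)) = exp (Ln (Determinant.det (R s)))" .
  qed
  have ImR: "Im (Ln (Determinant.det (R s))) = 0" if "s \<in> {0..1}" for s
    using Rpos[OF that] by (subst Im_Ln_eq_0) (auto simp: less_complex_def)
  have "Im (F es 0) = Im (F fs 0)"
  proof -
    have "F es 0 = h (0, 0) - h (0, 1)" using s0 F1[of es] by (simp add: algebra_simps)
    moreover have "F fs 0 = h (1, 0) - h (1, 1)" using s1 F1[of fs] by (simp add: algebra_simps)
    moreover have "h (0, 0) = h (1, 0)" using t0 by simp
    moreover have "Im (h (0, 1)) = Im (h (1, 1))"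
      using arg_cong[OF t1, of Im] ImR i01 by simp
    ultimately show ?thesis by simp
  qed
  then show ?thesis using F0[of es] F0[of fs] es_rhp fs_rhp unfolding w_def by simp
qed

section \<open>Forms with values in a half-plane\<close>

lemma Arg_cis_mult:
  assumes "z \<noteq> 0" "- pi < \<phi> + Arg (cis (- \<phi>) * z)" "\<phi> + Arg (cis (- \<phi>) * z) \<le> pi"
  shows "Arg z = \<phi> + Arg (cis (- \<phi>) * z)"
proof (rule Arg_unique')
  let ?u = "cis (- \<phi>) * z"
  show "0 < norm z" using assms by simp
  show "\<phi> + Arg ?u \<in> {- pi<..pi}" using assms by simp
  have "z = cis \<phi> * ?u" by (simp add: mult.assoc[symmetric] cis_mult)
  also have "?u = rcis (norm z) (Arg ?u)" using rcis_cmod_Arg[of ?u] by (simp add: norm_mult)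
  also have "cis \<phi> * \<dots> = rcis (norm z) (\<phi> + Arg ?u)" by (simp add: rcis_def cis_mult[symmetric])
  finally show "z = rcis (norm z) (\<phi> + Arg ?u)" .
qed

lemma Arg_cis_pos:
  assumes "0 < z" "\<bar>\<phi>\<bar> \<le> pi / 2"
  shows "Arg (cis (- \<phi>) * z) = - \<phi>"
proof (rule Arg_unique')
  show "0 < Re z" using assms by (simp add: less_complex_def)
  have "\<phi> < pi" "- pi \<le> \<phi>" using assms(2) pi_gt_zero by linarith+
  then show "- \<phi> \<in> {- pi<..pi}" by simp
  show "cis (- \<phi>) * z = rcis (Re z) (- \<phi>)" using assms
    by (simp add: rcis_def less_complex_def complex_eq_iff)
qed

text \<open>
  The matrix \<open>S\<^sup>* T S\<close> is similar to \<open>S S\<^sup>* T\<close>, so the argument sum is a congruence invariant, and the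
  corner \<open>c > 0\<close> contributes \<open>- \<phi>\<close>.
\<close>
lemma arg_sum_split_off:
  assumes T: "T \<in> carrier_mat (1 + m) (1 + m)" and hp: "half_plane (1 + m) \<phi> T" and \<phi>: "\<bar>\<phi>\<bar> \<le> pi / 2"
    and det: "Determinant.det T \<noteq> 0"
    and es: "char_poly T = (\<Prod>e\<leftarrow>es. [:- e, 1:])"
    and sum: "(\<Sum>e\<leftarrow>es. Arg (cis (- \<phi>) * e)) = - (real (1 + m) * \<phi>)"
    and S: "S \<in> carrier_mat (1 + m) (1 + m)" "Determinant.det S \<noteq> 0"
    and c: "0 < c" and r: "r \<in> carrier_mat 1 m" and T': "T' \<in> carrier_mat m m"
    and K: "mat_adjoint S * T * S = four_block_mat (c \<cdot>\<^sub>m 1\<^sub>m 1) r (0\<^sub>m m 1) T'"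
    and sT': "\<And>v w. v \<in> carrier_vec m \<Longrightarrow> w \<in> carrier_vec m \<Longrightarrow>
       sesq T' w v = sesq T (S *\<^sub>v bvec 0 w) (S *\<^sub>v bvec 0 v)"
  shows "half_plane m \<phi> T'" "Determinant.det T' \<noteq> 0"
    "\<exists>fs. char_poly T' = (\<Prod>e\<leftarrow>fs. [:- e, 1:]) \<and> (\<Sum>e\<leftarrow>fs. Arg (cis (- \<phi>) * e)) = - (real m * \<phi>)"
proof -
  let ?n = "1 + m"
  show "half_plane m \<phi> T'" unfolding half_plane_def
  proof
    fix x :: "complex vec" assume x: "x \<in> carrier_vec m"
    have "S *\<^sub>v bvec 0 x \<in> carrier_vec ?n" using S x by (intro mult_mat_vec_carrier[OF S(1)]) auto
    then show "0 \<le> Re (cis (- \<phi>) * sesq T' x x)" unfolding sT'[OF x x] using hp unfolding half_plane_def by blast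
  qed
  show "Determinant.det T' \<noteq> 0" using det_split_off[OF S(1) T r T' K] S(2) det c by auto
  have Sa: "mat_adjoint S \<in> carrier_mat ?n ?n" by (rule adjoint_carrier[OF S(1)])
  obtain R where R: "R \<in> carrier_mat ?n ?n" and SR: "S * R = 1\<^sub>m ?n" and RS: "R * S = 1\<^sub>m ?n"
    using det_inverse[OF S] by blast
  have Ra: "mat_adjoint R \<in> carrier_mat ?n ?n" by (rule adjoint_carrier[OF R])
  have RSa: "mat_adjoint R * mat_adjoint S = 1\<^sub>m ?n" and SRa: "mat_adjoint S * mat_adjoint R = 1\<^sub>m ?n"
    by (simp_all only: adjoint_mult[OF S(1) R, symmetric] adjoint_mult[OF R S(1), symmetric] SR RS adjoint_one)
  note a = assoc_mult_mat[of _ ?n ?n _ ?n _ ?n]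
  define P where "P = S * mat_adjoint S"
  define Q where "Q = mat_adjoint R * R"
  have P: "P \<in> carrier_mat ?n ?n" unfolding P_def by (rule mult_carrier_sq[OF S(1) Sa])
  have dR: "Determinant.det R \<noteq> 0" using inverse_det[OF S(1) R SR] by auto
  have Q: "pd ?n Q" unfolding pd_iff_psd_det
  proof
    show "psd ?n Q" using psd_congruence[OF psd_one R] unfolding Q_def right_mult_one_mat[OF Ra] .
    show "Determinant.det Q \<noteq> 0" unfolding Q_def det_mult[OF Ra R] det_adjoint[OF R] using dR by simp
  qed
  have QP: "Q * P = 1\<^sub>m ?n"
  proof -
    have "Q * P = mat_adjoint R * (R * S) * mat_adjoint S"
      unfolding Q_def P_def using S(1) R Sa Ra by (simp only: a mult_carrier_sq)
    then show ?thesis unfolding RS right_mult_one_mat[OF Ra] RSa .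
  qed
  obtain fs where fs: "char_poly T' = (\<Prod>e\<leftarrow>fs. [:- e, 1:])" using char_poly_factorized[OF T'] by blast
  have Kc: "mat_adjoint S * T * S \<in> carrier_mat ?n ?n" using S Sa T by (intro mult_carrier_sq)
  have "similar_mat (P * T) (mat_adjoint S * T * S)"
  proof (rule similar_matI[of _ _ S R ?n])
    have "P * T = S * mat_adjoint S * T * (S * R)" unfolding SR P_def using S(1) Sa T by simp
    also have "\<dots> = S * (mat_adjoint S * T * S) * R" using S(1) Sa T R by (simp only: a mult_carrier_sq)
    finally show "P * T = S * (mat_adjoint S * T * S) * R" .
  qed (use S R P T Kc SR RS in auto)
  then have "char_poly (P * T) = char_poly (mat_adjoint S * T * S)" by (rule char_poly_similar)
  also have "\<dots> = char_poly (c \<cdot>\<^sub>m 1\<^sub>m 1) * char_poly T'"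
    unfolding K by (rule char_poly_four_block_zeros_col) (use r T' in auto)
  also have "char_poly (c \<cdot>\<^sub>m 1\<^sub>m 1) = [:- c, 1:]"
    by (subst char_poly_upper_triangular[of _ 1]) (auto simp: diag_mat_def)
  finally have cfs: "char_poly (P * T) = (\<Prod>e\<leftarrow>c # fs. [:- e, 1:])" unfolding fs by simp
  have "(\<Sum>e\<leftarrow>c # fs. Arg (cis (- \<phi>) * e)) = - (real ?n * \<phi>)"
    using arg_sum_invariant[OF T hp det Q P QP es cfs] sum by simp
  then have "(\<Sum>e\<leftarrow>fs. Arg (cis (- \<phi>) * e)) = - (real m * \<phi>)"
    using Arg_cis_pos[OF c \<phi>] by (simp add: algebra_simps)
  then show "\<exists>fs. char_poly T' = (\<Prod>e\<leftarrow>fs. [:- e, 1:]) \<and> (\<Sum>e\<leftarrow>fs. Arg (cis (- \<phi>) * e)) = - (real m * \<phi>)"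
    using fs by blast
qed

text \<open>
  Two values on different sides of the positive axis and less than \<open>\<pi>\<close> apart have a positive convex
  combination, by the identity \<open>sin b cis a - sin a cis b = sin (b - a)\<close>.
\<close>
lemma positive_combination:
  assumes T: "T \<in> carrier_mat n n" and z1: "z1 \<in> numerical_range T" "z1 \<noteq> 0" and z2: "z2 \<in> numerical_range T" "z2 \<noteq> 0"
    and \<phi>: "\<bar>\<phi>\<bar> \<le> pi / 2"
    and 1: "Arg (cis (- \<phi>) * z1) < - \<phi>" and 2: "- \<phi> < Arg (cis (- \<phi>) * z2)"
    and d: "Arg (cis (- \<phi>) * z2) - Arg (cis (- \<phi>) * z1) < pi"
  shows "\<exists>z\<in>numerical_range T. 0 < z"
proof -
  define a where "a = \<phi> + Arg (cis (- \<phi>) * z1)"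
  define b where "b = \<phi> + Arg (cis (- \<phi>) * z2)"
  have ab: "a < 0" "0 < b" "b - a < pi" using 1 2 d by (auto simp: a_def b_def)
  have pol: "z = of_real (norm z) * cis (\<phi> + Arg (cis (- \<phi>) * z))" for z
  proof -
    have "z = cis \<phi> * (cis (- \<phi>) * z)" by (simp add: mult.assoc[symmetric] cis_mult)
    also have "cis (- \<phi>) * z = rcis (norm z) (Arg (cis (- \<phi>) * z))"
      using rcis_cmod_Arg[of "cis (- \<phi>) * z"] by (simp add: norm_mult)
    finally show ?thesis by (simp add: rcis_def cis_mult[symmetric] mult.left_commute)
  qed
  define p where "p = sin b / norm z1"
  define q where "q = - sin a / norm z2"
  have sn: "0 < sin b" "0 < sin (- a)" "0 < sin (b - a)" by (rule sin_gt_zero; use ab in linarith)+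
  have pq: "0 < p" "0 < q" unfolding p_def q_def using sn z1 z2 by (intro divide_pos_pos; simp)+
  have "of_real p * (of_real (norm z1) * cis a) = of_real (sin b) * cis a"
    "of_real q * (of_real (norm z2) * cis b) = - of_real (sin a) * cis b"
    using z1(2) z2(2) by (simp_all add: p_def q_def)
  then have "of_real p * z1 + of_real q * z2 = of_real (sin b) * cis a - of_real (sin a) * cis b"
    unfolding pol[of z1, folded a_def, symmetric] pol[of z2, folded b_def, symmetric] by simp
  also have "\<dots> = of_real (sin (b - a))" by (simp add: complex_eq_iff sin_diff algebra_simps)
  finally have eq: "of_real p * z1 + of_real q * z2 = of_real (sin (b - a))" .
  have "(p / (p + q)) *\<^sub>R z1 + (q / (p + q)) *\<^sub>R z2 \<in> numerical_range T"
    using pq by (intro convexD[OF convex_numerical_range[OF T] z1(1) z2(1)])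
      (auto simp: add_divide_distrib[symmetric])
  also have "(p / (p + q)) *\<^sub>R z1 + (q / (p + q)) *\<^sub>R z2 = (1 / (p + q)) *\<^sub>R (of_real p * z1 + of_real q * z2)"
    by (simp add: scaleR_conv_of_real add_divide_distrib algebra_simps)
  also have "\<dots> = of_real (sin (b - a) / (p + q))" unfolding eq by (simp add: scaleR_conv_of_real)
  finally show ?thesis using pq sn(3) by (intro bexI[of _ "of_real (sin (b - a) / (p + q))"]) (auto simp: less_complex_def simp del: of_real_divide)
qed

lemma numerical_range_positive_iff:
  assumes T: "T \<in> carrier_mat n n"
  shows "(\<exists>z\<in>numerical_range T. 0 < z) \<longleftrightarrow> (\<exists>x\<in>carrier_vec n. 0 < sesq T x x)"
proof
  assume "\<exists>x\<in>carrier_vec n. 0 < sesq T x x"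
  then obtain x where x: "x \<in> carrier_vec n" "0 < sesq T x x" by blast
  then have "x \<noteq> 0\<^sub>v n" using zero_sesq[OF T] by auto
  then obtain r where r: "0 < r" "(complex_of_real r \<cdot>\<^sub>v x) \<bullet>c (complex_of_real r \<cdot>\<^sub>v x) = 1"
    using normalize_vec x by blast
  have "sesq T (complex_of_real r \<cdot>\<^sub>v x) (complex_of_real r \<cdot>\<^sub>v x) \<in> numerical_range T"
    unfolding numerical_range_sesq[OF T]
    by (intro CollectI exI[of _ "complex_of_real r \<cdot>\<^sub>v x"]) (use r(2) x(1) in auto)
  moreover have "0 < sesq T (complex_of_real r \<cdot>\<^sub>v x) (complex_of_real r \<cdot>\<^sub>v x)"
    unfolding sesq_scale[OF T x(1)] using x(2) r(1) by (auto simp: less_complex_def)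
  ultimately show "\<exists>z\<in>numerical_range T. 0 < z" by blast
qed (auto simp: numerical_range_sesq[OF T])

lemma eigenvalue_in_numerical_range:
  assumes T: "T \<in> carrier_mat n n" and v: "v \<in> carrier_vec n" "v \<noteq> 0\<^sub>v n" and Tv: "T *\<^sub>v v = e \<cdot>\<^sub>v v"
  shows "e \<in> numerical_range T"
proof -
  obtain r where r: "0 < r" "(complex_of_real r \<cdot>\<^sub>v v) \<bullet>c (complex_of_real r \<cdot>\<^sub>v v) = 1"
    using normalize_vec v by blast
  let ?w = "complex_of_real r \<cdot>\<^sub>v v"
  have "T *\<^sub>v ?w = e \<cdot>\<^sub>v ?w" using mult_mat_vec[OF T v(1), of "of_real r"] Tv by (simp add: smult_smult_assoc mult.commute)
  then have "sesq T ?w ?w = e * (?w \<bullet>c ?w)" unfolding sesq_def using cinner_smult_left[of ?w n ?w e] v(1) by simp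
  then show ?thesis unfolding numerical_range_sesq[OF T] r(2) using r(2) v(1) by force
qed

lemma sum_list_between:
  fixes f :: "'a \<Rightarrow> real"
  assumes "xs \<noteq> []" "(\<Sum>x\<leftarrow>xs. f x) = real (length xs) * c" "\<And>x. x \<in> set xs \<Longrightarrow> f x \<noteq> c"
  shows "(\<exists>x\<in>set xs. f x < c) \<and> (\<exists>x\<in>set xs. c < f x)"
proof -
  have up: "(\<Sum>x\<leftarrow>xs. f x) < real (length xs) * c" if "xs \<noteq> []" "\<forall>x\<in>set xs. f x < c" for xs and f :: "'a \<Rightarrow> real" and c
    using that
  proof (induction xs rule: list_nonempty_induct)
    case (cons x xs)
    then show ?case by (simp add: algebra_simps)
  qed simp
  have "\<not> (\<forall>x\<in>set xs. f x < c)" using up[of xs f c] assms(1,2) by auto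
  moreover have "\<not> (\<forall>x\<in>set xs. - f x < - c)"
  proof
    assume "\<forall>x\<in>set xs. - f x < - c"
    then have "(\<Sum>x\<leftarrow>xs. - f x) < real (length xs) * - c" using up[of xs "\<lambda>x. - f x" "- c"] assms(1) by blast
    moreover have "(\<Sum>x\<leftarrow>xs. - f x) = - (\<Sum>x\<leftarrow>xs. f x)" by (simp add: uminus_sum_list_map o_def)
    ultimately show False using assms(2) by simp
  qed
  ultimately show ?thesis using assms(3) by (metis linorder_neqE_linordered_idom neg_less_iff_less)
qed

text \<open>
  The mean of the arguments of the eigenvalues is that of the positive axis, so there are eigenvalues on
  both sides of it. Without a positive value these are \<open>\<pi>\<close> apart and, by convexity, all values lie on the
  boundary line of the half-plane: the rotated matrix is skew-Hermitian. Eigenvectors \<open>x\<close> and \<open>y\<close>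
  for the two sides are orthogonal, and suitable \<open>a x + c y\<close> and \<open>a x - c y\<close> are isotropic.
\<close>
lemma no_positive_value:
  assumes T: "T \<in> carrier_mat m m" and m: "0 < m" and hp: "half_plane m \<phi> T" and \<phi>: "\<bar>\<phi>\<bar> \<le> pi / 2"
    and det: "Determinant.det T \<noteq> 0"
    and es: "char_poly T = (\<Prod>e\<leftarrow>es. [:- e, 1:])"
    and sum: "(\<Sum>e\<leftarrow>es. Arg (cis (- \<phi>) * e)) = - (real m * \<phi>)"
    and nopos: "\<not> (\<exists>z\<in>numerical_range T. 0 < z)"
  shows "\<forall>x\<in>carrier_vec m. Re (cis (- \<phi>) * sesq T x x) = 0"
    and "\<exists>u\<in>carrier_vec m. \<exists>v\<in>carrier_vec m. sesq T u u = 0 \<and> sesq T v v = 0 \<and> sesq T v u \<noteq> 0"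
proof -
  define w where "w = cis (- \<phi>)"
  have w0: "w \<noteq> 0" by (simp add: w_def)
  have W: "0 \<le> Re (w * z)" if "z \<in> numerical_range T" for z
    using hp half_plane_iff_numerical_range[OF T] that unfolding w_def by blast
  have Abd: "\<bar>Arg (w * z)\<bar> \<le> pi / 2" if "z \<in> numerical_range T" for z
    using W[OF that] Arg_Re_nonneg by blast
  have ev: "\<exists>v\<in>carrier_vec m. v \<noteq> 0\<^sub>v m \<and> T *\<^sub>v v = e \<cdot>\<^sub>v v" "e \<in> numerical_range T" "e \<noteq> 0" if "e \<in> set es" for e
    using root_eigenvector[OF T es that] eigenvalue_in_numerical_range[OF T] root_nonzero[OF T es that det] by blast+
  have neq: "Arg (w * z) \<noteq> - \<phi>" if "z \<in> numerical_range T" "z \<noteq> 0" for z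
  proof
    assume eq: "Arg (w * z) = - \<phi>"
    have "z = cis \<phi> * (w * z)" by (simp add: w_def mult.assoc[symmetric] cis_mult)
    also have "w * z = rcis (norm z) (- \<phi>)" using rcis_cmod_Arg[of "w * z"] eq by (simp add: norm_mult w_def)
    also have "cis \<phi> * \<dots> = of_real (norm z)" by (simp add: rcis_def mult.left_commute cis_mult)
    finally have "z = of_real (norm z)" .
    moreover have "0 < complex_of_real (norm z)" using that(2) by (simp add: less_complex_def)
    ultimately have "0 < z" by metis
    then show False using nopos that(1) by blast
  qed
  have len: "length es = m" by (rule char_poly_roots_length[OF T es])
  then have "es \<noteq> []" using m by auto
  moreover have "(\<Sum>e\<leftarrow>es. Arg (w * e)) = real (length es) * (- \<phi>)" using sum len by (simp add: w_def)
  ultimately have "(\<exists>e\<in>set es. Arg (w * e) < - \<phi>) \<and> (\<exists>e\<in>set es. - \<phi> < Arg (w * e))"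
    by (rule sum_list_between) (use ev neq in blast)
  then obtain e1 e2 where e1: "e1 \<in> set es" "Arg (w * e1) < - \<phi>" and e2: "e2 \<in> set es" "- \<phi> < Arg (w * e2)" by blast
  have comb: "pi \<le> Arg (w * z2) - Arg (w * z1)" if "z1 \<in> numerical_range T" "z1 \<noteq> 0" "z2 \<in> numerical_range T" "z2 \<noteq> 0"
     "Arg (w * z1) < - \<phi>" "- \<phi> < Arg (w * z2)" for z1 z2
    using positive_combination[OF T that(1-4) \<phi>] that(5,6) nopos unfolding w_def by force
  have A1: "Arg (w * e1) = - pi / 2" and A2: "Arg (w * e2) = pi / 2"
    using comb[OF ev(2,3)[OF e1(1)] ev(2,3)[OF e2(1)] e1(2) e2(2)] Abd[OF ev(2)[OF e1(1)]] Abd[OF ev(2)[OF e2(1)]]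
    by linarith+
  have line: "Re (w * z) = 0" if z: "z \<in> numerical_range T" for z
  proof (rule ccontr)
    assume "Re (w * z) \<noteq> 0"
    then have "0 < Re (w * z)" using W[OF z] by simp
    then have "\<bar>Arg (w * z)\<bar> < pi / 2" "z \<noteq> 0" using Arg_Re_pos[of "w * z"] by auto
    then show False using comb[OF z _ ev(2,3)[OF e2(1)] _ e2(2)] comb[OF ev(2,3)[OF e1(1)] z _ e1(2)] neq[OF z] A1 A2
      by (smt (verit, best) field_sum_of_halves)
  qed
  have hp0: "half_plane m (\<phi> + pi) T" unfolding half_plane_iff_numerical_range[OF T]
  proof
    fix z assume z: "z \<in> numerical_range T"
    have "cis (- (\<phi> + pi)) = - w" by (simp add: w_def complex_eq_iff)
    then show "0 \<le> Re (cis (- (\<phi> + pi)) * z)" using line[OF z] by simp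
  qed
  show all0: "\<forall>x\<in>carrier_vec m. Re (cis (- \<phi>) * sesq T x x) = 0"
  proof
    fix x :: "complex vec" assume x: "x \<in> carrier_vec m"
    have "cis (- (\<phi> + pi)) = - w" by (simp add: w_def complex_eq_iff)
    moreover have "0 \<le> Re (cis (- (\<phi> + pi)) * sesq T x x)" using hp0 x unfolding half_plane_def by blast
    moreover have "0 \<le> Re (w * sesq T x x)" using hp x unfolding half_plane_def w_def by blast
    ultimately show "Re (cis (- \<phi>) * sesq T x x) = 0" unfolding w_def by simp
  qed
  obtain x where x: "x \<in> carrier_vec m" "x \<noteq> 0\<^sub>v m" "T *\<^sub>v x = e1 \<cdot>\<^sub>v x" using ev(1)[OF e1(1)] by blast
  obtain y where y: "y \<in> carrier_vec m" "y \<noteq> 0\<^sub>v m" "T *\<^sub>v y = e2 \<cdot>\<^sub>v y" using ev(1)[OF e2(1)] by blast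
  define b1 where "b1 = norm e1"
  define b2 where "b2 = norm e2"
  have b: "0 < b1" "0 < b2" using ev(3)[OF e1(1)] ev(3)[OF e2(1)] by (auto simp: b1_def b2_def)
  have we1: "w * e1 = - (\<i> * of_real b1)"
    using rcis_cmod_Arg[of "w * e1"] unfolding A1 by (simp add: norm_mult w_def b1_def rcis_def cis_minus_pi_half complex_eq_iff)
  have we2: "w * e2 = \<i> * of_real b2"
    using rcis_cmod_Arg[of "w * e2"] unfolding A2 by (simp add: norm_mult w_def b2_def rcis_def mult.commute)
  define k where "k = x \<bullet>c y"
  define nx where "nx = Re (x \<bullet>c x)"
  define ny where "ny = Re (y \<bullet>c y)"
  have nxy: "x \<bullet>c x = of_real nx" "y \<bullet>c y = of_real ny" "0 < nx" "0 < ny"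
    using cinner_self[OF x(1)] cinner_self[OF y(1)] x(2) y(2) by (auto simp: nx_def ny_def)
  have s: "sesq T x x = e1 * of_real nx" "sesq T y y = e2 * of_real ny" "sesq T y x = e1 * k" "sesq T x y = e2 * cnj k"
    unfolding sesq_def x(3) y(3) k_def using x(1) y(1) nxy cinner_commute[OF y(1) x(1)]
    by (simp_all add: cinner_smult_left[of _ m])
  have val: "w * sesq T (a \<cdot>\<^sub>v x + c \<cdot>\<^sub>v y) (a \<cdot>\<^sub>v x + c \<cdot>\<^sub>v y) =
      - (\<i> * of_real b1) * (cnj a * a * of_real nx + cnj c * a * k) + \<i> * of_real b2 * (cnj c * c * of_real ny + cnj a * c * cnj k)" for a c
    unfolding sesq_combination[OF T x(1) y(1)] s we1[symmetric] we2[symmetric] by (simp add: algebra_simps)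
  have re0: "Re (w * sesq T (a \<cdot>\<^sub>v x + c \<cdot>\<^sub>v y) (a \<cdot>\<^sub>v x + c \<cdot>\<^sub>v y)) = 0" for a c
    using all0 x(1) y(1) unfolding w_def by simp
  have "(b1 + b2) * Im k = 0" using re0[of 1 1] unfolding val by (simp add: algebra_simps)
  moreover have "(b1 + b2) * Re k = 0" using re0[of 1 \<i>] unfolding val by (simp add: algebra_simps)
  ultimately have k0: "k = 0" using b by (simp add: complex_eq_iff)
  define a where "a = complex_of_real (sqrt (b2 * ny))"
  define c where "c = complex_of_real (sqrt (b1 * nx))"
  have ac: "cnj a * a = of_real (b2 * ny)" "cnj c * c = of_real (b1 * nx)"
    using b nxy by (simp_all add: a_def c_def of_real_mult[symmetric] del: of_real_mult)
  define u where "u = a \<cdot>\<^sub>v x + c \<cdot>\<^sub>v y"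
  define v where "v = a \<cdot>\<^sub>v x + (- c) \<cdot>\<^sub>v y"
  have uv: "u \<in> carrier_vec m" "v \<in> carrier_vec m" using x(1) y(1) by (auto simp: u_def v_def)
  have "w * sesq T u u = 0" unfolding u_def val ac k0 by (simp add: algebra_simps)
  moreover have "w * sesq T v v = 0" unfolding v_def val using ac k0 by (simp add: algebra_simps)
  moreover have "w * sesq T v u = - (\<i> * of_real b1) * (cnj a * a * of_real nx) - \<i> * of_real b2 * (cnj c * c * of_real ny)"
    unfolding u_def v_def we1[symmetric] we2[symmetric] using x(1) y(1) s k0
    by (simp add: sesq_bilinear[OF T] algebra_simps)
  then have "w * sesq T v u = - (2 * \<i>) * of_real (b1 * b2 * nx * ny)" unfolding ac by (simp add: algebra_simps)
  then have "sesq T v u \<noteq> 0" using b nxy by auto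
  ultimately show "\<exists>u\<in>carrier_vec m. \<exists>v\<in>carrier_vec m. sesq T u u = 0 \<and> sesq T v v = 0 \<and> sesq T v u \<noteq> 0"
    using uv w0 by auto
qed

text \<open>
  At \<open>bvec a v\<close> the compression contributes nothing to the real part, which is then a term linear in \<open>a\<close>
  plus a quadratic one; it can only be nonnegative for small \<open>a\<close> if the linear term vanishes.
\<close>
lemma skew_compression_off_diagonal:
  assumes r: "r \<in> carrier_mat 1 m" and T': "T' \<in> carrier_mat m m" and c: "0 < c"
    and hp: "half_plane (1 + m) \<phi> (four_block_mat (c \<cdot>\<^sub>m 1\<^sub>m 1) r (0\<^sub>m m 1) T')"
    and skew: "\<forall>x\<in>carrier_vec m. Re (cis (- \<phi>) * sesq T' x x) = 0" and v: "v \<in> carrier_vec m"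
  shows "(r *\<^sub>v v) $ 0 = 0"
proof -
  define \<rho> where "\<rho> = cis (- \<phi>) * (r *\<^sub>v v) $ 0"
  define c' where "c' = Re c"
  have c': "c = of_real c'" "0 < c'" using c by (auto simp: c'_def less_complex_def complex_eq_iff)
  define e where "e = 1 / (c' + 1)"
  have e: "0 < e" "c' * e < 1" using c' by (auto simp: e_def field_simps)
  define a where "a = - of_real e * \<rho>"
  have "0 \<le> Re (cis (- \<phi>) * sesq (four_block_mat (c \<cdot>\<^sub>m 1\<^sub>m 1) r (0\<^sub>m m 1) T') (bvec a v) (bvec a v))"
    using hp v unfolding half_plane_def by auto
  also have "cis (- \<phi>) * sesq (four_block_mat (c \<cdot>\<^sub>m 1\<^sub>m 1) r (0\<^sub>m m 1) T') (bvec a v) (bvec a v) =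
      cis (- \<phi>) * of_real (c' * (norm a)\<^sup>2) + \<rho> * cnj a + cis (- \<phi>) * sesq T' v v"
    unfolding sesq_block[OF r T' v v] c'(1) \<rho>_def of_real_mult complex_norm_square by (simp add: algebra_simps)
  also have "\<rho> * cnj a = of_real (- e * (norm \<rho>)\<^sup>2)"
    unfolding a_def of_real_mult complex_norm_square by simp
  also have "Re (cis (- \<phi>) * of_real (c' * (norm a)\<^sup>2) + of_real (- e * (norm \<rho>)\<^sup>2) + cis (- \<phi>) * sesq T' v v) =
     cos \<phi> * (c' * (norm a)\<^sup>2) - e * (norm \<rho>)\<^sup>2"
  proof -
    have "Re (cis (- \<phi>) * of_real A) = cos \<phi> * A" for A by simp
    then show ?thesis using skew v by (simp only: plus_complex.sel Re_complex_of_real)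
  qed
  also have "norm a = e * norm \<rho>" using e(1) by (simp add: a_def norm_mult)
  finally have "0 \<le> cos \<phi> * (c' * (e * norm \<rho>)\<^sup>2) - e * (norm \<rho>)\<^sup>2" .
  also have "\<dots> \<le> 1 * (c' * (e * norm \<rho>)\<^sup>2) - e * (norm \<rho>)\<^sup>2"
    using c' by (intro diff_right_mono mult_right_mono) auto
  also have "\<dots> = e * (norm \<rho>)\<^sup>2 * (c' * e - 1)" by (simp add: power2_eq_square algebra_simps)
  finally have "(norm \<rho>)\<^sup>2 \<le> 0" using e by (smt (verit) mult_pos_pos mult_pos_neg zero_le_power2)
  then have "\<rho> = 0" by simp
  then show ?thesis unfolding \<rho>_def by simp
qed

text \<open>
  By \<open>arg_sum_split_off\<close> the hypotheses pass to the compression, except possibly the existence of a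
  positive value. If this fails, \<open>T\<close> is congruent to the orthogonal sum of the positive number \<open>c\<close> and a
  matrix that is skew-Hermitian up to rotation and has isotropic \<open>u\<close> and \<open>v\<close> with \<open>v\<^sup>* T' u \<noteq> 0\<close>. Then the
  vector with coordinates \<open>1, u\<close> is a better choice: its value is also \<open>c\<close>, and its hyperplane contains a
  vector with coordinates \<open>b, v\<close>, \<open>b \<noteq> 0\<close>, of value \<open>c \<bar>b\<bar>\<^sup>2 > 0\<close>.
\<close>
theorem congruent_nonneg_of_arg_sum:
  assumes "T \<in> carrier_mat n n" "half_plane n \<phi> T" "\<bar>\<phi>\<bar> \<le> pi / 2" "Determinant.det T \<noteq> 0"
    "char_poly T = (\<Prod>e\<leftarrow>es. [:- e, 1:])"
    "(\<Sum>e\<leftarrow>es. Arg (cis (- \<phi>) * e)) = - (real n * \<phi>)"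
    "n = 0 \<or> (\<exists>x\<in>carrier_vec n. 0 < sesq T x x)"
  shows "congruent_nonneg n T"
  using assms
proof (induction n arbitrary: T es)
  case 0
  have "nonneg_diagonal T" unfolding nonneg_diagonal_def diagonal_mat_def using 0(1) by auto
  then have "cond_P3 T" unfolding cond_P3_def using similar_mat_refl[OF 0(1)] by blast
  then show ?case by (rule diagonal_congruent_nonneg[OF 0(1)])
next
  case (Suc m)
  let ?n = "1 + m"
  have T: "T \<in> carrier_mat ?n ?n" and hp: "half_plane ?n \<phi> T" and \<phi>: "\<bar>\<phi>\<bar> \<le> pi / 2" and det: "Determinant.det T \<noteq> 0"
    and es: "char_poly T = (\<Prod>e\<leftarrow>es. [:- e, 1:])" and sum: "(\<Sum>e\<leftarrow>es. Arg (cis (- \<phi>) * e)) = - (real ?n * \<phi>)"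
    and "\<exists>x\<in>carrier_vec ?n. 0 < sesq T x x" using Suc.prems by auto
  then obtain x0 where x0: "x0 \<in> carrier_vec ?n" "0 < sesq T x0 x0" by blast
  have step: "congruent_nonneg ?n T" if x: "x \<in> carrier_vec ?n" "0 < sesq T x x"
    and pos: "m = 0 \<or> (\<exists>y\<in>carrier_vec ?n. sesq T y x = 0 \<and> 0 < sesq T y y)" for x
  proof -
    have c0: "sesq T x x \<noteq> 0" using x by auto
    obtain S r T' where S: "S \<in> carrier_mat ?n ?n" "Determinant.det S \<noteq> 0"
      and r: "r \<in> carrier_mat 1 m" and T': "T' \<in> carrier_mat m m"
      and K: "mat_adjoint S * T * S = four_block_mat (sesq T x x \<cdot>\<^sub>m 1\<^sub>m 1) r (0\<^sub>m m 1) T'"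
      and sT': "\<And>v w. v \<in> carrier_vec m \<Longrightarrow> w \<in> carrier_vec m \<Longrightarrow>
         sesq T' w v = sesq T (S *\<^sub>v bvec 0 w) (S *\<^sub>v bvec 0 v)"
      and compl: "\<And>y. y \<in> carrier_vec ?n \<Longrightarrow> sesq T y x = 0 \<Longrightarrow> \<exists>v\<in>carrier_vec m. y = S *\<^sub>v bvec 0 v"
      by (rule split_off_vector[OF T x(1) refl c0]) blast
    note props = arg_sum_split_off[OF T hp \<phi> det es sum S x(2) r T' K sT']
    obtain fs where fs: "char_poly T' = (\<Prod>e\<leftarrow>fs. [:- e, 1:])" "(\<Sum>e\<leftarrow>fs. Arg (cis (- \<phi>) * e)) = - (real m * \<phi>)"
      using props(3) by blast
    have "m = 0 \<or> (\<exists>x\<in>carrier_vec m. 0 < sesq T' x x)"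
    proof (rule disjCI)
      assume "\<not> (\<exists>x\<in>carrier_vec m. 0 < sesq T' x x)"
      then show "m = 0" using pos compl sT' by metis
    qed
    then have "congruent_nonneg m T'"
      using Suc.IH[OF T' props(1) \<phi> props(2) fs(1)] fs(2) by blast
    then have "congruent_nonneg ?n (mat_adjoint S * T * S)"
      unfolding K using r x(2) by (intro congruent_nonneg_block)
    then show ?thesis using congruent_nonneg_congruence[OF T S] by simp
  qed
  have c0: "sesq T x0 x0 \<noteq> 0" using x0 by auto
  define c where "c = sesq T x0 x0"
  obtain S r T' where S: "S \<in> carrier_mat ?n ?n" "Determinant.det S \<noteq> 0"
    and r: "r \<in> carrier_mat 1 m" and T': "T' \<in> carrier_mat m m"
    and K: "mat_adjoint S * T * S = four_block_mat (c \<cdot>\<^sub>m 1\<^sub>m 1) r (0\<^sub>m m 1) T'"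
    and sT': "\<And>v w. v \<in> carrier_vec m \<Longrightarrow> w \<in> carrier_vec m \<Longrightarrow>
       sesq T' w v = sesq T (S *\<^sub>v bvec 0 w) (S *\<^sub>v bvec 0 v)"
    and orth: "\<And>v. v \<in> carrier_vec m \<Longrightarrow> sesq T (S *\<^sub>v bvec 0 v) x0 = 0"
    by (rule split_off_vector[OF T x0(1) c_def[symmetric] c0[folded c_def]]) blast
  have c: "0 < c" using x0 c_def by simp
  note props = arg_sum_split_off[OF T hp \<phi> det es sum S c r T' K sT']
  obtain fs where fs: "char_poly T' = (\<Prod>e\<leftarrow>fs. [:- e, 1:])" "(\<Sum>e\<leftarrow>fs. Arg (cis (- \<phi>) * e)) = - (real m * \<phi>)"
    using props(3) by blast
  have Sb: "S *\<^sub>v bvec a v \<in> carrier_vec ?n" if "v \<in> carrier_vec m" for a v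
    using S that by (intro mult_mat_vec_carrier[OF S(1)]) auto
  have "congruent_nonneg ?n T"
  proof (cases "m = 0 \<or> (\<exists>z\<in>numerical_range T'. 0 < z)")
    case True
    have "m = 0 \<or> (\<exists>y\<in>carrier_vec ?n. sesq T y x0 = 0 \<and> 0 < sesq T y y)"
    proof (cases "m = 0")
      case False
      then obtain v where v: "v \<in> carrier_vec m" "0 < sesq T' v v"
        using True numerical_range_positive_iff[OF T'] by blast
      then show ?thesis using Sb[OF v(1)] orth[OF v(1)] sT'[OF v(1) v(1)] by metis
    qed simp
    then show ?thesis by (rule step[OF x0])
  next
    case False
    then have m: "0 < m" and nopos: "\<not> (\<exists>z\<in>numerical_range T'. 0 < z)" by auto
    note np = no_positive_value[OF T' m props(1) \<phi> props(2) fs nopos]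
    obtain u v where uv: "u \<in> carrier_vec m" "v \<in> carrier_vec m" "sesq T' u u = 0" "sesq T' v v = 0" "sesq T' v u \<noteq> 0"
      using np(2) by blast
    have sK: "sesq (four_block_mat (c \<cdot>\<^sub>m 1\<^sub>m 1) r (0\<^sub>m m 1) T') (bvec a v) (bvec b w) = sesq T (S *\<^sub>v bvec a v) (S *\<^sub>v bvec b w)"
      if "v \<in> carrier_vec m" "w \<in> carrier_vec m" for a v b w
      unfolding K[symmetric] using that by (intro sesq_congruence[OF T S(1)]) auto
    have hpK: "half_plane ?n \<phi> (four_block_mat (c \<cdot>\<^sub>m 1\<^sub>m 1) r (0\<^sub>m m 1) T')"
      unfolding half_plane_def K[symmetric]
    proof
      fix x :: "complex vec" assume x: "x \<in> carrier_vec ?n"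
      show "0 \<le> Re (cis (- \<phi>) * sesq (mat_adjoint S * T * S) x x)"
        unfolding sesq_congruence[OF T S(1) x x]
        using hp mult_mat_vec_carrier[OF S(1) x] unfolding half_plane_def by blast
    qed
    have r0: "(r *\<^sub>v w) $ 0 = 0" if "w \<in> carrier_vec m" for w
      by (rule skew_compression_off_diagonal[OF r T' c hpK np(1) that])
    have form: "sesq T (S *\<^sub>v bvec b w) (S *\<^sub>v bvec a v) = c * a * cnj b + sesq T' w v"
      if "v \<in> carrier_vec m" "w \<in> carrier_vec m" for a b v w
      unfolding sK[OF that(2,1), symmetric] sesq_block[OF r T' that] r0[OF that(1)] by simp
    define b where "b = cnj (- sesq T' v u / c)"
    have b0: "b \<noteq> 0" using uv(5) c by (auto simp: b_def)
    show ?thesis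
    proof (rule step[of "S *\<^sub>v bvec 1 u"])
      show "S *\<^sub>v bvec 1 u \<in> carrier_vec ?n" by (rule Sb[OF uv(1)])
      show "0 < sesq T (S *\<^sub>v bvec 1 u) (S *\<^sub>v bvec 1 u)" unfolding form[OF uv(1,1)] using uv(3) c by simp
      have "sesq T (S *\<^sub>v bvec b v) (S *\<^sub>v bvec 1 u) = 0"
        unfolding form[OF uv(1,2)] using c by (auto simp: b_def)
      moreover have "0 < sesq T (S *\<^sub>v bvec b v) (S *\<^sub>v bvec b v)"
        unfolding form[OF uv(2,2)] uv(4) mult.assoc complex_norm_square[symmetric]
        using c b0 by (auto simp: less_complex_def)
      ultimately show "m = 0 \<or> (\<exists>y\<in>carrier_vec ?n. sesq T y (S *\<^sub>v bvec 1 u) = 0 \<and> 0 < sesq T y y)"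
        using Sb[OF uv(2)] by blast
    qed
  qed
  then show ?case by simp
qed

section \<open>Products of three positive definite matrices\<close>

lemma invertible_det:
  fixes A :: "complex mat"
  assumes "invertible_mat A" and A: "A \<in> carrier_mat n n"
  shows "Determinant.det A \<noteq> 0"
proof -
  obtain B where B: "A * B = 1\<^sub>m (dim_row A)" "B * A = 1\<^sub>m (dim_row B)"
    using assms(1) unfolding invertible_mat_def inverts_mat_def by blast
  have "dim_col B = n" using arg_cong[OF B(1), of dim_col] A by simp
  moreover have "dim_row B = n" using arg_cong[OF B(2), of dim_col] A by simp
  ultimately have "B \<in> carrier_mat n n" by auto
  then show ?thesis using inverse_det[OF A _ ] B(1) A by fastforce
qed

text \<open>
  A half-plane containing a positive number has its axis within \<open>\<pi> / 2\<close> of the positive axis.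
\<close>
lemma half_plane_normalize:
  assumes T: "T \<in> carrier_mat n n" and hp: "half_plane n \<phi>0 T" and z: "z \<in> numerical_range T" "0 < z"
  shows "\<exists>\<phi>. \<bar>\<phi>\<bar> \<le> pi / 2 \<and> half_plane n \<phi> T"
proof (intro exI conjI)
  let ?\<phi> = "Arg (cis \<phi>0)"
  have "cis ?\<phi> = cis \<phi>0" using cis_Arg[of "cis \<phi>0"] by (simp add: sgn_div_norm)
  then have "cis (- ?\<phi>) = cis (- \<phi>0)" by (metis cis_cnj)
  then show "half_plane n ?\<phi> T" using hp unfolding half_plane_def by simp
  have "0 \<le> Re (cis (- \<phi>0) * z)" using hp half_plane_iff_numerical_range[OF T] z(1) by blast
  then have "0 \<le> Re (cis \<phi>0)" using z(2) by (auto simp: less_complex_def zero_le_mult_iff)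
  then show "\<bar>?\<phi>\<bar> \<le> pi / 2" using Arg_Re_nonneg by blast
qed

text \<open>
  The rotation by \<open>- \<phi>\<close> shifts all principal arguments by the same amount: it could only fail to do so
  at an eigenvalue on the negative real axis.
\<close>
lemma cond_ii_imp_congruent_nonneg:
  assumes T: "T \<in> carrier_mat k k" and det: "Determinant.det T \<noteq> 0" and ii: "cond_ii T"
  shows "congruent_nonneg k T"
proof -
  obtain r es where int: "0 \<notin> interior (numerical_range T)" and r: "r \<in> numerical_range T" "0 < r"
    and es: "char_poly T = (\<Prod>e\<leftarrow>es. [:- e, 1:])"
    and bd: "\<And>e. e \<in> set es \<Longrightarrow> - pi < Arg e \<and> Arg e < pi" and sum: "(\<Sum>e\<leftarrow>es. Arg e) = 0"
    using ii unfolding cond_ii_def by blast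
  obtain \<phi>0 where "half_plane k \<phi>0 T" using not_interior_imp_half_plane[OF T int] by blast
  then obtain \<phi> where \<phi>: "\<bar>\<phi>\<bar> \<le> pi / 2" and hp: "half_plane k \<phi> T"
    using half_plane_normalize[OF T _ r] by blast
  have shift: "Arg (cis (- \<phi>) * e) = Arg e - \<phi>" if e: "e \<in> set es" for e
  proof -
    obtain v where v: "v \<in> carrier_vec k" "v \<noteq> 0\<^sub>v k" "T *\<^sub>v v = e \<cdot>\<^sub>v v" using root_eigenvector[OF T es e] by blast
    have e0: "e \<noteq> 0" by (rule root_nonzero[OF T es e det])
    have "0 \<le> Re (cis (- \<phi>) * e)"
      using hp half_plane_iff_numerical_range[OF T] eigenvalue_in_numerical_range[OF T v] by blast
    then have a: "\<bar>Arg (cis (- \<phi>) * e)\<bar> \<le> pi / 2" using Arg_Re_nonneg by blast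
    have "\<phi> + Arg (cis (- \<phi>) * e) \<noteq> - pi"
    proof
      assume eq: "\<phi> + Arg (cis (- \<phi>) * e) = - pi"
      have "e = cis \<phi> * (cis (- \<phi>) * e)" by (simp add: mult.assoc[symmetric] cis_mult)
      also have "cis (- \<phi>) * e = rcis (norm e) (Arg (cis (- \<phi>) * e))"
        using rcis_cmod_Arg[of "cis (- \<phi>) * e"] by (simp add: norm_mult)
      also have "cis \<phi> * \<dots> = of_real (norm e) * cis (\<phi> + Arg (cis (- \<phi>) * e))"
        by (simp add: rcis_def cis_mult[symmetric])
      finally have "e = of_real (- norm e)" unfolding eq by (simp add: complex_eq_iff)
      then have "Arg e = pi" unfolding Arg_eq_pi using e0 by (metis Im_complex_of_real Re_complex_of_real neg_less_0_iff_less zero_less_norm_iff)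
      then show False using bd[OF e] by simp
    qed
    then have "Arg e = \<phi> + Arg (cis (- \<phi>) * e)" using a \<phi> by (intro Arg_cis_mult[OF e0]) (auto simp: abs_le_iff)
    then show ?thesis by simp
  qed
  have "(\<Sum>e\<leftarrow>es. Arg (cis (- \<phi>) * e)) = (\<Sum>e\<leftarrow>es. Arg e - \<phi>)"
    using shift by (intro arg_cong[of _ _ sum_list] map_cong) auto
  also have "\<dots> = - (real k * \<phi>)"
    using sum char_poly_roots_length[OF T es] by (simp add: sum_list_subtractf sum_list_triv)
  finally have "(\<Sum>e\<leftarrow>es. Arg (cis (- \<phi>) * e)) = - (real k * \<phi>)" .
  moreover have "\<exists>x\<in>carrier_vec k. 0 < sesq T x x" using numerical_range_positive_iff[OF T] r by blast
  ultimately show ?thesis using congruent_nonneg_of_arg_sum[OF T hp \<phi> det es] by blast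
qed

lemma cond_i_imp_congruent_nonneg:
  assumes T: "T \<in> carrier_mat k k" and i: "cond_i T"
  shows "congruent_nonneg k T"
  using congruent_nonneg_of_interior[OF T] i interior_iff_not_half_plane[OF T] unfolding cond_i_def by blast

lemma pd_product_3_of_cond:
  assumes T: "T \<in> carrier_mat k k" and det: "Determinant.det T \<noteq> 0" and "cond_i T \<or> cond_ii T"
  shows "pd_product k 3 T"
  using assms cond_i_imp_congruent_nonneg cond_ii_imp_congruent_nonneg congruent_nonneg_pd_product_3 by blast

lemma mult_pos_pos_complex: "0 < (a::complex) \<Longrightarrow> 0 < b \<Longrightarrow> 0 < a * b"
  by (simp add: less_complex_def)

lemma pd_mult_roots_pos:
  assumes B: "pd n B" and C: "pd n C" and fs: "char_poly (B * C) = (\<Prod>e\<leftarrow>fs. [:- e, 1:])" and f: "f \<in> set fs"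
  shows "0 < f"
proof -
  have BC: "B * C \<in> carrier_mat n n" using pd_carrier[OF B] pd_carrier[OF C] by simp
  have "Determinant.det (B * C) \<noteq> 0"
    using det_mult[OF pd_carrier[OF B] pd_carrier[OF C]] B C pd_iff_psd_det by auto
  then have "f \<noteq> 0" using root_nonzero[OF BC fs f] by blast
  moreover have "0 \<le> f"
    using root_eigenvector[OF BC fs f] nonneg_semisimpleD2[OF psd_mult_semisimple[OF pd_imp_psd[OF B] pd_imp_psd[OF C]]]
    by blast
  ultimately show ?thesis by (simp add: order.strict_iff_order)
qed

lemma sum_list_nonneg_eq_0D:
  fixes f :: "'a \<Rightarrow> real"
  assumes "\<And>x. x \<in> set xs \<Longrightarrow> 0 \<le> f x" "(\<Sum>x\<leftarrow>xs. f x) = 0" "x \<in> set xs"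
  shows "f x = 0"
  using sum_list_nonneg_eq_0_iff[of "map f xs"] assms by auto

text \<open>
  If \<open>T = B C D\<close> has its numerical range in a half-plane, its argument sum equals that of \<open>C D\<close>,
  whose eigenvalues are positive; otherwise \<open>0\<close> is interior to the numerical range. A positive value is taken at \<open>D\<^sup>-\<^sup>1 w\<close> for an eigenvector \<open>w\<close> of \<open>B C\<close>.
\<close>
theorem pd_product_3_imp_cond:
  assumes T: "T \<in> carrier_mat k k" and k: "0 < k" and "pd_product k 3 T"
  shows "cond_i T \<or> cond_ii T"
proof -
  obtain B C D where B: "pd k B" and C: "pd k C" and D: "pd k D" and TBCD: "T = B * (C * D)"
    using assms(3) unfolding pd_product_3 by blast
  note c = pd_carrier[OF B] pd_carrier[OF C] pd_carrier[OF D]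
  have CD: "C * D \<in> carrier_mat k k" using c by simp
  have det: "0 < Determinant.det T"
    unfolding TBCD det_mult[OF c(1) CD] det_mult[OF c(2,3)]
    by (intro mult_pos_pos_complex) (use pd_det_pos B C D in blast)+
  show ?thesis
  proof (cases "\<exists>\<phi>. half_plane k \<phi> T")
    case False
    then show ?thesis using det interior_iff_not_half_plane[OF T] unfolding cond_i_def by blast
  next
    case True
    then obtain \<phi>0 where hp0: "half_plane k \<phi>0 T" by blast
    have int: "0 \<notin> interior (numerical_range T)" using interior_imp_not_half_plane[OF T] hp0 by blast
    have BC: "B * C \<in> carrier_mat k k" using c by simp
    obtain gs where gs: "char_poly (B * C) = (\<Prod>e\<leftarrow>gs. [:- e, 1:])" using char_poly_factorized[OF BC] by blast
    have "gs \<noteq> []" using char_poly_roots_length[OF BC gs] k by auto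
    then obtain l where l: "l \<in> set gs" by (meson list.set_sel(1))
    obtain w where w: "w \<in> carrier_vec k" "w \<noteq> 0\<^sub>v k" "(B * C) *\<^sub>v w = l \<cdot>\<^sub>v w"
      using root_eigenvector[OF BC gs l] by blast
    have "Determinant.det D \<noteq> 0" using D pd_iff_psd_det by blast
    then obtain D' where D': "D' \<in> carrier_mat k k" "D * D' = 1\<^sub>m k" using det_inverse[OF c(3)] by blast
    define y where "y = D' *\<^sub>v w"
    have y: "y \<in> carrier_vec k" using mult_mat_vec_carrier[OF D'(1) w(1)] by (simp add: y_def)
    have Dy: "D *\<^sub>v y = w" unfolding y_def using assoc_mult_mat_vec[OF c(3) D'(1) w(1)] D'(2) w(1) by simp
    have "y \<noteq> 0\<^sub>v k" using Dy zero_mult_vec[OF c(3)] w(2) by auto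
    then have "0 < sesq D y y" using D y unfolding pd_sesq by blast
    moreover have "T *\<^sub>v y = l \<cdot>\<^sub>v w"
    proof -
      have "T = (B * C) * D" unfolding TBCD using c by (simp add: assoc_mult_mat[of _ k k _ k _ k])
      then have "T *\<^sub>v y = (B * C) *\<^sub>v (D *\<^sub>v y)" using assoc_mult_mat_vec[OF BC c(3) y] by simp
      then show ?thesis unfolding Dy w(3) .
    qed
    then have "sesq T y y = l * sesq D y y"
      unfolding sesq_def Dy using cinner_smult_left[OF w(1) y] by simp
    ultimately have "0 < sesq T y y" using mult_pos_pos_complex[OF pd_mult_roots_pos[OF B C gs l]] by simp
    then obtain r where r: "r \<in> numerical_range T" "0 < r" using numerical_range_positive_iff[OF T] y by blast
    obtain \<phi> where \<phi>: "\<bar>\<phi>\<bar> \<le> pi / 2" and hp: "half_plane k \<phi> T" using half_plane_normalize[OF T hp0 r] by blast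
    have "Determinant.det B \<noteq> 0" using B pd_iff_psd_det by blast
    then obtain P where P: "P \<in> carrier_mat k k" "B * P = 1\<^sub>m k" "P * B = 1\<^sub>m k" using det_inverse[OF c(1)] by blast
    have PT: "P * T = C * D"
    unfolding TBCD assoc_mult_mat[OF P(1) c(1) CD, symmetric] P(3) by (rule left_mult_one_mat[OF CD])
    obtain es where es: "char_poly T = (\<Prod>e\<leftarrow>es. [:- e, 1:])" using char_poly_factorized[OF T] by blast
    obtain fs where fs: "char_poly (C * D) = (\<Prod>e\<leftarrow>fs. [:- e, 1:])" using char_poly_factorized[OF CD] by blast
    have dT: "Determinant.det T \<noteq> 0" using det by auto
    have "(\<Sum>e\<leftarrow>es. Arg (cis (- \<phi>) * e)) = (\<Sum>e\<leftarrow>fs. Arg (cis (- \<phi>) * e))"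
      using arg_sum_invariant[OF T hp dT B P(1,2) es] fs unfolding PT by blast
    also have "\<dots> = (\<Sum>e\<leftarrow>fs. - \<phi>)"
      using Arg_cis_pos[OF pd_mult_roots_pos[OF C D fs] \<phi>] by (intro arg_cong[of _ _ sum_list] map_cong) auto
    also have "\<dots> = - (real k * \<phi>)" using char_poly_roots_length[OF CD fs] by (simp add: sum_list_triv)
    finally have sum: "(\<Sum>e\<leftarrow>es. \<phi> + Arg (cis (- \<phi>) * e)) = 0"
      using char_poly_roots_length[OF T es] by (simp add: sum_list_addf sum_list_triv)
    have a: "\<bar>Arg (cis (- \<phi>) * e)\<bar> \<le> pi / 2" "e \<noteq> 0" if e: "e \<in> set es" for e
    proof -
      obtain v where v: "v \<in> carrier_vec k" "v \<noteq> 0\<^sub>v k" "T *\<^sub>v v = e \<cdot>\<^sub>v v" using root_eigenvector[OF T es e] by blast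
      have "0 \<le> Re (cis (- \<phi>) * e)"
        using hp half_plane_iff_numerical_range[OF T] eigenvalue_in_numerical_range[OF T v] by blast
      then show "\<bar>Arg (cis (- \<phi>) * e)\<bar> \<le> pi / 2" using Arg_Re_nonneg by blast
      show "e \<noteq> 0" by (rule root_nonzero[OF T es e dT])
    qed
    \<comment> \<open>The negative axis is met only if the half-plane is the upper or the lower one; then all
        arguments have the same sign and vanish with their sum.\<close>
    have bd: "\<phi> + Arg (cis (- \<phi>) * e) \<noteq> pi" "\<phi> + Arg (cis (- \<phi>) * e) \<noteq> - pi" if e: "e \<in> set es" for e
    proof -
      show "\<phi> + Arg (cis (- \<phi>) * e) \<noteq> pi"
      proof
        assume eq: "\<phi> + Arg (cis (- \<phi>) * e) = pi"
        then have "\<phi> = pi / 2" using a(1)[OF e] \<phi> by linarith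
        then have "0 \<le> \<phi> + Arg (cis (- \<phi>) * x)" if "x \<in> set es" for x using a(1)[OF that] by linarith
        then have "\<phi> + Arg (cis (- \<phi>) * e) = 0"
          using sum_list_nonneg_eq_0D[OF _ sum e] by blast
        then show False using eq pi_gt_zero by simp
      qed
      show "\<phi> + Arg (cis (- \<phi>) * e) \<noteq> - pi"
      proof
        assume eq: "\<phi> + Arg (cis (- \<phi>) * e) = - pi"
        then have "\<phi> = - pi / 2" using a(1)[OF e] \<phi> by linarith
        then have "0 \<le> - (\<phi> + Arg (cis (- \<phi>) * x))" if "x \<in> set es" for x using a(1)[OF that] by linarith
        moreover have "(\<Sum>e\<leftarrow>es. - (\<phi> + Arg (cis (- \<phi>) * e))) = 0"
          using sum uminus_sum_list_map[of "\<lambda>e. \<phi> + Arg (cis (- \<phi>) * e)" es] by (simp add: o_def)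
        ultimately have "- (\<phi> + Arg (cis (- \<phi>) * e)) = 0"
          using sum_list_nonneg_eq_0D[of es "\<lambda>e. - (\<phi> + Arg (cis (- \<phi>) * e))" e] e by blast
        then show False using eq pi_gt_zero by simp
      qed
    qed
    have Arg_e: "Arg e = \<phi> + Arg (cis (- \<phi>) * e)" if e: "e \<in> set es" for e
    proof (rule Arg_cis_mult[OF a(2)[OF e]])
      have "- pi \<le> \<phi> + Arg (cis (- \<phi>) * e)" "\<phi> + Arg (cis (- \<phi>) * e) \<le> pi" using a(1)[OF e] \<phi> by linarith+
      then show "- pi < \<phi> + Arg (cis (- \<phi>) * e)" "\<phi> + Arg (cis (- \<phi>) * e) \<le> pi" using bd[OF e] by linarith+
    qed
    have "(\<Sum>e\<leftarrow>es. Arg e) = (\<Sum>e\<leftarrow>es. \<phi> + Arg (cis (- \<phi>) * e))"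
      using Arg_e by (intro arg_cong[of _ _ sum_list] map_cong) auto
    moreover have "- pi < Arg e \<and> Arg e < pi" if e: "e \<in> set es" for e
      using mpi_less_Arg[of e] Arg_le_pi[of e] bd[OF e] Arg_e[OF e] by linarith
    ultimately have "cond_ii T" unfolding cond_ii_def using int r es sum by auto
    then show ?thesis ..
  qed
qed

section \<open>Products of four positive semi-definite matrices\<close>

lemma cond_P3_transpose:
  assumes "cond_P3 (transpose_mat A)" and A: "A \<in> carrier_mat n n"
  shows "cond_P3 A"
proof -
  obtain D P Q where D: "D \<in> carrier_mat n n" and P: "P \<in> carrier_mat n n" and Q: "Q \<in> carrier_mat n n"
    and PQ: "P * Q = 1\<^sub>m n" "Q * P = 1\<^sub>m n" and AT: "transpose_mat A = P * D * Q" and diag: "diagonal_mat D"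
    and nn: "\<And>i. i < n \<Longrightarrow> 0 \<le> D $$ (i, i)"
    using assms(1) transpose_carrier_mat[of A n n] A by (rule cond_P3E[OF _ iffD2]) blast
  have DT: "transpose_mat D = D"
  proof (rule eq_matI)
    fix i j assume "i < dim_row D" "j < dim_col D"
    then show "transpose_mat D $$ (i, j) = D $$ (i, j)" using D diag by (cases "i = j") (auto simp: diagonal_mat_def)
  qed (use D in auto)
  have "A = transpose_mat (P * D * Q)" using AT by (metis transpose_transpose)
  also have "\<dots> = transpose_mat Q * (D * transpose_mat P)"
    unfolding transpose_mult[OF mult_carrier_sq[OF P D] Q] transpose_mult[OF P D] DT ..
  also have "\<dots> = transpose_mat Q * D * transpose_mat P" using D P Q by (simp add: assoc_mult_mat[of _ n n _ n _ n])
  finally have "similar_mat A D"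
    using A D P Q PQ by (intro similar_matI[of _ _ "transpose_mat Q" "transpose_mat P" n])
      (auto simp: transpose_mult[of P n n Q n, symmetric] transpose_mult[of Q n n P n, symmetric])
  moreover have "nonneg_diagonal D" unfolding nonneg_diagonal_def using D diag nn by auto
  ultimately show ?thesis unfolding cond_P3_def by blast
qed

text \<open>
  A matrix for which every vector is an eigenvector is scalar.
\<close>
lemma nonscalar_vector:
  fixes A :: "complex mat"
  assumes A: "A \<in> carrier_mat n n" and ns: "\<not> (\<exists>\<alpha>. A = \<alpha> \<cdot>\<^sub>m 1\<^sub>m n)"
  shows "\<exists>x\<in>carrier_vec n. \<forall>\<mu>. A *\<^sub>v x \<noteq> \<mu> \<cdot>\<^sub>v x"
proof (rule ccontr)
  assume "\<not> ?thesis"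
  then have "\<forall>x\<in>carrier_vec n. \<exists>\<mu>. A *\<^sub>v x = \<mu> \<cdot>\<^sub>v x" by blast
  then obtain \<mu> where \<mu>: "\<And>x. x \<in> carrier_vec n \<Longrightarrow> A *\<^sub>v x = \<mu> x \<cdot>\<^sub>v x" by metis
  define m where "m i = \<mu> (unit_vec n i)" for i
  have ent: "A $$ (j, i) = (if i = j then m i else 0)" if "i < n" "j < n" for i j
  proof -
    have "(A *\<^sub>v unit_vec n i) $ j = A $$ (j, i)" using mult_unit_vec[OF A that(1)] A that by simp
    then show ?thesis unfolding \<mu>[OF unit_vec_carrier] m_def[symmetric] using that by auto
  qed
  have "m i = m j" if ij: "i < n" "j < n" "i \<noteq> j" for i j
  proof -
    let ?x = "unit_vec n i + unit_vec n j"
    have "A *\<^sub>v ?x = A *\<^sub>v unit_vec n i + A *\<^sub>v unit_vec n j" by (rule mult_add_distrib_mat_vec[OF A]) auto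
    then have eq: "\<mu> ?x \<cdot>\<^sub>v ?x = m i \<cdot>\<^sub>v unit_vec n i + m j \<cdot>\<^sub>v unit_vec n j"
      using \<mu>[of ?x] \<mu>[OF unit_vec_carrier] by (simp add: m_def)
    have "(\<mu> ?x \<cdot>\<^sub>v ?x) $ i = m i" "(\<mu> ?x \<cdot>\<^sub>v ?x) $ j = m j" unfolding eq using ij by auto
    moreover have "(\<mu> ?x \<cdot>\<^sub>v ?x) $ i = \<mu> ?x" "(\<mu> ?x \<cdot>\<^sub>v ?x) $ j = \<mu> ?x" using ij by auto
    ultimately show ?thesis by simp
  qed
  then have "A = m 0 \<cdot>\<^sub>m 1\<^sub>m n" using ent A by (intro eq_matI) (auto, metis gr_implies_not0 neq0_conv)
  then show False using ns by blast
qed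

text \<open>
  The transpose of \<open>cond_P3_border_finite\<close>.
\<close>
lemma cond_P3_border_lower:
  assumes "cond_P3 M" and M: "M \<in> carrier_mat r r"
  shows "\<exists>F. finite F \<and> (\<forall>c. 0 \<le> c \<and> c \<notin> F \<longrightarrow> (\<forall>m. \<forall>Y\<in>(carrier_mat r m :: complex mat set).
    cond_P3 (four_block_mat (c \<cdot>\<^sub>m 1\<^sub>m m) (0\<^sub>m m r) Y M)))"
proof -
  have MT: "transpose_mat M \<in> carrier_mat r r" using M by simp
  have "cond_P3 (transpose_mat M)"
    using cond_P3_transpose[OF _ MT] assms(1) by simp
  from cond_P3_border_finite[OF this MT] obtain F where F: "finite F"
    "\<And>c m X. 0 \<le> c \<Longrightarrow> c \<notin> F \<Longrightarrow> X \<in> (carrier_mat m r :: complex mat set) \<Longrightarrow>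
      cond_P3 (four_block_mat (c \<cdot>\<^sub>m 1\<^sub>m m) X (0\<^sub>m r m) (transpose_mat M))" by blast
  show ?thesis
  proof (intro exI[of _ F] conjI allI impI ballI F(1))
    fix c m and Y :: "complex mat" assume c: "0 \<le> c \<and> c \<notin> F" and Y: "Y \<in> carrier_mat r m"
    have "transpose_mat (four_block_mat (c \<cdot>\<^sub>m 1\<^sub>m m) (0\<^sub>m m r) Y M) =
      four_block_mat (c \<cdot>\<^sub>m 1\<^sub>m m) (transpose_mat Y) (0\<^sub>m r m) (transpose_mat M)"
      using Y M by (intro eq_matI) auto
    moreover have "cond_P3 (four_block_mat (c \<cdot>\<^sub>m 1\<^sub>m m) (transpose_mat Y) (0\<^sub>m r m) (transpose_mat M))"
      using F(2)[of c "transpose_mat Y" m] c Y by simp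
    ultimately show "cond_P3 (four_block_mat (c \<cdot>\<^sub>m 1\<^sub>m m) (0\<^sub>m m r) Y M)"
      using cond_P3_transpose[of "four_block_mat (c \<cdot>\<^sub>m 1\<^sub>m m) (0\<^sub>m m r) Y M" "m + r"] M by simp
  qed
qed

text \<open>
  Let \<open>x\<close> not be an eigenvector and \<open>d = A x - x\<close>. In a basis that starts with \<open>x\<close> and whose other
  vectors span a hyperplane containing \<open>d\<close>, the first column is \<open>A x = x + d\<close>.
\<close>
lemma nonscalar_leading_one:
  fixes A :: "complex mat"
  assumes A: "A \<in> carrier_mat (1 + m) (1 + m)" and ns: "\<not> (\<exists>\<alpha>. A = \<alpha> \<cdot>\<^sub>m 1\<^sub>m (1 + m))"
  shows "\<exists>r s D. r \<in> carrier_mat 1 m \<and> s \<in> carrier_mat m 1 \<and> D \<in> carrier_mat m m \<and> s \<noteq> 0\<^sub>m m 1 \<and>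
    similar_mat A (four_block_mat (1\<^sub>m 1) r s D)"
proof -
  let ?n = "1 + m"
  obtain x where x: "x \<in> carrier_vec ?n" and ne: "\<And>\<mu>. A *\<^sub>v x \<noteq> \<mu> \<cdot>\<^sub>v x" using nonscalar_vector[OF A ns] by blast
  have Ax: "A *\<^sub>v x \<in> carrier_vec ?n" by (rule mult_mat_vec_carrier[OF A x])
  define d where "d = A *\<^sub>v x + (- 1) \<cdot>\<^sub>v x"
  have d: "d \<in> carrier_vec ?n" using Ax x by (simp add: d_def)
  have Axd: "A *\<^sub>v x = x + d" unfolding d_def using Ax x A by (intro eq_vecI) auto
  have d0: "d \<noteq> 0\<^sub>v ?n"
  proof
    assume "d = 0\<^sub>v ?n"
    then have "A *\<^sub>v x = 1 \<cdot>\<^sub>v x" unfolding Axd using x by simp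
    then show False using ne by blast
  qed
  have xd: "x \<noteq> \<mu> \<cdot>\<^sub>v d" for \<mu>
  proof
    assume eq: "x = \<mu> \<cdot>\<^sub>v d"
    have "\<mu> \<noteq> 0"
    proof
      assume "\<mu> = 0"
      then have "x = 0\<^sub>v ?n" using eq d by (intro eq_vecI) auto
      moreover have "0 \<cdot>\<^sub>v (0\<^sub>v ?n :: complex vec) = 0\<^sub>v ?n" by (intro eq_vecI) auto
      ultimately have "A *\<^sub>v x = 0 \<cdot>\<^sub>v x" using zero_mult_vec[OF A] by simp
      then show False using ne by blast
    qed
    then have "d = (1 / \<mu>) \<cdot>\<^sub>v x" unfolding eq by (simp add: smult_smult_assoc)
    then have "A *\<^sub>v x = (1 + 1 / \<mu>) \<cdot>\<^sub>v x" unfolding Axd using x by (intro eq_vecI) (auto simp: algebra_simps)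
    then show False using ne by blast
  qed
  obtain u where u: "u \<in> carrier_vec ?n" "x \<bullet>c u = 1" "d \<bullet>c u = 0" using dual_vector[OF x d d0 xd] by blast
  have "x \<bullet>c u \<noteq> 0" using u by simp
  then obtain S where S: "S \<in> carrier_mat ?n ?n" and dS: "Determinant.det S \<noteq> 0" and Sx: "S *\<^sub>v bvec 1 (0\<^sub>v m) = x"
    and orth: "\<And>v. v \<in> carrier_vec m \<Longrightarrow> (S *\<^sub>v bvec 0 v) \<bullet>c u = 0"
    using adapted_basis[OF u(1) x] by blast
  obtain R where R: "R \<in> carrier_mat ?n ?n" and SR: "S * R = 1\<^sub>m ?n" and RS: "R * S = 1\<^sub>m ?n"
    using det_inverse[OF S dS] by blast
  define N where "N = R * A * S"
  have N: "N \<in> carrier_mat ?n ?n" unfolding N_def using R A S by (intro mult_carrier_sq)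
  note a = assoc_mult_mat[of _ ?n ?n _ ?n _ ?n]
  have "S * N * R = (S * R) * A * (S * R)" unfolding N_def using R A S by (simp only: a mult_carrier_sq)
  also have "\<dots> = A" unfolding SR using A by simp
  finally have sim: "similar_mat A N" using A N S R SR RS by (intro similar_matI[of _ _ S R ?n]) auto
  have RSv: "R *\<^sub>v (S *\<^sub>v v) = v" if "v \<in> carrier_vec ?n" for v
    using assoc_mult_mat_vec[OF R S that] RS that by simp
  have SRv: "S *\<^sub>v (R *\<^sub>v v) = v" if "v \<in> carrier_vec ?n" for v
    using assoc_mult_mat_vec[OF S R that] SR that by simp
  have e0: "bvec 1 (0\<^sub>v m) \<in> carrier_vec ?n" by simp
  have Rx: "R *\<^sub>v x = bvec 1 (0\<^sub>v m)" unfolding Sx[symmetric] by (rule RSv[OF e0])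
  have Rd: "R *\<^sub>v d \<in> carrier_vec ?n" by (rule mult_mat_vec_carrier[OF R d])
  obtain g t where g: "g \<in> carrier_vec m" and Rdg: "R *\<^sub>v d = bvec t g" using bvec_cases[OF Rd] by blast
  have bsplit: "bvec t g = t \<cdot>\<^sub>v bvec 1 (0\<^sub>v m) + bvec 0 g"
    using g by (intro eq_vecI) (auto simp: bvec_def append_vec_def)
  have Sg: "S *\<^sub>v bvec 0 g \<in> carrier_vec ?n" using g by (intro mult_mat_vec_carrier[OF S]) auto
  have "d = S *\<^sub>v bvec t g" using SRv[OF d] Rdg by simp
  also have "\<dots> = t \<cdot>\<^sub>v x + S *\<^sub>v bvec 0 g"
    unfolding bsplit using g by (simp add: mult_add_distrib_mat_vec[OF S] mult_mat_vec[OF S] Sx)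
  finally have "d \<bullet>c u = t * (x \<bullet>c u) + (S *\<^sub>v bvec 0 g) \<bullet>c u"
    using x u(1) Sg by (simp add: cinner_add_left[of _ ?n] cinner_smult_left[of _ ?n])
  then have t0: "t = 0" using u orth[OF g] by simp
  have g0: "g \<noteq> 0\<^sub>v m"
  proof
    assume "g = 0\<^sub>v m"
    then have "R *\<^sub>v d = 0\<^sub>v ?n" using Rdg t0 bvec_0 by simp
    then have "d = 0\<^sub>v ?n" using SRv[OF d] zero_mult_vec[OF S] by simp
    then show False using d0 by simp
  qed
  have "N *\<^sub>v bvec 1 (0\<^sub>v m) = R *\<^sub>v (A *\<^sub>v (S *\<^sub>v bvec 1 (0\<^sub>v m)))"
    unfolding N_def using assoc_mult_mat_vec[OF mult_carrier_sq[OF R A] S e0]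
      assoc_mult_mat_vec[OF R A mult_mat_vec_carrier[OF S e0]] by simp
  also have "\<dots> = R *\<^sub>v x + R *\<^sub>v d" unfolding Sx Axd by (rule mult_add_distrib_mat_vec[OF R x d])
  also have "\<dots> = bvec 1 g" unfolding Rx Rdg t0
    using g by (intro eq_vecI) (auto simp: bvec_def append_vec_def)
  finally have col0: "col N 0 = bvec 1 g"
    using mult_unit_vec[OF N, of 0] unit_vec_bvec(1)[of m] by simp
  define r where "r = Matrix.mat 1 m (\<lambda>(i, j). N $$ (0, Suc j))"
  define s where "s = Matrix.mat m 1 (\<lambda>(i, j). g $ i)"
  define D where "D = Matrix.mat m m (\<lambda>(i, j). N $$ (Suc i, Suc j))"
  have N0: "N $$ (i, 0) = bvec 1 g $ i" if "i < ?n" for i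
    using arg_cong[OF col0, of "\<lambda>v. v $ i"] that N by simp
  have "N = four_block_mat (1\<^sub>m 1) r s D"
  proof (rule eq_matI)
    fix i j assume "i < dim_row (four_block_mat (1\<^sub>m 1) r s D)" "j < dim_col (four_block_mat (1\<^sub>m 1) r s D)"
    then have ij: "i < Suc m" "j < Suc m" by (auto simp: D_def)
    show "N $$ (i, j) = four_block_mat (1\<^sub>m 1) r s D $$ (i, j)"
      using ij N0 g by (cases i; cases j) (auto simp: r_def s_def D_def bvec_index)
  next
    show "dim_row N = dim_row (four_block_mat (1\<^sub>m 1) r s D)" "dim_col N = dim_col (four_block_mat (1\<^sub>m 1) r s D)"
      using carrier_matD[OF N] by (simp_all add: D_def)
  qed
  moreover have "s \<noteq> 0\<^sub>m m 1"
  proof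
    assume "s = 0\<^sub>m m 1"
    then have "g $ i = 0" if "i < m" for i proof -
      have "s $$ (i, 0) = 0" unfolding \<open>s = 0\<^sub>m m 1\<close> using that by simp
      then show ?thesis using that by (simp add: s_def)
    qed
    then have "g = 0\<^sub>v m" using g by (intro eq_vecI) auto
    then show False using g0 by simp
  qed
  ultimately show ?thesis using sim by (intro exI[of _ r] exI[of _ s] exI[of _ D]) (auto simp: r_def s_def D_def)
qed

lemma mult_1x1:
  fixes q s :: "complex mat"
  assumes "q \<in> carrier_mat 1 m" "s \<in> carrier_mat m 1"
  shows "q * s = ((q * s) $$ (0, 0)) \<cdot>\<^sub>m 1\<^sub>m 1"
  using assms by (intro eq_matI) auto

lemma outer_index:
  fixes q s :: "complex mat"
  assumes "s \<in> carrier_mat m 1" "q \<in> carrier_mat 1 k" "i < m" "j < k"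
  shows "(s * q) $$ (i, j) = s $$ (i, 0) * q $$ (0, j)"
  using assms by (simp add: scalar_prod_def)

text \<open>
  If the Schur complement is the scalar \<open>\<delta>\<close>, the shear by a row \<open>q\<close> with \<open>q s = 0\<close> keeps the
  leading entry and changes the complement to \<open>\<delta> (I + s q)\<close>.
\<close>
lemma nonscalar_schur_complement:
  fixes r s :: "complex mat"
  assumes r: "r \<in> carrier_mat 1 m" and s: "s \<in> carrier_mat m 1" "s \<noteq> 0\<^sub>m m 1" and m: "1 < m" and \<delta>: "\<delta> \<noteq> 0"
  shows "\<exists>r' D'. r' \<in> carrier_mat 1 m \<and> D' \<in> carrier_mat m m \<and> \<not> (\<exists>\<alpha>. D' = \<alpha> \<cdot>\<^sub>m 1\<^sub>m m) \<and>
    similar_mat (four_block_mat (1\<^sub>m 1) r s (\<delta> \<cdot>\<^sub>m 1\<^sub>m m + s * r)) (four_block_mat (1\<^sub>m 1) r' s (D' + s * r'))"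
proof -
  obtain i where i: "i < m" "s $$ (i, 0) \<noteq> 0"
  proof -
    have "\<exists>i<m. s $$ (i, 0) \<noteq> 0"
    proof (rule ccontr)
      assume "\<not> ?thesis"
      then have "s = 0\<^sub>m m 1" using s(1) by (intro eq_matI) auto
      then show False using s by simp
    qed
    then show thesis using that by blast
  qed
  obtain j where j: "j < m" "j \<noteq> i" using m by (metis less_one nat_neq_iff not_less_iff_gr_or_eq order_less_trans zero_less_one)
  define q where "q = Matrix.mat 1 m (\<lambda>(_, l). if l = j then 1 else if l = i then - s $$ (j, 0) / s $$ (i, 0) else 0)"
  have q: "q \<in> carrier_mat 1 m" by (simp add: q_def)
  have "(q * s) $$ (0, 0) = (\<Sum>l<m. q $$ (0, l) * s $$ (l, 0))"
    using q s(1) by (auto simp: scalar_prod_def lessThan_atLeast0 intro!: sum.cong)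
  also have "\<dots> = (\<Sum>l<m. (if l = j then s $$ (j, 0) else 0) + (if l = i then - s $$ (j, 0) else 0))"
    using i j by (intro sum.cong) (auto simp: q_def)
  also have "\<dots> = 0" using i j by (simp add: sum.distrib)
  finally have qs: "q * s = 0\<^sub>m 1 1" using mult_1x1[OF q s(1)] by (auto intro!: eq_matI)
  define D' where "D' = \<delta> \<cdot>\<^sub>m (1\<^sub>m m + s * q)"
  define r' where "r' = q + r - \<delta> \<cdot>\<^sub>m q"
  have sq: "s * q \<in> carrier_mat m m" and sr: "s * r \<in> carrier_mat m m" using s q r by auto
  have D': "D' \<in> carrier_mat m m" and r': "r' \<in> carrier_mat 1 m" unfolding D'_def r'_def
    by (rule smult_carrier_mat[OF add_carrier_mat[OF sq]], rule minus_carrier_mat[OF smult_carrier_mat[OF q]])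
  have "\<not> (\<exists>\<alpha>. D' = \<alpha> \<cdot>\<^sub>m 1\<^sub>m m)"
  proof
    assume "\<exists>\<alpha>. D' = \<alpha> \<cdot>\<^sub>m 1\<^sub>m m"
    then obtain \<alpha> where "D' = \<alpha> \<cdot>\<^sub>m 1\<^sub>m m" by blast
    from arg_cong[OF this, of "\<lambda>M. M $$ (i, j)"] have "\<delta> * (s * q) $$ (i, j) = 0"
      using i j sq s q by (simp add: D'_def)
    then show False using outer_index[OF s(1) q i(1) j(1)] i(2) \<delta> j by (simp add: q_def)
  qed
  moreover have "similar_mat (four_block_mat (1\<^sub>m 1) r s (\<delta> \<cdot>\<^sub>m 1\<^sub>m m + s * r)) (four_block_mat (1\<^sub>m 1) r' s (D' + s * r'))"
  proof (rule similar_matI[of _ _ "four_block_mat (1\<^sub>m 1) q (0\<^sub>m m 1) (1\<^sub>m m)" "four_block_mat (1\<^sub>m 1) (- q) (0\<^sub>m m 1) (1\<^sub>m m)" "1 + m"])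
    let ?E = "four_block_mat (1\<^sub>m 1) q (0\<^sub>m m 1) (1\<^sub>m m)" and ?E' = "four_block_mat (1\<^sub>m 1) (- q) (0\<^sub>m m 1) (1\<^sub>m m)"
    have z: "q + - q = 0\<^sub>m 1 m" "- q + q = 0\<^sub>m 1 m" "- 0\<^sub>m m m + 1\<^sub>m m = (1\<^sub>m m :: complex mat)"
      using q by (auto intro!: eq_matI)
    show "?E * ?E' = 1\<^sub>m (1 + m)" "?E' * ?E = 1\<^sub>m (1 + m)"
      using mult_four_block_mat[of "1\<^sub>m 1" 1 1 q m "0\<^sub>m m 1" m "1\<^sub>m m" "1\<^sub>m 1" 1 "- q" m "0\<^sub>m m 1" "1\<^sub>m m"]
        mult_four_block_mat[of "1\<^sub>m 1" 1 1 "- q" m "0\<^sub>m m 1" m "1\<^sub>m m" "1\<^sub>m 1" 1 "q" m "0\<^sub>m m 1" "1\<^sub>m m"] q z by auto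
    let ?K = "four_block_mat (1\<^sub>m 1) r' s (D' + s * r')"
    have Ds: "D' + s * r' \<in> carrier_mat m m" using D' s r' by auto
    have "q * D' = \<delta> \<cdot>\<^sub>m q"
    proof -
      have "q * D' = \<delta> \<cdot>\<^sub>m (q * (1\<^sub>m m + s * q))" unfolding D'_def using q sq
        by (intro mult_smult_distrib[of _ 1 m _ m]) auto
      also have "q * (1\<^sub>m m + s * q) = q * 1\<^sub>m m + q * (s * q)" using q sq by (intro mult_add_distrib_mat[of _ 1 m]) auto
      also have "q * (s * q) = (q * s) * q" using assoc_mult_mat[OF q s(1) q] by simp
      also have "\<dots> = 0\<^sub>m 1 m" unfolding qs using q by simp
      finally show ?thesis using q by simp
    qed
    moreover have "q * (s * r') = 0\<^sub>m 1 m" using assoc_mult_mat[OF q s(1) r'] r' unfolding qs by simp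
    ultimately have qDs: "q * (D' + s * r') = \<delta> \<cdot>\<^sub>m q"
      using mult_add_distrib_mat[of q 1 m D' m "s * r'"] q D' s r' by auto
    have EK: "?E * ?K = four_block_mat (1\<^sub>m 1) (r' + \<delta> \<cdot>\<^sub>m q) s (D' + s * r')"
      using mult_four_block_mat[of "1\<^sub>m 1" 1 1 q m "0\<^sub>m m 1" m "1\<^sub>m m" "1\<^sub>m 1" 1 r' m s "D' + s * r'"] q r' s Ds qs qDs by auto
    have "r' + \<delta> \<cdot>\<^sub>m q = q + r" unfolding r'_def using q r by (intro eq_matI) auto
    then have EK: "?E * ?K = four_block_mat (1\<^sub>m 1) (q + r) s (D' + s * r')" using EK by simp
    have ur: "1\<^sub>m 1 * - q + (q + r) * 1\<^sub>m m = r" using q r by (intro eq_matI) auto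
    have lr: "s * - q + (D' + s * r') * 1\<^sub>m m = \<delta> \<cdot>\<^sub>m 1\<^sub>m m + s * r"
    proof -
      have "(D' + s * r') * 1\<^sub>m m = D' + s * r'" using Ds by (rule right_mult_one_mat)
      then show ?thesis
        using q r s D' r' sq sr by (intro eq_matI) (auto simp: D'_def r'_def scalar_prod_def algebra_simps)
    qed
    have "?E * ?K * ?E' = four_block_mat (1\<^sub>m 1) r s (\<delta> \<cdot>\<^sub>m 1\<^sub>m m + s * r)"
      unfolding EK
      using mult_four_block_mat[of "1\<^sub>m 1" 1 1 "q + r" m s m "D' + s * r'" "1\<^sub>m 1" 1 "- q" m "0\<^sub>m m 1" "1\<^sub>m m"]
        q r s Ds ur lr by auto
    then show "four_block_mat (1\<^sub>m 1) r s (\<delta> \<cdot>\<^sub>m 1\<^sub>m m + s * r) = ?E * ?K * ?E'" ..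
  next
    have "{four_block_mat (1\<^sub>m 1) r s (\<delta> \<cdot>\<^sub>m 1\<^sub>m m + s * r), four_block_mat (1\<^sub>m 1) r' s (D' + s * r'),
       four_block_mat (1\<^sub>m 1) q (0\<^sub>m m 1) (1\<^sub>m m), four_block_mat (1\<^sub>m 1) (- q) (0\<^sub>m m 1) (1\<^sub>m m)}
      \<subseteq> carrier_mat (1 + m) (1 + m)"
      unfolding insert_subset using q r r' s D' sr by (intro conjI four_block_carrier_mat; auto)
    then show "{four_block_mat (1\<^sub>m 1) r s (\<delta> \<cdot>\<^sub>m 1\<^sub>m m + s * r), four_block_mat (1\<^sub>m 1) r' s (D' + s * r'),
       four_block_mat (1\<^sub>m 1) q (0\<^sub>m m 1) (1\<^sub>m m), four_block_mat (1\<^sub>m 1) (- q) (0\<^sub>m m 1) (1\<^sub>m m)}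
      \<subseteq> carrier_mat (1 + m) (1 + m)" .
  qed
  ultimately show ?thesis using D' r' by blast
qed


lemma det_schur:
  fixes r s :: "complex mat"
  assumes r: "r \<in> carrier_mat 1 m" and s: "s \<in> carrier_mat m 1" and D: "D \<in> carrier_mat m m"
  shows "Determinant.det (four_block_mat (1\<^sub>m 1) r s (D + s * r)) = Determinant.det D"
proof -
  let ?L = "four_block_mat (1\<^sub>m 1) (0\<^sub>m 1 m) s (1\<^sub>m m)" and ?U = "four_block_mat (1\<^sub>m 1) r (0\<^sub>m m 1) D"
  have sr: "s * r \<in> carrier_mat m m" using r s by simp
  have "?L * ?U = four_block_mat (1\<^sub>m 1) r s (s * r + D)"
    using mult_four_block_mat[of "1\<^sub>m 1" 1 1 "0\<^sub>m 1 m" m s m "1\<^sub>m m" "1\<^sub>m 1" 1 r m "0\<^sub>m m 1" D] r s D by auto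
  also have "s * r + D = D + s * r" by (rule comm_add_mat[OF sr D])
  finally have "Determinant.det (four_block_mat (1\<^sub>m 1) r s (D + s * r)) = Determinant.det ?L * Determinant.det ?U"
    using det_mult[of ?L "1 + m" ?U] four_block_carrier_mat[of "1\<^sub>m 1" 1 1 "1\<^sub>m m" m m "0\<^sub>m 1 m" s]
      four_block_carrier_mat[of "1\<^sub>m 1" 1 1 D m m r "0\<^sub>m m 1"] D by simp
  then show ?thesis
    using det_four_block_mat_upper_right_zero[of "1\<^sub>m 1" 1 "0\<^sub>m 1 m" m s "1\<^sub>m m"] s
      det_four_block_mat_lower_left_zero[of "1\<^sub>m 1" 1 r m "0\<^sub>m m 1" D] r D by simp
qed

text \<open>
  The Schur complement \<open>D\<close> of the corner has the determinant of \<open>A\<close>, so the induction can go on with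
  \<open>D\<close> as soon as it is nonscalar.
\<close>
lemma similar_mat_nonscalar_step:
  fixes A :: "complex mat"
  assumes A: "A \<in> carrier_mat (1 + m) (1 + m)" and ns: "\<not> (\<exists>\<alpha>. A = \<alpha> \<cdot>\<^sub>m 1\<^sub>m (1 + m))"
    and det: "Determinant.det A \<noteq> 0"
  shows "\<exists>r s D. r \<in> carrier_mat 1 m \<and> s \<in> carrier_mat m 1 \<and> D \<in> carrier_mat m m \<and>
    similar_mat A (four_block_mat (1\<^sub>m 1) r s (D + s * r)) \<and> (m \<le> 1 \<or> \<not> (\<exists>\<alpha>. D = \<alpha> \<cdot>\<^sub>m 1\<^sub>m m))"
proof -
  obtain r s E where r: "r \<in> carrier_mat 1 m" and s: "s \<in> carrier_mat m 1" and E: "E \<in> carrier_mat m m"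
    and s0: "s \<noteq> 0\<^sub>m m 1" and sim: "similar_mat A (four_block_mat (1\<^sub>m 1) r s E)"
    using nonscalar_leading_one[OF A ns] by blast
  have sr: "s * r \<in> carrier_mat m m" using r s by simp
  define D where "D = E - s * r"
  have D: "D \<in> carrier_mat m m" unfolding D_def by (rule minus_carrier_mat[OF sr])
  have "D + s * r = E" unfolding D_def using E sr r s by (intro eq_matI) auto
  then have sim': "similar_mat A (four_block_mat (1\<^sub>m 1) r s (D + s * r))" using sim by simp
  show ?thesis
  proof (cases "1 < m \<and> (\<exists>\<alpha>. D = \<alpha> \<cdot>\<^sub>m 1\<^sub>m m)")
    case True
    then obtain \<delta> where \<delta>: "D = \<delta> \<cdot>\<^sub>m 1\<^sub>m m" by blast
    have "Determinant.det A = Determinant.det D" using det_similar[OF sim'] det_schur[OF r s D] by simp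
    moreover have "Determinant.det D = \<delta> ^ m" unfolding \<delta> by simp
    ultimately have "\<delta> \<noteq> 0" using det True by auto
    then obtain r' D' where r': "r' \<in> carrier_mat 1 m" and D': "D' \<in> carrier_mat m m"
      and ns': "\<not> (\<exists>\<alpha>. D' = \<alpha> \<cdot>\<^sub>m 1\<^sub>m m)"
      and sim2: "similar_mat (four_block_mat (1\<^sub>m 1) r s (\<delta> \<cdot>\<^sub>m 1\<^sub>m m + s * r)) (four_block_mat (1\<^sub>m 1) r' s (D' + s * r'))"
      using nonscalar_schur_complement[OF r s s0] True by blast
    have "similar_mat A (four_block_mat (1\<^sub>m 1) r' s (D' + s * r'))"
      using similar_mat_trans[OF sim'[unfolded \<delta>] sim2] .
    then show ?thesis using r' s D' ns' by (intro exI[of _ r'] exI[of _ s] exI[of _ D'] conjI disjI2)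
  next
    case False
    then have "m \<le> 1 \<or> \<not> (\<exists>\<alpha>. D = \<alpha> \<cdot>\<^sub>m 1\<^sub>m m)" by (cases "1 < m") auto
    then show ?thesis using r s D sim' by (intro exI[of _ r] exI[of _ s] exI[of _ D] conjI)
  qed
qed

text \<open>
  If the Schur complement is \<open>B C\<close>, then the matrix with blocks \<open>1\<close>, \<open>r\<close>, \<open>s\<close> and \<open>B C + s r\<close> is the
  product of the block triangular matrices with diagonal blocks \<open>\<beta>\<close>, \<open>B\<close> and \<open>1 / \<beta>\<close>, \<open>C\<close>, for
  any \<open>\<beta> > 0\<close>. For all but finitely many \<open>\<beta>\<close> both are again similar to nonnegative diagonal matrices.
\<close>
theorem nonscalar_two_factors:
  fixes A :: "complex mat"
  assumes "A \<in> carrier_mat n n" "0 < Determinant.det A" "n \<le> 1 \<or> \<not> (\<exists>\<alpha>. A = \<alpha> \<cdot>\<^sub>m 1\<^sub>m n)"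
  shows "\<exists>B\<in>carrier_mat n n. \<exists>C\<in>carrier_mat n n. cond_P3 B \<and> cond_P3 C \<and> A = B * C"
  using assms
proof (induction n arbitrary: A)
  case 0
  have "cond_P3 A" "cond_P3 (1\<^sub>m 0)"
    using 0 by (intro cond_P3_dim_le_1[of _ 0]; simp add: less_eq_complex_def)+
  then show ?case using 0 by (intro bexI[of _ A] bexI[of _ "1\<^sub>m 0"]) auto
next
  case (Suc m)
  show ?case
  proof (cases "m = 0")
    case True
    have "cond_P3 A" using Suc.prems True by (intro cond_P3_dim_le_1[of _ 1]) auto
    moreover have "cond_P3 (1\<^sub>m 1)" by (intro cond_P3_dim_le_1[of _ 1]) (auto simp: less_eq_complex_def)
    ultimately show ?thesis using Suc.prems True by (intro bexI[of _ A] bexI[of _ "1\<^sub>m 1"]) auto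
  next
    case False
    then have ns: "\<not> (\<exists>\<alpha>. A = \<alpha> \<cdot>\<^sub>m 1\<^sub>m (1 + m))" using Suc.prems(3) by simp
    have A: "A \<in> carrier_mat (1 + m) (1 + m)" using Suc.prems by simp
    have dA: "Determinant.det A \<noteq> 0" using Suc.prems(2) by auto
    obtain r s D where r: "r \<in> carrier_mat 1 m" and s: "s \<in> carrier_mat m 1" and D: "D \<in> carrier_mat m m"
      and sim: "similar_mat A (four_block_mat (1\<^sub>m 1) r s (D + s * r))"
      and nsD: "m \<le> 1 \<or> \<not> (\<exists>\<alpha>. D = \<alpha> \<cdot>\<^sub>m 1\<^sub>m m)"
      using similar_mat_nonscalar_step[OF A ns dA] by blast
    have sr: "s * r \<in> carrier_mat m m" using r s by simp
    have "Determinant.det A = Determinant.det D" using det_similar[OF sim] det_schur[OF r s D] by simp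
    then have "0 < Determinant.det D" using Suc.prems(2) by simp
    from Suc.IH[OF D this nsD] obtain B C where B: "B \<in> carrier_mat m m" "cond_P3 B"
      and C: "C \<in> carrier_mat m m" "cond_P3 C" and BC: "D = B * C" by blast
    obtain F where F: "finite F" "\<And>c X. 0 \<le> c \<Longrightarrow> c \<notin> F \<Longrightarrow> X \<in> carrier_mat m 1 \<Longrightarrow>
        cond_P3 (four_block_mat (c \<cdot>\<^sub>m 1\<^sub>m 1) (0\<^sub>m 1 m) X B)"
      using cond_P3_border_lower[OF B(2,1)] by blast
    obtain G where G: "finite G" "\<And>c X. 0 \<le> c \<Longrightarrow> c \<notin> G \<Longrightarrow> X \<in> carrier_mat 1 m \<Longrightarrow>
        cond_P3 (four_block_mat (c \<cdot>\<^sub>m 1\<^sub>m 1) X (0\<^sub>m m 1) C)"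
      using cond_P3_border_finite[OF C(2,1)] by blast
    have "finite (Re ` (F \<union> inverse ` G))" using F(1) G(1) by simp
    moreover have "infinite {0 <..(1::real)}" by simp
    ultimately obtain t where t: "t \<in> {0 <..1}" "t \<notin> Re ` (F \<union> inverse ` G)"
      by (meson finite_subset subsetI)
    define \<beta> where "\<beta> = complex_of_real t"
    have \<beta>0: "0 \<le> \<beta>" "0 \<le> inverse \<beta>" "\<beta> \<noteq> 0" using t(1) by (auto simp: \<beta>_def less_eq_complex_def)
    have "\<beta> \<notin> F" using t(2) by (force simp: \<beta>_def)
    then have PB: "cond_P3 (four_block_mat (\<beta> \<cdot>\<^sub>m 1\<^sub>m 1) (0\<^sub>m 1 m) (\<beta> \<cdot>\<^sub>m s) B)" using F(2) \<beta>0 s by simp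
    have "inverse \<beta> \<notin> G"
    proof
      assume "inverse \<beta> \<in> G"
      then have "inverse (inverse \<beta>) \<in> inverse ` G" by blast
      then have "\<beta> \<in> F \<union> inverse ` G" by simp
      then have "Re \<beta> \<in> Re ` (F \<union> inverse ` G)" by blast
      then show False using t(2) by (simp add: \<beta>_def)
    qed
    then have PC: "cond_P3 (four_block_mat (inverse \<beta> \<cdot>\<^sub>m 1\<^sub>m 1) (inverse \<beta> \<cdot>\<^sub>m r) (0\<^sub>m m 1) C)" using G(2) \<beta>0 r by simp
    define B' where "B' = four_block_mat (\<beta> \<cdot>\<^sub>m 1\<^sub>m 1) (0\<^sub>m 1 m) (\<beta> \<cdot>\<^sub>m s) B"
    define C' where "C' = four_block_mat (inverse \<beta> \<cdot>\<^sub>m 1\<^sub>m 1) (inverse \<beta> \<cdot>\<^sub>m r) (0\<^sub>m m 1) C"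
    have B': "B' \<in> carrier_mat (1 + m) (1 + m)" and C': "C' \<in> carrier_mat (1 + m) (1 + m)"
      unfolding B'_def C'_def using B C by (intro four_block_carrier_mat; simp)+
    have e1: "\<beta> \<cdot>\<^sub>m 1\<^sub>m 1 * (inverse \<beta> \<cdot>\<^sub>m 1\<^sub>m 1) = 1\<^sub>m 1"
      using \<beta>0 by (intro eq_matI) (auto simp: scalar_prod_def)
    have e2: "\<beta> \<cdot>\<^sub>m 1\<^sub>m 1 * (inverse \<beta> \<cdot>\<^sub>m r) = r"
      using \<beta>0 r by (intro eq_matI) (auto simp: scalar_prod_def)
    have e3: "\<beta> \<cdot>\<^sub>m s * (inverse \<beta> \<cdot>\<^sub>m 1\<^sub>m 1) = s"
      using \<beta>0 s by (intro eq_matI) (auto simp: scalar_prod_def)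
    have e4: "\<beta> \<cdot>\<^sub>m s * (inverse \<beta> \<cdot>\<^sub>m r) = s * r"
      using \<beta>0 s r by (intro eq_matI) (auto simp: scalar_prod_def)
    have "B' * C' = four_block_mat (1\<^sub>m 1) r s (s * r + B * C)"
      unfolding B'_def C'_def
      using mult_four_block_mat[of "\<beta> \<cdot>\<^sub>m 1\<^sub>m 1" 1 1 "0\<^sub>m 1 m" m "\<beta> \<cdot>\<^sub>m s" m B
        "inverse \<beta> \<cdot>\<^sub>m 1\<^sub>m 1" 1 "inverse \<beta> \<cdot>\<^sub>m r" m "0\<^sub>m m 1" C] r s B(1) C(1) e1 e2 e3 e4 by simp
    also have "s * r + B * C = D + s * r" unfolding BC[symmetric] by (rule comm_add_mat[OF sr D])
    finally have sim2: "similar_mat A (B' * C')" using sim by simp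
    obtain P Q where "similar_mat_wit A (B' * C') P Q" using sim2 unfolding similar_mat_def by blast
    note w = similar_mat_witD2[OF A this]
    have conj: "cond_P3 (P * X * Q)" if "cond_P3 X" and X: "X \<in> carrier_mat (1 + m) (1 + m)" for X
    proof (rule cond_P3_similar[OF _ that(1)])
      have "P * X * Q \<in> carrier_mat (1 + m) (1 + m)" using w(6,7) X by (intro mult_carrier_sq)
      then show "similar_mat (P * X * Q) X" using w X by (intro similar_matI[of _ _ P Q "1 + m"]) auto
    qed
    note a = assoc_mult_mat[of _ "1 + m" "1 + m" _ "1 + m" _ "1 + m"]
    have "(P * B' * Q) * (P * C' * Q) = P * (B' * ((Q * P) * (C' * Q)))"
      using w(6,7) B' C' by (simp only: a mult_carrier_sq)
    also have "\<dots> = P * (B' * (C' * Q))" unfolding w(2) left_mult_one_mat[OF mult_carrier_sq[OF C' w(7)]] ..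
    also have "\<dots> = A" unfolding w(3) using w(6,7) B' C' by (simp only: a mult_carrier_sq)
    finally have "A = (P * B' * Q) * (P * C' * Q)" ..
    moreover have "P * B' * Q \<in> carrier_mat (Suc m) (Suc m)" "P * C' * Q \<in> carrier_mat (Suc m) (Suc m)"
      using w(6,7) B' C' by (auto intro!: mult_carrier_sq)
    ultimately show ?thesis using conj[OF PB[folded B'_def] B'] conj[OF PC[folded C'_def] C'] by blast
  qed
qed

corollary nonscalar_psd_product_4:
  fixes A :: "complex mat"
  assumes "A \<in> carrier_mat n n" "0 < Determinant.det A" "n \<le> 1 \<or> \<not> (\<exists>\<alpha>. A = \<alpha> \<cdot>\<^sub>m 1\<^sub>m n)"
  shows "psd_product n 4 A"
proof -
  obtain B C where "B \<in> carrier_mat n n" "C \<in> carrier_mat n n" "cond_P3 B" "cond_P3 C" "A = B * C"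
    using nonscalar_two_factors[OF assms] by blast
  then have "psd_product n (2 + 2) A" using psd_product_mult[of n 2 B 2 C] psd_product_2_iff by simp
  then show ?thesis by simp
qed

section \<open>Direct sums with a zero block\<close>

lemma append_cases:
  fixes x :: "complex vec"
  assumes "x \<in> carrier_vec (k + p)"
  obtains u v where "u \<in> carrier_vec k" "v \<in> carrier_vec p" "x = u @\<^sub>v v"
  using assms vec_first_last_append[of x k p] vec_first_carrier vec_last_carrier by metis

lemma append_zero: "0\<^sub>v k @\<^sub>v 0\<^sub>v p = (0\<^sub>v (k + p) :: complex vec)"
  by (intro eq_vecI) (auto simp: append_vec_def)

lemma append_eq_zero:
  fixes u v :: "complex vec"
  assumes "u \<in> carrier_vec k" "v \<in> carrier_vec p" "u @\<^sub>v v = 0\<^sub>v (k + p)"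
  shows "u = 0\<^sub>v k" "v = 0\<^sub>v p"
  using assms append_vec_eq[of u k "0\<^sub>v k" v "0\<^sub>v p"] by (auto simp: append_zero)

lemma cinner_append:
  fixes u v :: "complex vec"
  assumes "u \<in> carrier_vec k" "v \<in> carrier_vec p" "x \<in> carrier_vec k" "y \<in> carrier_vec p"
  shows "(u @\<^sub>v v) \<bullet>c (x @\<^sub>v y) = u \<bullet>c x + v \<bullet>c y"
proof -
  have "conjugate (x @\<^sub>v y) = conjugate x @\<^sub>v conjugate y"
    using assms by (intro eq_vecI) (auto simp: append_vec_def)
  then show ?thesis using assms scalar_prod_append[of u k v p "conjugate x" "conjugate y"] by simp
qed

abbreviation (input) pad_zero :: "nat \<Rightarrow> nat \<Rightarrow> complex mat \<Rightarrow> complex mat" where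
  "pad_zero k p T \<equiv> four_block_mat T (0\<^sub>m k p) (0\<^sub>m p k) (0\<^sub>m p p)"

lemma pad_zero_carrier: "T \<in> carrier_mat k k \<Longrightarrow> pad_zero k p T \<in> carrier_mat (k + p) (k + p)"
  by (rule four_block_carrier_mat) auto

lemma pad_zero_mult_vec:
  assumes "T \<in> carrier_mat k k" "u \<in> carrier_vec k" "v \<in> carrier_vec p"
  shows "pad_zero k p T *\<^sub>v (u @\<^sub>v v) = (T *\<^sub>v u) @\<^sub>v 0\<^sub>v p"
  using mult_mat_vec_split[OF assms(1) zero_carrier_mat assms(2,3)] zero_mat_mult_vec[OF assms(3), of p] by simp

lemma pad_zero_mult:
  assumes "S \<in> carrier_mat k k" "T \<in> carrier_mat k k"
  shows "pad_zero k p S * pad_zero k p T = pad_zero k p (S * T)"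
  using mult_four_block_mat[of S k k "0\<^sub>m k p" p "0\<^sub>m p k" p "0\<^sub>m p p" T k "0\<^sub>m k p" p "0\<^sub>m p k" "0\<^sub>m p p"]
    assms by simp

lemma psd_pad_zero:
  assumes P: "psd k P"
  shows "psd (k + p) (pad_zero k p P)"
  unfolding psd_def
proof (intro conjI ballI)
  have Pc: "P \<in> carrier_mat k k" using P by (rule psd_carrier)
  show "pad_zero k p P \<in> carrier_mat (k + p) (k + p)" by (rule pad_zero_carrier[OF Pc])
  show "mat_adjoint (pad_zero k p P) = pad_zero k p P"
    using adjoint_four_block[of P k k "0\<^sub>m k p" p "0\<^sub>m p k" p "0\<^sub>m p p"] P by (simp add: psd_def)
  fix x :: "complex vec" assume "x \<in> carrier_vec (k + p)"
  then obtain u v where uv: "u \<in> carrier_vec k" "v \<in> carrier_vec p" "x = u @\<^sub>v v" by (rule append_cases)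
  have "(pad_zero k p P *\<^sub>v x) \<bullet>c x = (P *\<^sub>v u) \<bullet>c u + 0\<^sub>v p \<bullet>c v"
    unfolding uv(3) pad_zero_mult_vec[OF Pc uv(1,2)] using Pc uv by (intro cinner_append) auto
  also have "0\<^sub>v p \<bullet>c v = 0" using uv(2) by simp
  finally show "0 \<le> (pad_zero k p P *\<^sub>v x) \<bullet>c x" using P uv(1) by (simp add: psd_def)
qed

lemma psd_product_3I: "psd n B \<Longrightarrow> psd n C \<Longrightarrow> psd n D \<Longrightarrow> psd_product n 3 (B * (C * D))"
  using psd_product_mult[of n 1 B 2 "C * D"] psd_product_2[of n C D] unfolding psd_product_1 by (simp add: numeral_3_eq_3)

lemma pd_product_3_pad_zero:
  assumes "pd_product k 3 T"
  shows "psd_product (k + p) 3 (pad_zero k p T)"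
proof -
  obtain B C D where *: "pd k B" "pd k C" "pd k D" "T = B * (C * D)" using assms unfolding pd_product_3 by blast
  note c = pd_carrier[OF *(1)] pd_carrier[OF *(2)] pd_carrier[OF *(3)]
  have "pad_zero k p T = pad_zero k p B * (pad_zero k p C * pad_zero k p D)"
    unfolding *(4) pad_zero_mult[OF c(2,3)] pad_zero_mult[OF c(1) mult_carrier_sq[OF c(2,3)]] ..
  then show ?thesis using psd_product_3I psd_pad_zero *(1-3) pd_imp_psd by metis
qed

text \<open>
  \<open>T \<oplus> 0\<close> is the projection \<open>I \<oplus> 0\<close> times any matrix \<open>N\<close> with first block row \<open>T\<close>, \<open>0\<close>. A nonzero block
  below \<open>T\<close> makes \<open>N\<close> kill a vector that \<open>N\<^sup>*\<close> does not kill, so \<open>N\<close> has three factors.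
\<close>
lemma pad_zero_psd_product_4:
  assumes T: "T \<in> carrier_mat k k" and k: "0 < k" and p: "0 < p"
  shows "psd_product (k + p) 4 (pad_zero k p T)"
proof -
  define X where "X = Matrix.mat p k (\<lambda>_. 1 :: complex)"
  have X: "X \<in> carrier_mat p k" by (simp add: X_def)
  define N where "N = four_block_mat T (0\<^sub>m k p) X (0\<^sub>m p p)"
  have N: "N \<in> carrier_mat (k + p) (k + p)" unfolding N_def by (rule four_block_carrier_mat[OF T]) simp
  define z where "z = 0\<^sub>v k @\<^sub>v (unit_vec p 0 :: complex vec)"
  have z: "z \<in> carrier_vec (k + p)" by (simp add: z_def)
  have "N *\<^sub>v z = (T *\<^sub>v 0\<^sub>v k + 0\<^sub>m k p *\<^sub>v unit_vec p 0) @\<^sub>v (X *\<^sub>v 0\<^sub>v k + 0\<^sub>m p p *\<^sub>v unit_vec p 0)"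
    unfolding N_def z_def using T X by (intro four_block_mat_mult_vec) auto
  also have "\<dots> = 0\<^sub>v (k + p)" using zero_mult_vec[OF T] zero_mult_vec[OF X] by (simp add: zero_mat_mult_vec append_zero)
  finally have Nz: "N *\<^sub>v z = 0\<^sub>v (k + p)" .
  have Na: "mat_adjoint N = four_block_mat (mat_adjoint T) (mat_adjoint X) (0\<^sub>m p k) (0\<^sub>m p p)"
    unfolding N_def using adjoint_four_block[of T k k "0\<^sub>m k p" p X p "0\<^sub>m p p"] T X by simp
  have "mat_adjoint N *\<^sub>v z = (mat_adjoint T *\<^sub>v 0\<^sub>v k + mat_adjoint X *\<^sub>v unit_vec p 0) @\<^sub>v
      (0\<^sub>m p k *\<^sub>v 0\<^sub>v k + 0\<^sub>m p p *\<^sub>v unit_vec p 0)"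
    unfolding Na z_def using adjoint_carrier[OF T] adjoint_carrier[OF X] by (intro four_block_mat_mult_vec) auto
  moreover have "mat_adjoint T *\<^sub>v 0\<^sub>v k + mat_adjoint X *\<^sub>v unit_vec p 0 = Matrix.vec k (\<lambda>_. 1)"
    using p zero_mult_vec[OF adjoint_carrier[OF T]] mult_unit_vec[OF adjoint_carrier[OF X] p] X
    by (intro eq_vecI) (auto simp: X_def)
  ultimately have "(mat_adjoint N *\<^sub>v z) $ 0 = 1" using k by (simp add: append_vec_def)
  then have "mat_adjoint N *\<^sub>v z \<noteq> 0\<^sub>v (k + p)" using k by auto
  then have "psd_product (k + p) 3 N"
    using congruent_nonneg_of_kernel[OF N z Nz] congruent_nonneg_psd_product_3 by blast
  then have "psd_product (k + p) (1 + 3) (pad_zero k p (1\<^sub>m k) * N)"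
    using psd_pad_zero[OF psd_one] psd_product_1 psd_product_mult by blast
  moreover have "pad_zero k p (1\<^sub>m k) * N = pad_zero k p T"
    unfolding N_def
    using mult_four_block_mat[of "1\<^sub>m k" k k "0\<^sub>m k p" p "0\<^sub>m p k" p "0\<^sub>m p p" T k "0\<^sub>m k p" p X "0\<^sub>m p p"] T X by simp
  ultimately show ?thesis by simp
qed

lemma mat_eq_zeroI:
  fixes A :: "complex mat"
  assumes A: "A \<in> carrier_mat n m" and 0: "\<And>v. v \<in> carrier_vec m \<Longrightarrow> A *\<^sub>v v = 0\<^sub>v n"
  shows "A = 0\<^sub>m n m"
proof (rule mat_col_eqI)
  fix i assume "i < dim_col (0\<^sub>m n m :: complex mat)"
  then have i: "i < m" by simp
  then show "col A i = col (0\<^sub>m n m) i"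
    using mult_unit_vec[OF A i] 0[of "unit_vec m i"] by (auto intro!: eq_vecI)
qed (use A in auto)

text \<open>
  If every kernel vector of \<open>T\<close> were annihilated by the adjoint, then \<open>ker T\<^sub>2\<close> would lie in the
  kernels of \<open>R\<close> and of \<open>T\<^sub>2\<^sup>*\<close>; so \<open>ker T\<^sub>2\<close> would be orthogonal to the range of \<open>T\<^sub>2\<close>, which for
  a nilpotent matrix means that it is zero.
\<close>
lemma kernel_not_adjoint_kernel:
  fixes T1 R T2 :: "complex mat"
  assumes T1: "T1 \<in> carrier_mat k k" and R: "R \<in> carrier_mat k p" and T2: "T2 \<in> carrier_mat p p"
    and det: "Determinant.det T1 \<noteq> 0" and nil: "T2 ^\<^sub>m m = 0\<^sub>m p p"
    and ne: "R \<noteq> 0\<^sub>m k p \<or> T2 \<noteq> 0\<^sub>m p p"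
  shows "\<exists>z\<in>carrier_vec (k + p). four_block_mat T1 R (0\<^sub>m p k) T2 *\<^sub>v z = 0\<^sub>v (k + p) \<and>
    mat_adjoint (four_block_mat T1 R (0\<^sub>m p k) T2) *\<^sub>v z \<noteq> 0\<^sub>v (k + p)"
proof (rule ccontr)
  let ?T = "four_block_mat T1 R (0\<^sub>m p k) T2"
  assume "\<not> ?thesis"
  then have all: "mat_adjoint ?T *\<^sub>v z = 0\<^sub>v (k + p)" if "z \<in> carrier_vec (k + p)" "?T *\<^sub>v z = 0\<^sub>v (k + p)" for z
    using that by blast
  note Ta = adjoint_carrier[OF T1] adjoint_carrier[OF R] adjoint_carrier[OF T2]
  obtain W where W: "W \<in> carrier_mat k k" "T1 * W = 1\<^sub>m k" using det_inverse[OF T1 det] by blast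
  have ker: "R *\<^sub>v v = 0\<^sub>v k \<and> mat_adjoint T2 *\<^sub>v v = 0\<^sub>v p" if v: "v \<in> carrier_vec p" and T2v: "T2 *\<^sub>v v = 0\<^sub>v p" for v
  proof -
    have Rv: "R *\<^sub>v v \<in> carrier_vec k" by (rule mult_mat_vec_carrier[OF R v])
    define u where "u = W *\<^sub>v ((- 1) \<cdot>\<^sub>v (R *\<^sub>v v))"
    have u: "u \<in> carrier_vec k" unfolding u_def using Rv by (intro mult_mat_vec_carrier[OF W(1)]) simp
    have "T1 *\<^sub>v u = (T1 * W) *\<^sub>v ((- 1) \<cdot>\<^sub>v (R *\<^sub>v v))"
      unfolding u_def using assoc_mult_mat_vec[OF T1 W(1), of "(- 1) \<cdot>\<^sub>v (R *\<^sub>v v)"] Rv by simp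
    also have "\<dots> = (- 1) \<cdot>\<^sub>v (R *\<^sub>v v)" unfolding W(2) using Rv by (intro one_mult_mat_vec) simp
    finally have T1u: "T1 *\<^sub>v u = (- 1) \<cdot>\<^sub>v (R *\<^sub>v v)" .
    have "?T *\<^sub>v (u @\<^sub>v v) = (T1 *\<^sub>v u + R *\<^sub>v v) @\<^sub>v (0\<^sub>m p k *\<^sub>v u + T2 *\<^sub>v v)"
      using T1 R T2 u v by (intro four_block_mat_mult_vec) auto
    also have "T1 *\<^sub>v u + R *\<^sub>v v = 0\<^sub>v k" unfolding T1u using Rv R by (intro eq_vecI) auto
    also have "0\<^sub>m p k *\<^sub>v u + T2 *\<^sub>v v = 0\<^sub>v p" unfolding T2v zero_mat_mult_vec[OF u] by simp
    finally have "?T *\<^sub>v (u @\<^sub>v v) = 0\<^sub>v (k + p)" by (simp add: append_zero)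
    then have "mat_adjoint ?T *\<^sub>v (u @\<^sub>v v) = 0\<^sub>v (k + p)" using u v by (intro all) simp
    moreover have "mat_adjoint ?T = four_block_mat (mat_adjoint T1) (0\<^sub>m k p) (mat_adjoint R) (mat_adjoint T2)"
      using adjoint_four_block[of T1 k k R p "0\<^sub>m p k" p T2] T1 R T2 by simp
    moreover have "four_block_mat (mat_adjoint T1) (0\<^sub>m k p) (mat_adjoint R) (mat_adjoint T2) *\<^sub>v (u @\<^sub>v v) =
        (mat_adjoint T1 *\<^sub>v u + 0\<^sub>m k p *\<^sub>v v) @\<^sub>v (mat_adjoint R *\<^sub>v u + mat_adjoint T2 *\<^sub>v v)"
      using Ta u v by (intro four_block_mat_mult_vec) auto
    ultimately have "(mat_adjoint T1 *\<^sub>v u + 0\<^sub>m k p *\<^sub>v v) @\<^sub>v (mat_adjoint R *\<^sub>v u + mat_adjoint T2 *\<^sub>v v) = 0\<^sub>v (k + p)"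
      by simp
    from append_eq_zero[OF _ _ this]
    have z: "mat_adjoint T1 *\<^sub>v u + 0\<^sub>m k p *\<^sub>v v = 0\<^sub>v k" "mat_adjoint R *\<^sub>v u + mat_adjoint T2 *\<^sub>v v = 0\<^sub>v p"
      using mult_mat_vec_carrier[OF Ta(1) u] mult_mat_vec_carrier[OF Ta(2) u] mult_mat_vec_carrier[OF Ta(3) v]
      by (auto simp: zero_mat_mult_vec[OF v])
    have "mat_adjoint T1 *\<^sub>v u = 0\<^sub>v k"
      using z(1) mult_mat_vec_carrier[OF Ta(1) u] by (simp add: zero_mat_mult_vec[OF v])
    moreover have "Determinant.det (mat_adjoint T1) \<noteq> 0" using det det_adjoint[OF T1] by simp
    ultimately have u0: "u = 0\<^sub>v k" using det_0_iff_vec_prod_zero[OF Ta(1)] u by blast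
    have "mat_adjoint T2 *\<^sub>v v = 0\<^sub>v p"
      using z(2) mult_mat_vec_carrier[OF Ta(3) v] unfolding u0 zero_mult_vec[OF Ta(2)] by simp
    moreover have "R *\<^sub>v v = 0\<^sub>v k"
      using T1u Rv smult_vec_eq_0D[of "- 1" "R *\<^sub>v v" k] unfolding u0 zero_mult_vec[OF T1] by simp
    ultimately show ?thesis by blast
  qed
  have sq: "T2 *\<^sub>v v = 0\<^sub>v p" if v: "v \<in> carrier_vec p" and T2v: "T2 *\<^sub>v (T2 *\<^sub>v v) = 0\<^sub>v p" for v
  proof -
    have w: "T2 *\<^sub>v v \<in> carrier_vec p" by (rule mult_mat_vec_carrier[OF T2 v])
    have "(T2 *\<^sub>v v) \<bullet>c (T2 *\<^sub>v v) = v \<bullet>c (mat_adjoint T2 *\<^sub>v (T2 *\<^sub>v v))" by (rule adjoint_inner[OF T2 v w])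
    also have "\<dots> = 0" using ker[OF w T2v] v by simp
    finally show ?thesis using conjugate_square_eq_0_vec[OF w] by simp
  qed
  have pow: "T2 *\<^sub>v v = 0\<^sub>v p" if "v \<in> carrier_vec p" "T2 ^\<^sub>m j *\<^sub>v v = 0\<^sub>v p" for j v
    using that
  proof (induction j arbitrary: v)
    case 0
    then show ?case using T2 zero_mult_vec[OF T2] by simp
  next
    case (Suc j)
    have "T2 ^\<^sub>m j *\<^sub>v (T2 *\<^sub>v v) = 0\<^sub>v p"
      using Suc.prems assoc_mult_mat_vec[OF pow_carrier_mat[OF T2] T2 Suc.prems(1), of j] by simp
    then have "T2 *\<^sub>v (T2 *\<^sub>v v) = 0\<^sub>v p"
      using Suc.IH[of "T2 *\<^sub>v v"] mult_mat_vec_carrier[OF T2 Suc.prems(1)] by simp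
    then show ?case by (rule sq[OF Suc.prems(1)])
  qed
  have T2v: "T2 *\<^sub>v v = 0\<^sub>v p" if "v \<in> carrier_vec p" for v
    using pow[OF that, of m] zero_mat_mult_vec[OF that] unfolding nil by simp
  have "T2 = 0\<^sub>m p p" using T2v by (rule mat_eq_zeroI[OF T2])
  moreover have "R = 0\<^sub>m k p" using ker T2v by (intro mat_eq_zeroI[OF R]) blast
  ultimately show False using ne by blast
qed

section \<open>Lower bounds for the number of factors\<close>

lemma psd_product_4E:
  assumes "psd_product n 4 A"
  obtains M N where "psd_product n 2 M" "psd_product n 2 N" "A = M * N"
proof -
  obtain Ps where *: "length Ps = 4" "\<forall>P\<in>set Ps. psd n P" "A = foldr (*) Ps (1\<^sub>m n)"
    using assms unfolding psd_product_def by blast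
  then obtain B C D E where Ps: "Ps = [B, C, D, E]" by (auto simp: numeral_eq_Suc length_Suc_conv)
  have c: "B \<in> carrier_mat n n" "C \<in> carrier_mat n n" "D \<in> carrier_mat n n" "E \<in> carrier_mat n n"
    using *(2) psd_carrier unfolding Ps by auto
  have "A = (B * C) * (D * E)"
    using *(3) c mult_carrier_sq[OF c(3,4)] unfolding Ps by (simp add: assoc_mult_mat[of _ n n _ n _ n])
  then show thesis using that[of "B * C" "D * E"] psd_product_2 *(2) unfolding Ps by simp
qed

text \<open>
  If \<open>M N = \<alpha> I\<close>, an eigenvector of \<open>N\<close> for \<open>\<nu>\<close> is an eigenvector of \<open>M\<close> for \<open>\<alpha> / \<nu>\<close>, and both
  are nonnegative.
\<close>
lemma scalar_psd_product_4:
  assumes n: "0 < n" and "psd_product n j (\<alpha> \<cdot>\<^sub>m 1\<^sub>m n)" "j \<le> 4"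
  shows "0 \<le> \<alpha>"
proof (cases "\<alpha> = 0")
  case False
  obtain M N where M: "psd_product n 2 M" and N: "psd_product n 2 N" and MN: "\<alpha> \<cdot>\<^sub>m 1\<^sub>m n = M * N"
    using psd_product_4E[OF psd_product_mono[OF assms(2,3)]] by blast
  note c = psd_product_carrier[OF M] psd_product_carrier[OF N]
  have ss: "nonneg_semisimple n M" "nonneg_semisimple n N"
    using M N psd_product_2_iff[OF c(1)] psd_product_2_iff[OF c(2)] cond_P3_iff_nonneg_semisimple c by blast+
  have "Determinant.det (\<alpha> \<cdot>\<^sub>m 1\<^sub>m n) = \<alpha> ^ n" by simp
  then have dN: "Determinant.det N \<noteq> 0" using det_mult[OF c] False unfolding MN by auto
  obtain es where es: "char_poly N = (\<Prod>e\<leftarrow>es. [:- e, 1:])" "length es = n" using char_poly_factorized[OF c(2)] by blast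
  define \<nu> where "\<nu> = hd es"
  have \<nu>: "\<nu> \<in> set es" using es(2) n unfolding \<nu>_def by (intro hd_in_set) auto
  obtain v where v: "v \<in> carrier_vec n" "v \<noteq> 0\<^sub>v n" and Nv: "N *\<^sub>v v = \<nu> \<cdot>\<^sub>v v" using root_eigenvector[OF c(2) es(1) \<nu>] by blast
  have \<nu>0: "0 \<le> \<nu>" "\<nu> \<noteq> 0" using nonneg_semisimpleD2[OF ss(2) Nv v(2,1)] root_nonzero[OF c(2) es(1) \<nu> dN] by auto
  have Mv: "M *\<^sub>v v \<in> carrier_vec n" by (rule mult_mat_vec_carrier[OF c(1) v(1)])
  have "\<alpha> \<cdot>\<^sub>v v = (\<alpha> \<cdot>\<^sub>m 1\<^sub>m n) *\<^sub>v v" using v(1) by (intro eq_vecI) auto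
  also have "\<dots> = M *\<^sub>v (N *\<^sub>v v)" unfolding MN by (rule assoc_mult_mat_vec[OF c v(1)])
  also have "\<dots> = \<nu> \<cdot>\<^sub>v (M *\<^sub>v v)" unfolding Nv by (rule mult_mat_vec[OF c(1) v(1)])
  finally have eq: "\<alpha> \<cdot>\<^sub>v v = \<nu> \<cdot>\<^sub>v (M *\<^sub>v v)" .
  have "M *\<^sub>v v = (1 / \<nu>) \<cdot>\<^sub>v (\<nu> \<cdot>\<^sub>v (M *\<^sub>v v))" using \<nu>0 by (simp add: smult_smult_assoc)
  also have "\<dots> = (\<alpha> / \<nu>) \<cdot>\<^sub>v v" unfolding eq[symmetric] by (simp add: smult_smult_assoc)
  finally have "0 \<le> \<alpha> / \<nu>" using nonneg_semisimpleD2[OF ss(1) _ v(2,1)] by blast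
  then show ?thesis using mult_nonneg_nonneg[of "\<alpha> / \<nu>" \<nu>] \<nu>0 by simp
qed simp

text \<open>
  The transpose of the corner is the restriction of the transpose to an invariant subspace.
\<close>
lemma cond_P3_lower_block:
  fixes M :: "complex mat"
  assumes P3: "cond_P3 (four_block_mat M (0\<^sub>m k p) Y Z)" and M: "M \<in> carrier_mat k k"
    and Y: "Y \<in> carrier_mat p k" and Z: "Z \<in> carrier_mat p p"
  shows "cond_P3 M"
proof -
  let ?K = "four_block_mat M (0\<^sub>m k p) Y Z" and ?L = "transpose_mat M"
  let ?KT = "four_block_mat ?L (transpose_mat Y) (0\<^sub>m p k) (transpose_mat Z)"
  have K: "?K \<in> carrier_mat (k + p) (k + p)" by (rule four_block_carrier_mat[OF M Z])
  have KT: "transpose_mat ?K = ?KT" using M Y Z by (intro eq_matI) auto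
  have KTc: "?KT \<in> carrier_mat (k + p) (k + p)" unfolding KT[symmetric] using K by (rule transpose_carrier_mat[THEN iffD2])
  have "cond_P3 ?KT" using cond_P3_transpose[of ?KT "k + p"] P3 KTc unfolding KT[symmetric] by simp
  then have ss: "nonneg_semisimple (k + p) ?KT" using cond_P3_iff_nonneg_semisimple[OF KTc] by simp
  have L: "?L \<in> carrier_mat k k" using M by simp
  have mv: "?KT *\<^sub>v (v @\<^sub>v 0\<^sub>v p) = (?L *\<^sub>v v) @\<^sub>v 0\<^sub>v p" if v: "v \<in> carrier_vec k" for v
  proof -
    have "?KT *\<^sub>v (v @\<^sub>v 0\<^sub>v p) = (?L *\<^sub>v v + transpose_mat Y *\<^sub>v 0\<^sub>v p) @\<^sub>v (0\<^sub>m p k *\<^sub>v v + transpose_mat Z *\<^sub>v 0\<^sub>v p)"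
      using M Y Z v by (intro four_block_mat_mult_vec) auto
    moreover have "transpose_mat Y *\<^sub>v 0\<^sub>v p = 0\<^sub>v k" "transpose_mat Z *\<^sub>v 0\<^sub>v p = 0\<^sub>v p"
      using Y Z by (auto intro!: zero_mult_vec)
    ultimately show ?thesis using mult_mat_vec_carrier[OF L v] by (simp add: zero_mat_mult_vec[OF v])
  qed
  have "nonneg_semisimple k ?L"
  proof (rule nonneg_semisimple_intertwine[OF ss L, of "\<lambda>v. v @\<^sub>v 0\<^sub>v p"])
    show "v = 0\<^sub>v k" if "v \<in> carrier_vec k" "v @\<^sub>v 0\<^sub>v p = 0\<^sub>v (k + p)" for v :: "complex vec"
      by (rule append_eq_zero(1)[OF that(1) zero_carrier_vec that(2)])
    show "(c \<cdot>\<^sub>v v) @\<^sub>v 0\<^sub>v p = c \<cdot>\<^sub>v (v @\<^sub>v 0\<^sub>v p)" for c and v :: "complex vec"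
      by (intro eq_vecI) (auto simp: append_vec_def Let_def)
    show "(v + w) @\<^sub>v 0\<^sub>v p = (v @\<^sub>v 0\<^sub>v p) + (w @\<^sub>v 0\<^sub>v p)" if "v \<in> carrier_vec k" "w \<in> carrier_vec k" for v w :: "complex vec"
      using append_vec_add[OF that zero_carrier_vec zero_carrier_vec, of p] by simp
  qed (use mv in auto)
  then show ?thesis using cond_P3_transpose[OF _ M] cond_P3_iff_nonneg_semisimple[OF L] by blast
qed

text \<open>
  Let \<open>T \<oplus> 0 = P M\<close> with \<open>M\<close> a product of two factors. A vector in the kernel of \<open>P\<close> is in the
  kernel of \<open>T\<^sup>* \<oplus> 0\<close>, so its first part vanishes; this makes \<open>M\<close> block lower triangular and its
  corner \<open>L\<close> invertible. The form of \<open>T L\<^sup>-\<^sup>1\<close> is the form of \<open>P\<close> pulled back to the graph over the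
  first coordinates, so \<open>T L\<^sup>-\<^sup>1\<close> is positive definite.
\<close>
theorem pad_zero_psd_product_3:
  assumes T: "T \<in> carrier_mat k k" and det: "Determinant.det T \<noteq> 0"
    and "psd_product (k + p) 3 (pad_zero k p T)"
  shows "pd_product k 3 T"
proof -
  let ?n = "k + p" and ?A = "pad_zero k p T"
  obtain P P2 P3 where P: "psd ?n P" and P23: "psd ?n P2" "psd ?n P3" and A: "?A = P * (P2 * P3)"
    using psd_product_3E[OF assms(3)] by blast
  define M where "M = P2 * P3"
  have M: "M \<in> carrier_mat ?n ?n" unfolding M_def using P23 psd_carrier by (intro mult_carrier_sq) auto
  have Pc: "P \<in> carrier_mat ?n ?n" and Pa: "mat_adjoint P = P" using P by (auto simp: psd_def)
  have AM: "?A = P * M" using A unfolding M_def .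
  have P3M: "cond_P3 M" using psd_product_2[OF P23] psd_product_2_iff[OF M] unfolding M_def by simp
  define L where "L = Matrix.mat k k (\<lambda>(i, j). M $$ (i, j))"
  define X where "X = Matrix.mat k p (\<lambda>(i, j). M $$ (i, j + k))"
  define Y where "Y = Matrix.mat p k (\<lambda>(i, j). M $$ (i + k, j))"
  define Z where "Z = Matrix.mat p p (\<lambda>(i, j). M $$ (i + k, j + k))"
  have c: "L \<in> carrier_mat k k" "X \<in> carrier_mat k p" "Y \<in> carrier_mat p k" "Z \<in> carrier_mat p p"
    by (auto simp: L_def X_def Y_def Z_def)
  have MB: "M = four_block_mat L X Y Z"
    using M by (intro eq_matI) (auto simp: L_def X_def Y_def Z_def)
  have PMv: "P *\<^sub>v (M *\<^sub>v v) = ?A *\<^sub>v v" if "v \<in> carrier_vec ?n" for v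
    unfolding AM using assoc_mult_mat_vec[OF Pc M that] by simp
  have Ta: "mat_adjoint T \<in> carrier_mat k k" "Determinant.det (mat_adjoint T) \<noteq> 0"
    using adjoint_carrier[OF T] det det_adjoint[OF T] by auto
  have kerP: "u = 0\<^sub>v k" if u: "u \<in> carrier_vec k" and v: "v \<in> carrier_vec p" and Pu: "P *\<^sub>v (u @\<^sub>v v) = 0\<^sub>v ?n" for u v
  proof -
    have uv: "u @\<^sub>v v \<in> carrier_vec ?n" using u v by simp
    have "mat_adjoint ?A = mat_adjoint M * P" unfolding AM adjoint_mult[OF Pc M] Pa ..
    then have "mat_adjoint ?A *\<^sub>v (u @\<^sub>v v) = mat_adjoint M *\<^sub>v (P *\<^sub>v (u @\<^sub>v v))"
      using assoc_mult_mat_vec[OF adjoint_carrier[OF M] Pc uv] by simp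
    also have "\<dots> = 0\<^sub>v ?n" unfolding Pu by (rule zero_mult_vec[OF adjoint_carrier[OF M]])
    also have "mat_adjoint ?A = pad_zero k p (mat_adjoint T)"
      using adjoint_four_block[of T k k "0\<^sub>m k p" p "0\<^sub>m p k" p "0\<^sub>m p p"] T by simp
    finally have "(mat_adjoint T *\<^sub>v u) @\<^sub>v 0\<^sub>v p = 0\<^sub>v ?n" unfolding pad_zero_mult_vec[OF Ta(1) u v] .
    then have "mat_adjoint T *\<^sub>v u = 0\<^sub>v k"
      using append_eq_zero(1)[OF mult_mat_vec_carrier[OF Ta(1) u] zero_carrier_vec] by blast
    then show ?thesis using det_0_iff_vec_prod_zero[OF Ta(1)] Ta(2) u by blast
  qed
  have Mv: "M *\<^sub>v (u @\<^sub>v v) = (L *\<^sub>v u + X *\<^sub>v v) @\<^sub>v (Y *\<^sub>v u + Z *\<^sub>v v)" if "u \<in> carrier_vec k" "v \<in> carrier_vec p" for u v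
    unfolding MB using c that by (intro four_block_mat_mult_vec) auto
  have X0: "X = 0\<^sub>m k p"
  proof (rule mat_eq_zeroI[OF c(2)])
    fix v :: "complex vec" assume v: "v \<in> carrier_vec p"
    have "P *\<^sub>v (M *\<^sub>v (0\<^sub>v k @\<^sub>v v)) = 0\<^sub>v ?n"
      using PMv[of "0\<^sub>v k @\<^sub>v v"] pad_zero_mult_vec[OF T zero_carrier_vec v] v zero_mult_vec[OF T] by (simp add: append_zero)
    moreover have "M *\<^sub>v (0\<^sub>v k @\<^sub>v v) = (X *\<^sub>v v) @\<^sub>v (Z *\<^sub>v v)"
      using Mv[OF zero_carrier_vec v] zero_mult_vec[OF c(1)] zero_mult_vec[OF c(3)]
        mult_mat_vec_carrier[OF c(2) v] mult_mat_vec_carrier[OF c(4) v] by simp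
    ultimately show "X *\<^sub>v v = 0\<^sub>v k"
      using kerP[OF mult_mat_vec_carrier[OF c(2) v] mult_mat_vec_carrier[OF c(4) v]] by simp
  qed
  have P3L: "cond_P3 L" using cond_P3_lower_block[OF _ c(1,3,4)] P3M unfolding MB X0 by blast
  have Mu: "M *\<^sub>v (u @\<^sub>v 0\<^sub>v p) = (L *\<^sub>v u) @\<^sub>v (Y *\<^sub>v u)" if u: "u \<in> carrier_vec k" for u
    using Mv[OF u zero_carrier_vec] zero_mult_vec[OF c(2)] zero_mult_vec[OF c(4)]
      mult_mat_vec_carrier[OF c(1) u] mult_mat_vec_carrier[OF c(3) u] by simp
  have PMu: "P *\<^sub>v (M *\<^sub>v (u @\<^sub>v 0\<^sub>v p)) = (T *\<^sub>v u) @\<^sub>v 0\<^sub>v p" if u: "u \<in> carrier_vec k" for u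
    using PMv[of "u @\<^sub>v 0\<^sub>v p"] pad_zero_mult_vec[OF T u zero_carrier_vec] u by simp
  have Tu: "T *\<^sub>v u \<in> carrier_vec k" and Lu: "L *\<^sub>v u \<in> carrier_vec k" and Yu: "Y *\<^sub>v u \<in> carrier_vec p"
    if "u \<in> carrier_vec k" for u
    using T c that by auto
  have form: "sesq P (M *\<^sub>v (u @\<^sub>v 0\<^sub>v p)) (M *\<^sub>v (w @\<^sub>v 0\<^sub>v p)) = (T *\<^sub>v w) \<bullet>c (L *\<^sub>v u)"
    if u: "u \<in> carrier_vec k" and w: "w \<in> carrier_vec k" for u w
    unfolding sesq_def PMu[OF w] unfolding Mu[OF u]
    using cinner_append[OF Tu[OF w] zero_carrier_vec Lu[OF u] Yu[OF u]] Yu[OF u] by simp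
  have dL: "Determinant.det L \<noteq> 0"
  proof
    assume "Determinant.det L = 0"
    then obtain v where v: "v \<in> carrier_vec k" "v \<noteq> 0\<^sub>v k" "L *\<^sub>v v = 0\<^sub>v k"
      using det_0_iff_vec_prod_zero[OF c(1)] by blast
    have y: "M *\<^sub>v (v @\<^sub>v 0\<^sub>v p) \<in> carrier_vec ?n" using v(1) by (intro mult_mat_vec_carrier[OF M]) simp
    have "sesq P (M *\<^sub>v (v @\<^sub>v 0\<^sub>v p)) (M *\<^sub>v (v @\<^sub>v 0\<^sub>v p)) = 0"
      unfolding form[OF v(1) v(1)] v(3) using Tu[OF v(1)] by simp
    then have "P *\<^sub>v (M *\<^sub>v (v @\<^sub>v 0\<^sub>v p)) = 0\<^sub>v ?n" by (rule psd_zero_form_imp_kernel[OF P y])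
    then have "T *\<^sub>v v = 0\<^sub>v k" unfolding PMu[OF v(1)] using append_eq_zero(1)[OF Tu[OF v(1)] zero_carrier_vec] by blast
    then show False using det_0_iff_vec_prod_zero[OF T] det v by blast
  qed
  obtain W where W: "W \<in> carrier_mat k k" "L * W = 1\<^sub>m k" "W * L = 1\<^sub>m k" using det_inverse[OF c(1) dL] by blast
  define a where "a = T * W"
  have a: "a \<in> carrier_mat k k" unfolding a_def by (rule mult_carrier_sq[OF T W(1)])
  define g where "g y = M *\<^sub>v ((W *\<^sub>v y) @\<^sub>v 0\<^sub>v p)" for y
  have Wy: "W *\<^sub>v y \<in> carrier_vec k" if "y \<in> carrier_vec k" for y by (rule mult_mat_vec_carrier[OF W(1) that])
  have g: "g y \<in> carrier_vec ?n" if "y \<in> carrier_vec k" for y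
    unfolding g_def using Wy[OF that] by (intro mult_mat_vec_carrier[OF M]) simp
  have sa: "sesq a x y = sesq P (g x) (g y)" if x: "x \<in> carrier_vec k" and y: "y \<in> carrier_vec k" for x y
  proof -
    have "L *\<^sub>v (W *\<^sub>v x) = x" using assoc_mult_mat_vec[OF c(1) W(1) x] x unfolding W(2) by simp
    moreover have "T *\<^sub>v (W *\<^sub>v y) = a *\<^sub>v y" unfolding a_def using assoc_mult_mat_vec[OF T W(1) y] by simp
    ultimately show ?thesis unfolding g_def form[OF Wy[OF x] Wy[OF y]] by (simp add: sesq_def)
  qed
  have "psd k a" unfolding psd_sesq
  proof (intro conjI ballI a)
    show "mat_adjoint a = a"
    proof (rule sesq_cong[OF adjoint_carrier[OF a] a])
      fix x y :: "complex vec" assume x: "x \<in> carrier_vec k" and y: "y \<in> carrier_vec k"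
      have "sesq (mat_adjoint a) x y = cnj (sesq P (g y) (g x))" using sesq_adjoint[OF a x y] sa[OF y x] by simp
      also have "\<dots> = sesq (mat_adjoint P) (g x) (g y)" using sesq_adjoint[OF Pc g[OF x] g[OF y]] by simp
      finally show "sesq (mat_adjoint a) x y = sesq a x y" unfolding Pa sa[OF x y] .
    qed
    fix x :: "complex vec" assume x: "x \<in> carrier_vec k"
    show "0 \<le> sesq a x x" unfolding sa[OF x x] using P g[OF x] by (simp add: psd_sesq)
  qed
  moreover have "Determinant.det a \<noteq> 0"
    unfolding a_def det_mult[OF T W(1)] using det inverse_det[OF c(1) W(1,2)] by auto
  ultimately have "pd k a" using pd_iff_psd_det by blast
  moreover obtain B C where B: "psd k B" and C: "pd k C" and BC: "L = B * C" using cond_P3_factorization[OF P3L c(1)] by blast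
  moreover have "Determinant.det B \<noteq> 0" using dL det_mult[OF psd_carrier[OF B] pd_carrier[OF C]] unfolding BC by auto
  then have "pd k B" using B pd_iff_psd_det by blast
  moreover have "T = a * (B * C)"
    unfolding BC[symmetric] a_def using assoc_mult_mat[OF T W(1) c(1)] W(3) T by simp
  ultimately show ?thesis unfolding pd_product_3 by blast
qed

section \<open>The number of factors\<close>

lemma psd_product_not_fewerI:
  assumes "psd_product n (Suc k) A" "\<not> psd_product n k A"
  shows "psd_product_not_fewer n (Suc k) A"
  unfolding psd_product_not_fewer_def using assms psd_product_mono[of n _ A k] by (auto simp: less_Suc_eq_le)

lemma psd_scalar:
  assumes "0 \<le> \<alpha>"
  shows "psd n (\<alpha> \<cdot>\<^sub>m 1\<^sub>m n)"
  using assms by (intro nonneg_diagonal_psd) (auto simp: nonneg_diagonal_def diagonal_mat_def)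

text \<open>
  A Hermitian triangular matrix is diagonal.
\<close>
lemma psd_upper_triangular:
  assumes P: "psd n T" and ut: "upper_triangular T"
  shows "nonneg_diagonal T"
proof -
  have T: "T \<in> carrier_mat n n" and herm: "mat_adjoint T = T" using P by (auto simp: psd_def)
  have "T $$ (i, j) = 0" if "i < n" "j < n" "i \<noteq> j" for i j
  proof (cases "j < i")
    case True
    then show ?thesis using ut T that by auto
  next
    case False
    then have "T $$ (j, i) = 0" using ut T that by auto
    moreover have "mat_adjoint T $$ (i, j) = cnj (T $$ (j, i))" using T that by simp
    ultimately show ?thesis unfolding herm by simp
  qed
  moreover have "0 \<le> T $$ (i, i)" if "i < n" for i
    using P sesq_unit[OF T that that] unfolding psd_sesq by (metis unit_vec_carrier)
  ultimately show ?thesis using T by (auto simp: nonneg_diagonal_def diagonal_mat_def)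
qed

text \<open>
  One factor \<open>diag(2, 1, \<dots>, 1)\<close> turns the scalar matrix into a nonscalar one, which has four factors.
\<close>
lemma scalar_psd_product_5:
  fixes \<alpha> :: complex
  assumes n: "0 < n" and \<alpha>: "\<not> 0 \<le> \<alpha>" and det: "0 \<le> Determinant.det (\<alpha> \<cdot>\<^sub>m 1\<^sub>m n)"
  shows "psd_product n 5 (\<alpha> \<cdot>\<^sub>m 1\<^sub>m n)"
proof -
  have det: "0 \<le> \<alpha> ^ n" using det by simp
  have \<alpha>0: "\<alpha> \<noteq> 0" using \<alpha> by auto
  have "n \<noteq> 1"
  proof
    assume "n = 1"
    then show False using det \<alpha> by simp
  qed
  then have n1: "1 < n" using n by simp
  have pos: "0 < \<alpha> ^ n" using det \<alpha>0 by (metis order_less_le power_not_zero)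
  define D :: "complex \<Rightarrow> complex mat" where
    "D c = Matrix.mat n n (\<lambda>(i, j). if i = j then (if i = 0 then c else 1) else 0)" for c
  have D: "D c \<in> carrier_mat n n" and diag: "diagonal_mat (D c)" for c by (auto simp: D_def diagonal_mat_def)
  have psdD: "psd n (D 2)"
    using diag[of 2] by (intro nonneg_diagonal_psd[OF D]) (auto simp: nonneg_diagonal_def D_def less_eq_complex_def)
  define N where "N = \<alpha> \<cdot>\<^sub>m D (1 / 2)"
  have N: "N \<in> carrier_mat n n" using D by (simp add: N_def)
  have DN: "D 2 * N = \<alpha> \<cdot>\<^sub>m 1\<^sub>m n"
  proof (rule eq_matI)
    fix i j assume "i < dim_row (\<alpha> \<cdot>\<^sub>m 1\<^sub>m n)" "j < dim_col (\<alpha> \<cdot>\<^sub>m 1\<^sub>m n)"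
    then have ij: "i < n" "j < n" by auto
    have "diagonal_mat N" using diag D by (auto simp: N_def diagonal_mat_def)
    then have e: "(D 2 * N) $$ (i, j) = D 2 $$ (i, j) * N $$ (j, j)" by (intro mult_diagonal_index[OF D N _ ij])
    show "(D 2 * N) $$ (i, j) = (\<alpha> \<cdot>\<^sub>m 1\<^sub>m n) $$ (i, j)"
      unfolding e using ij by (auto simp: D_def N_def)
  qed (use D N in auto)
  have dets: "Determinant.det (D 2) * Determinant.det N = \<alpha> ^ n"
    using det_mult[OF D N, of 2] unfolding DN by simp
  then have "Determinant.det (D 2) \<noteq> 0" using \<alpha>0 by auto
  then have d2: "0 < Determinant.det (D 2)" using psdD pd_iff_psd_det pd_det_pos by blast
  then have "Determinant.det N = \<alpha> ^ n / Determinant.det (D 2)" using dets by (auto simp: field_simps)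
  then have dN: "0 < Determinant.det N" using divide_pos_pos_complex[OF pos d2] by simp
  have "\<not> (\<exists>c. N = c \<cdot>\<^sub>m 1\<^sub>m n)"
  proof
    assume "\<exists>c. N = c \<cdot>\<^sub>m 1\<^sub>m n"
    then obtain c where c: "N = c \<cdot>\<^sub>m 1\<^sub>m n" by blast
    have "N $$ (0, 0) = c" "N $$ (1, 1) = c" unfolding c using n1 by auto
    moreover have "N $$ (0, 0) = \<alpha> / 2" "N $$ (1, 1) = \<alpha>" using n1 by (auto simp: N_def D_def)
    ultimately show False using \<alpha>0 by simp
  qed
  then have "psd_product n (1 + 4) (D 2 * N)"
    using nonscalar_psd_product_4[OF N dN] psdD psd_product_1 psd_product_mult by blast
  then show ?thesis unfolding DN by simp
qed

context
  fixes A T T1 R T2 :: "complex mat" and n k p :: nat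
  assumes tb: "triangular_block_form n A T k p T1 R T2"
begin

lemma blocks:
  shows T_carrier: "T \<in> carrier_mat n n" and T1_carrier: "T1 \<in> carrier_mat k k" and R_carrier: "R \<in> carrier_mat k p"
    and T2_carrier: "T2 \<in> carrier_mat p p" and T_blocks: "T = four_block_mat T1 R (0\<^sub>m p k) T2"
    and A_similar_T: "unitarily_similar n A T" and det_T1: "Determinant.det T1 \<noteq> 0" and n_eq: "n = k + p"
proof -
  show "T1 \<in> carrier_mat k k" "R \<in> carrier_mat k p" "T2 \<in> carrier_mat p p"
    and T_blocks: "T = four_block_mat T1 R (0\<^sub>m p k) T2" and A_similar_T: "unitarily_similar n A T"
    using tb unfolding triangular_block_form_def by blast+
  then show "Determinant.det T1 \<noteq> 0" using tb invertible_det unfolding triangular_block_form_def by blast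
  show T_carrier: "T \<in> carrier_mat n n" using A_similar_T unfolding unitarily_similar_def by blast
  have "T \<in> carrier_mat (k + p) (k + p)"
    unfolding T_blocks using tb unfolding triangular_block_form_def by (intro four_block_carrier_mat) auto
  then show "n = k + p" using T_carrier by auto
qed

lemma psd_product_block_form: "psd_product n j A \<longleftrightarrow> psd_product n j T"
  by (rule psd_product_unitarily_similar[OF A_similar_T])

lemma one_factor_iff: "psd_product n 1 A \<longleftrightarrow> nonneg_diagonal T"
proof
  assume "psd_product n 1 A"
  then have "psd n T" using psd_product_block_form psd_product_1 by blast
  moreover have "upper_triangular T" using tb unfolding triangular_block_form_def by blast
  ultimately show "nonneg_diagonal T" by (rule psd_upper_triangular)
next
  assume "nonneg_diagonal T"
  then have "psd n T" by (rule nonneg_diagonal_psd[OF T_carrier])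
  then show "psd_product n 1 A" using psd_product_block_form psd_product_1 by blast
qed

lemma three_factors:
  assumes "cond_3a k p R T2 \<or> cond_3b k p T1 R T2"
  shows "psd_product n 3 A"
proof -
  have "psd_product n 3 T"
  proof (cases "cond_3a k p R T2")
    case True
    obtain m where "T2 ^\<^sub>m m = 0\<^sub>m p p" using tb unfolding triangular_block_form_def by blast
    then obtain z where z: "z \<in> carrier_vec n" "T *\<^sub>v z = 0\<^sub>v n" "mat_adjoint T *\<^sub>v z \<noteq> 0\<^sub>v n"
      using kernel_not_adjoint_kernel[OF T1_carrier R_carrier T2_carrier det_T1] True unfolding cond_3a_def T_blocks n_eq by blast
    then show ?thesis using congruent_nonneg_of_kernel[OF T_carrier z] congruent_nonneg_psd_product_3 by blast
  next
    case False
    then have "cond_3b k p T1 R T2" using assms by blast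
    then show ?thesis unfolding T_blocks n_eq cond_3b_def using pd_product_3_pad_zero by blast
  qed
  then show ?thesis using psd_product_block_form by blast
qed

lemma cond_3a_iff: "cond_3a k p R T2 \<longleftrightarrow> T \<noteq> pad_zero k p T1"
proof
  assume a: "cond_3a k p R T2"
  show "T \<noteq> pad_zero k p T1"
  proof
    assume eq: "T = pad_zero k p T1"
    have "R $$ (i, j) = 0" if "i < k" "j < p" for i j
    proof -
      have "T $$ (i, j + k) = R $$ (i, j)" unfolding T_blocks using that T1_carrier R_carrier T2_carrier by simp
      moreover have "T $$ (i, j + k) = 0" unfolding eq using that T1_carrier by simp
      ultimately show ?thesis by simp
    qed
    then have "R = 0\<^sub>m k p" using R_carrier by (intro eq_matI) auto
    moreover have "T2 $$ (i, j) = 0" if "i < p" "j < p" for i j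
    proof -
      have "T $$ (i + k, j + k) = T2 $$ (i, j)" unfolding T_blocks using that T1_carrier R_carrier T2_carrier by simp
      moreover have "T $$ (i + k, j + k) = 0" unfolding eq using that T1_carrier by simp
      ultimately show ?thesis by simp
    qed
    then have "T2 = 0\<^sub>m p p" using T2_carrier by (intro eq_matI) auto
    ultimately show False using a unfolding cond_3a_def by blast
  qed
next
  assume "T \<noteq> pad_zero k p T1"
  then show "cond_3a k p R T2" unfolding T_blocks cond_3a_def by blast
qed

text \<open>Without the invertible block, the padded matrix would be zero and thus nonnegative diagonal.\<close>
lemma invertible_block_nonempty:
  assumes "\<not> nonneg_diagonal T" "\<not> cond_3a k p R T2"
  shows "0 < k"
proof (rule ccontr)
  assume "\<not> 0 < k"
  then have "T = 0\<^sub>m n n" using cond_3a_iff assms(2) T1_carrier n_eq by (intro eq_matI) auto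
  then show False using assms(1) by (simp add: nonneg_diagonal_def diagonal_mat_def)
qed

lemma cond_3b_iff:
  assumes "\<not> nonneg_diagonal T" "\<not> cond_3a k p R T2"
  shows "cond_3b k p T1 R T2 \<longleftrightarrow> cond_i T1 \<or> cond_ii T1"
  using pd_product_3_imp_cond[OF T1_carrier invertible_block_nonempty[OF assms]] pd_product_3_of_cond[OF T1_carrier det_T1] assms(2)
  unfolding cond_3a_def cond_3b_def by blast

lemma not_three_factors:
  assumes "\<not> cond_3a k p R T2" "\<not> cond_3b k p T1 R T2"
  shows "\<not> psd_product n 3 A"
proof
  assume "psd_product n 3 A"
  then have "psd_product (k + p) 3 (pad_zero k p T1)" using psd_product_block_form cond_3a_iff assms(1) n_eq by simp
  then have "pd_product k 3 T1" by (rule pad_zero_psd_product_3[OF T1_carrier det_T1])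
  then show False using assms unfolding cond_3a_def cond_3b_def by blast
qed

lemma four_factors:
  assumes A: "A \<in> carrier_mat n n" and det: "0 \<le> Determinant.det A"
    and ns: "\<not> (\<exists>\<alpha>. \<not> 0 \<le> \<alpha> \<and> A = \<alpha> \<cdot>\<^sub>m 1\<^sub>m n)"
    and nd: "\<not> nonneg_diagonal T" and a: "\<not> cond_3a k p R T2"
  shows "psd_product n 4 A"
proof (cases "p = 0")
  case True
  have "T = T1" using cond_3a_iff a T1_carrier True by (intro eq_matI) auto
  then have "Determinant.det A = Determinant.det T1"
    using det_similar[OF unitarily_similar_imp_similar[OF A_similar_T]] by simp
  then have "0 < Determinant.det A" using det_T1 det by (auto simp: order_less_le)
  moreover have "\<not> (\<exists>\<alpha>. A = \<alpha> \<cdot>\<^sub>m 1\<^sub>m n)"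
  proof
    assume "\<exists>\<alpha>. A = \<alpha> \<cdot>\<^sub>m 1\<^sub>m n"
    then obtain \<alpha> where "A = \<alpha> \<cdot>\<^sub>m 1\<^sub>m n" "0 \<le> \<alpha>" using ns by blast
    then show False using one_factor_iff nd psd_product_1 psd_scalar by blast
  qed
  ultimately show ?thesis using nonscalar_psd_product_4[OF A] by blast
next
  case False
  then have "psd_product n 4 T"
    using pad_zero_psd_product_4[OF T1_carrier invertible_block_nonempty[OF nd a], of p] cond_3a_iff a n_eq by simp
  then show ?thesis using psd_product_block_form by blast
qed

end

theorem mainTheorem2:
  fixes A :: "complex mat" and n :: nat
  assumes "0 < n" and "A \<in> carrier_mat n n" and "0 \<le> Determinant.det A"
  shows
    "((\<exists>\<alpha>. \<not> 0 \<le> \<alpha> \<and> A = \<alpha> \<cdot>\<^sub>m 1\<^sub>m n) \<longrightarrow> psd_product_not_fewer n 5 A) \<and>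
     (\<not> (\<exists>\<alpha>. \<not> 0 \<le> \<alpha> \<and> A = \<alpha> \<cdot>\<^sub>m 1\<^sub>m n) \<longrightarrow>
       (\<forall>T k p T1 R T2. triangular_block_form n A T k p T1 R T2 \<longrightarrow>
         (nonneg_diagonal T \<longrightarrow> psd n A) \<and>
         (\<not> nonneg_diagonal T \<and> cond_P n A \<longrightarrow> psd_product_not_fewer n 2 A) \<and>
         (\<not> nonneg_diagonal T \<and> \<not> cond_P n A \<and> (cond_3a k p R T2 \<or> cond_3b k p T1 R T2) \<longrightarrow>
           psd_product_not_fewer n 3 A) \<and>
         (cond_i T1 \<or> cond_ii T1 \<longrightarrow> pd_product k 3 T1) \<and>
         (\<not> nonneg_diagonal T \<and> \<not> cond_P n A \<longrightarrow>
           (\<not> (cond_3a k p R T2 \<or> cond_3b k p T1 R T2) \<longleftrightarrow>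
              T = four_block_mat T1 (0\<^sub>m k p) (0\<^sub>m p k) (0\<^sub>m p p) \<and> \<not> cond_i T1 \<and> \<not> cond_ii T1) \<and>
           (\<not> (cond_3a k p R T2 \<or> cond_3b k p T1 R T2) \<longrightarrow> psd_product_not_fewer n 4 A))))"
proof (intro conjI impI allI)
  note n = assms(1) and A = assms(2) and det = assms(3)
  have P_iff: "cond_P n A \<longleftrightarrow> psd_product n 2 A" by (rule cond_P_iff_psd_product_2[OF A])
  show "psd_product_not_fewer n 5 A" if "\<exists>\<alpha>. \<not> 0 \<le> \<alpha> \<and> A = \<alpha> \<cdot>\<^sub>m 1\<^sub>m n"
  proof -
    obtain \<alpha> where \<alpha>: "\<not> 0 \<le> \<alpha>" "A = \<alpha> \<cdot>\<^sub>m 1\<^sub>m n" using \<open>\<exists>\<alpha>. _\<close> by blast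
    have "\<not> psd_product n 4 A" using scalar_psd_product_4[OF n, of 4 \<alpha>] \<alpha> by auto
    moreover have "psd_product n (Suc 4) A" using scalar_psd_product_5[OF n \<alpha>(1)] det unfolding \<alpha>(2) by simp
    ultimately show ?thesis using psd_product_not_fewerI[of n 4 A] by simp
  qed
  fix T k p T1 R T2
  assume ns: "\<not> (\<exists>\<alpha>. \<not> 0 \<le> \<alpha> \<and> A = \<alpha> \<cdot>\<^sub>m 1\<^sub>m n)" and tb: "triangular_block_form n A T k p T1 R T2"
  note one = one_factor_iff[OF tb]
  show "psd n A" if "nonneg_diagonal T" using one that psd_product_1 by blast
  show "psd_product_not_fewer n 2 A" if "\<not> nonneg_diagonal T \<and> cond_P n A"
    using psd_product_not_fewerI[of n 1 A] one P_iff that by (simp add: numeral_2_eq_2)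
  show "psd_product_not_fewer n 3 A"
    if "\<not> nonneg_diagonal T \<and> \<not> cond_P n A \<and> (cond_3a k p R T2 \<or> cond_3b k p T1 R T2)"
    using psd_product_not_fewerI[of n 2 A] three_factors[OF tb] P_iff that by (simp add: eval_nat_numeral)
  show "pd_product k 3 T1" if "cond_i T1 \<or> cond_ii T1"
    by (rule pd_product_3_of_cond[OF T1_carrier[OF tb] det_T1[OF tb] that])
  show "\<not> (cond_3a k p R T2 \<or> cond_3b k p T1 R T2) \<longleftrightarrow>
      T = pad_zero k p T1 \<and> \<not> cond_i T1 \<and> \<not> cond_ii T1"
    if "\<not> nonneg_diagonal T \<and> \<not> cond_P n A"
    using cond_3a_iff[OF tb] cond_3b_iff[OF tb] that by blast
  show "psd_product_not_fewer n 4 A"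
    if "\<not> nonneg_diagonal T \<and> \<not> cond_P n A" "\<not> (cond_3a k p R T2 \<or> cond_3b k p T1 R T2)"
    using psd_product_not_fewerI[of n 3 A] four_factors[OF tb A det ns] not_three_factors[OF tb] that by simp
qed

end
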